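(* Fix $\chi\in\mathcal{E}$ and $\ell\in[0,1]$. Assume: (1) $r$ and $\sigma_\varepsilon^2$ are continuous on a neighborhood of $\chi$, $F(0)=0$, and $\varphi(t):=E[r(\mathcal{X})-r(\chi)\mid \|\mathcal{X}-\chi\|=t]$ is differentiable at $t=0$; (2) $K$ is a nonnegative bounded kernel with support $[0,1]$ and $\inf_{t\in[0,1]}K(t)>0$; (3) for every $s\in[0,1]$, $\tau_h(s):=F(hs)/F(h)\to\tau_0(s)<\infty$ as $h\to0$; (4) as $n\to\infty$, $h_n\to0$, $nF(h_n)\to\infty$, $A_{n,\ell}:=\frac1n\sum_{i=1}^n\frac{h_i}{h_n}\left[\frac{F(h_i)}{F(h_n)}\right]^{1-\ell}\to\alpha_{[\ell]}<\infty$, and for every real $q\le 2$, $B_{n,q}:=\frac1n\sum_{i=1}^n\left[\frac{F(h_i)}{F(h_n)}\right]^q\to\beta_{[q]}<\infty$. Then, as $n\to\infty$, $$E\left[r_n^{[\ell]}(\chi)\right]-r(\chi)=\varphi'(0)\frac{\alpha_{[\ell]}}{\beta_{[1-\ell]}}\frac{M_0}{M_1}h_n[1+o(1)]+O\left[\frac{1}{nF(h_n)}\right],$$ $$\mathrm{Var}\left[r_n^{[\ell]}(\chi)\right]=\frac{\beta_{[1-2\ell]}}{\beta_{[1-\ell]}^2}\frac{M_2}{M_1^2}\sigma_\varepsilon^2(\chi)\frac{1}{nF(h_n)}[1+o(1)].$$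
   Context: $\mathcal{E}$ is a Banach space endowed with a semi-norm $\|\cdot\|$ (neighborhoods and balls are taken with respect to $\|\cdot\|$). $(\mathcal{X},Y)$ is a random pair with values in $\mathcal{E}\times\mathbb{R}$ and $(\mathcal{X}_i,Y_i)_{i\ge1}$ are i.i.d. copies of it. The model is $Y_i=r(\mathcal{X}_i)+\varepsilon_i$ with $r(\chi)=E(Y\mid\mathcal{X}=\chi)$, $E(\varepsilon_i\mid\mathcal{X}_i)=0$ and $E(\varepsilon_i^2\mid\mathcal{X}_i)=\sigma_\varepsilon^2(\mathcal{X}_i)<\infty$. $F(t)=P(\|\chi-\mathcal{X}\|\le t)$, and $(h_n)$ is a sequence of positive bandwidths. The estimator is $$r_n^{[\ell]}(\chi)=\frac{\sum_{i=1}^n\frac{Y_i}{F(h_i)^\ell}K\left(\frac{\|\chi-\mathcal{X}_i\|}{h_i}\right)}{\sum_{i=1}^n\frac{1}{F(h_i)^\ell}K\left(\frac{\|\chi-\mathcal{X}_i\|}{h_i}\right)}$$ (with $0/0=0$). $K$ is differentiable on $[0,1]$ with integrable derivative, and $M_0=K(1)-\int_0^1(sK(s))'\tau_0(s)\,ds$, $M_1=K(1)-\int_0^1K'(s)\tau_0(s)\,ds$, $M_2=K^2(1)-\int_0^1(K^2(s))'\tau_0(s)\,ds$.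
   Formalization: Adds that E[Y²; ‖χ−X‖≤h_i] is finite for every i (otherwise Var[r_n] is infinite for all large n), and reads c·g_n[1+o(1)] as o(g_n) when the constant c is 0, the literal reading being false. *)

theory Defs
  imports "HOL-Probability.Probability" "HOL-Library.Landau_Symbols"
begin

definition is_seminorm :: "('e::real_vector \<Rightarrow> real) \<Rightarrow> bool" where
  "is_seminorm p \<longleftrightarrow>
     (\<forall>x y. p (x + y) \<le> p x + p y) \<and> (\<forall>c x. p (c *\<^sub>R x) = \<bar>c\<bar> * p x)"

(* Both the neighbourhood (a ball, which is open) and continuity refer to the topology
   induced by the seminorm p, not to the norm topology of the Banach space. *)
definition continuous_near :: "('e::real_vector \<Rightarrow> real) \<Rightarrow> 'e \<Rightarrow> ('e \<Rightarrow> real) \<Rightarrow> bool" where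
  "continuous_near p chi f \<longleftrightarrow>
     (\<exists>\<delta>>0. \<forall>x. p (x - chi) < \<delta> \<longrightarrow>
        (\<forall>e>0. \<exists>d>0. \<forall>y. p (y - x) < d \<longrightarrow> \<bar>f y - f x\<bar> < e))"

definition sigma_gen :: "'w measure \<Rightarrow> ('w \<Rightarrow> 'b::topological_space) \<Rightarrow> 'w measure" where
  "sigma_gen M Z = vimage_algebra (space M) Z borel"

definition small_ball ::
  "'w measure \<Rightarrow> ('e::real_vector \<Rightarrow> real) \<Rightarrow> ('w \<Rightarrow> 'e) \<Rightarrow> 'e \<Rightarrow> real \<Rightarrow> real" where
  "small_ball M p X chi t = measure M {\<omega> \<in> space M. p (chi - X \<omega>) \<le> t}"

(* The convention 0/0 = 0 for the ratio is that of HOL division. *)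
definition recursive_estimator ::
  "('e::real_vector \<Rightarrow> real) \<Rightarrow> (real \<Rightarrow> real) \<Rightarrow> (real \<Rightarrow> real) \<Rightarrow> (nat \<Rightarrow> real) \<Rightarrow> real \<Rightarrow>
   (nat \<Rightarrow> 'w \<Rightarrow> 'e) \<Rightarrow> (nat \<Rightarrow> 'w \<Rightarrow> real) \<Rightarrow> 'e \<Rightarrow> nat \<Rightarrow> 'w \<Rightarrow> real" where
  "recursive_estimator p F K h l Xs Ys chi n \<omega> =
     (\<Sum>i=1..n. Ys i \<omega> / F (h i) powr l * K (p (chi - Xs i \<omega>) / h i)) /
     (\<Sum>i=1..n. 1 / F (h i) powr l * K (p (chi - Xs i \<omega>) / h i))"

(* Derivative relative to the unit interval, hence one-sided at the end points. *)
definition deriv01 :: "(real \<Rightarrow> real) \<Rightarrow> real \<Rightarrow> real" where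
  "deriv01 f s = vector_derivative f (at s within {0..1})"

definition M0 :: "(real \<Rightarrow> real) \<Rightarrow> (real \<Rightarrow> real) \<Rightarrow> real" where
  "M0 K \<tau> = K 1 - (LBINT s:{0..1}. deriv01 (\<lambda>s. s * K s) s * \<tau> s)"

definition M1 :: "(real \<Rightarrow> real) \<Rightarrow> (real \<Rightarrow> real) \<Rightarrow> real" where
  "M1 K \<tau> = K 1 - (LBINT s:{0..1}. deriv01 K s * \<tau> s)"

definition M2 :: "(real \<Rightarrow> real) \<Rightarrow> (real \<Rightarrow> real) \<Rightarrow> real" where
  "M2 K \<tau> = (K 1)\<^sup>2 - (LBINT s:{0..1}. deriv01 (\<lambda>s. (K s)\<^sup>2) s * \<tau> s)"

definition A_avg :: "(real \<Rightarrow> real) \<Rightarrow> (nat \<Rightarrow> real) \<Rightarrow> real \<Rightarrow> nat \<Rightarrow> real" where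
  "A_avg F h l n = 1 / real n * (\<Sum>i=1..n. h i / h n * (F (h i) / F (h n)) powr (1 - l))"

definition B_avg :: "(real \<Rightarrow> real) \<Rightarrow> (nat \<Rightarrow> real) \<Rightarrow> real \<Rightarrow> nat \<Rightarrow> real" where
  "B_avg F h q n = 1 / real n * (\<Sum>i=1..n. (F (h i) / F (h n)) powr q)"

(* f = c * g * [1 + o(1)].  For c = 0 this notation is read in the usual way, as f = o(g);
   asymptotic equivalence to 0 would instead force f to vanish eventually. *)
definition leading_term :: "(nat \<Rightarrow> real) \<Rightarrow> real \<Rightarrow> (nat \<Rightarrow> real) \<Rightarrow> bool" where
  "leading_term f c g \<longleftrightarrow>
     (if c = 0 then f \<in> o(g)
      else (\<exists>\<delta>. \<delta> \<longlonglongrightarrow> 0 \<and> (\<forall>\<^sub>F n in sequentially. f n = c * g n * (1 + \<delta> n))))"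

end

theory Submission
  imports Defs
begin

text \<open>The estimator is a weighted mean of the \<open>Y\<^sub>i\<close> whose weights depend only on the distances
  \<open>\<rho>\<^sub>i = p (chi - X\<^sub>i)\<close>, so everything can be conditioned on the \<open>\<rho>\<^sub>i\<close>: with \<open>Z\<^sub>i = Y\<^sub>i - r chi\<close>,
  replacing \<open>Z\<^sub>i\<close> by \<open>\<phi> \<rho>\<^sub>i\<close> does not change the mean of the weighted sum, and it changes its second
  moment by \<open>\<Sum>\<^sub>i E [w\<^sub>i\<^sup>2 (Z\<^sub>i\<^sup>2 - (\<phi> \<rho>\<^sub>i)\<^sup>2)]\<close>, which is asymptotically
  \<open>\<sigma>2 chi \<cdot> \<Sum>\<^sub>i E w\<^sub>i\<^sup>2\<close>. The weighted sum of the \<open>\<phi> \<rho>\<^sub>i\<close> is linearized around the quotient of the means;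
  its variance is \<open>o(1 / (n F (h n)))\<close> because \<open>\<phi>\<close> vanishes at \<open>0\<close>. Small denominators are excluded
  by an exponential lower tail bound for sums of nonnegative variables. Averages such as
  \<open>A_avg\<close> and \<open>B_avg\<close> forget their first terms since their convergence alone forces the underlying
  partial sums to diverge, by comparison with the harmonic series.\<close>

section \<open>Weighted averages and sums of independent variables\<close>

lemma weighted_Cesaro:
  fixes s y :: "nat \<Rightarrow> real"
  assumes s_pos: "\<And>i. i \<ge> 1 \<Longrightarrow> s i > 0"
    and lim: "(\<lambda>n. 1 / real n * (\<Sum>i=1..n. s i / s n)) \<longlonglongrightarrow> \<gamma>"
    and y: "y \<longlonglongrightarrow> L"
  shows "(\<lambda>n. 1 / real n * (\<Sum>i=1..n. s i / s n * y i)) \<longlonglongrightarrow> \<gamma> * L"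
proof -
  define S where "S n = (\<Sum>i=1..n. s i)" for n
  have S_mono: "S m \<le> S n" if "m \<le> n" for m n
    unfolding S_def using that s_pos by (intro sum_mono2) (auto intro: less_imp_le)
  have S_pos: "S n > 0" if "n \<ge> 1" for n
    unfolding S_def using that s_pos by (intro sum_pos) auto
  have avg: "1 / real n * (\<Sum>i=1..n. s i / s n) = S n / (real n * s n)" for n
    by (simp add: S_def sum_divide_distrib [symmetric])
  have S_top: "filterlim S at_top sequentially"
  proof (rule ccontr)
    assume not_top: "\<not> filterlim S at_top sequentially"
    have "\<exists>C. \<forall>n. S n \<le> C"
    proof (rule ccontr)
      assume "\<nexists>C. \<forall>n. S n \<le> C"
      then have "\<exists>n. S n > C" for C
        by (meson not_le_imp_less)
      then have "eventually (\<lambda>n. S n \<ge> C) sequentially" for C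
        by (metis S_mono eventually_at_top_linorderI less_imp_le order.trans)
      with not_top show False
        by (simp add: filterlim_at_top)
    qed
    then obtain C where C: "\<And>n. S n \<le> C" by blast
    have "summable (\<lambda>n. s (Suc n))"
    proof (rule bounded_imp_summable)
      show "(\<Sum>k\<le>n. s (Suc k)) \<le> C" for n
        using C [of "Suc n"]
        by (simp add: S_def lessThan_Suc_atMost [symmetric] sum.atLeast1_atMost_eq)
    qed (use s_pos in \<open>auto intro: less_imp_le\<close>)
    then have sum_s: "summable s"
      by (simp add: summable_Suc_iff)
    define A where "A = \<bar>\<gamma>\<bar> + 1"
    have A_pos: "A > 0" by (simp add: A_def)
    have "\<forall>\<^sub>F n in sequentially. S n / (real n * s n) < A"
      using order_tendstoD(2) [OF lim [unfolded avg], of A] by (simp add: A_def)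
    then have "\<forall>\<^sub>F n in sequentially. norm (inverse (real n)) \<le> A / s 1 * s n"
      using eventually_ge_at_top [of 1]
    proof eventually_elim
      case (elim n)
      then have "S n < A * (real n * s n)"
        using s_pos [of n] by (simp add: pos_divide_less_eq)
      moreover have "s 1 \<le> S n"
        using S_mono [of 1 n] elim by (simp add: S_def)
      ultimately have "s 1 \<le> A * (real n * s n)" by simp
      then show ?case
        using elim s_pos [of 1] by (simp add: field_simps)
    qed
    then have "summable (\<lambda>n. inverse (real n))"
      by (rule summable_comparison_test_ev) (intro summable_mult sum_s)
    then show False
      using not_summable_harmonic by blast
  qed
  have "(\<lambda>n. (\<Sum>i=1..n. s i * (y i - L)) / S n) \<longlonglongrightarrow> 0"
  proof (rule LIMSEQ_I)
    fix e :: real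
    assume e: "e > 0"
    then obtain n0 where n0: "\<And>n. n \<ge> n0 \<Longrightarrow> \<bar>y n - L\<bar> < e / 2"
      using LIMSEQ_D [OF y, of "e / 2"] by auto
    define C where "C = (\<Sum>i=1..n0. s i * \<bar>y i - L\<bar>)"
    have "\<forall>\<^sub>F n in sequentially. S n > 2 * C / e"
      using S_top by (simp add: filterlim_at_top_dense)
    then have "\<forall>\<^sub>F n in sequentially. norm ((\<Sum>i=1..n. s i * (y i - L)) / S n - 0) < e"
      using eventually_ge_at_top [of "max 1 n0"]
    proof eventually_elim
      case (elim n)
      then have n: "n \<ge> 1" "n0 \<le> n" by auto
      have "\<bar>\<Sum>i=1..n. s i * (y i - L)\<bar> \<le> (\<Sum>i=1..n. s i * \<bar>y i - L\<bar>)"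
        by (rule order.trans [OF sum_abs])
           (auto intro!: sum_mono simp: abs_mult s_pos less_imp_le)
      also have "\<dots> \<le> (\<Sum>i=1..n. (if i \<le> n0 then s i * \<bar>y i - L\<bar> else 0) + s i * (e / 2))"
      proof (rule sum_mono)
        fix i assume "i \<in> {1..n}"
        then have "s i > 0" using s_pos by auto
        then show "s i * \<bar>y i - L\<bar> \<le> (if i \<le> n0 then s i * \<bar>y i - L\<bar> else 0) + s i * (e / 2)"
          using n0 [of i] e by (auto intro!: mult_left_mono)
      qed
      also have "\<dots> = C + S n * (e / 2)"
      proof -
        have "(\<Sum>i=1..n. if i \<le> n0 then s i * \<bar>y i - L\<bar> else 0) = C"
          unfolding C_def by (rule sum.mono_neutral_cong_right) (use n in auto)
        then show ?thesis by (simp add: sum.distrib S_def sum_distrib_right)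
      qed
      finally show ?case
        using elim(1) S_pos [of n] n e by (simp add: field_simps)
    qed
    then show "\<exists>no. \<forall>n\<ge>no. norm ((\<Sum>i=1..n. s i * (y i - L)) / S n - 0) < e"
      by (simp add: eventually_sequentially)
  qed
  then have "(\<lambda>n. S n / (real n * s n) * (L + (\<Sum>i=1..n. s i * (y i - L)) / S n))
     \<longlonglongrightarrow> \<gamma> * (L + 0)"
    using tendsto_mult [OF lim [unfolded avg] tendsto_add [OF tendsto_const]] by blast
  moreover have "\<forall>\<^sub>F n in sequentially.
      S n / (real n * s n) * (L + (\<Sum>i=1..n. s i * (y i - L)) / S n) =
      1 / real n * (\<Sum>i=1..n. s i / s n * y i)"
    using eventually_ge_at_top [of 1]
  proof eventually_elim
    case (elim n)
    have "(\<Sum>i=1..n. s i * (y i - L)) = (\<Sum>i=1..n. s i * y i) - L * S n"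
      by (simp add: S_def algebra_simps sum_subtractf sum_distrib_left)
    then have "S n * (L + (\<Sum>i=1..n. s i * (y i - L)) / S n) = (\<Sum>i=1..n. s i * y i)"
      using S_pos [OF elim] by (simp add: field_simps)
    then show ?case
      by (simp add: sum_divide_distrib [symmetric])
  qed
  ultimately have "(\<lambda>n. 1 / real n * (\<Sum>i=1..n. s i / s n * y i)) \<longlonglongrightarrow> \<gamma> * (L + 0)"
    by (rule Lim_transform_eventually)
  then show ?thesis by simp
qed

lemma exp_neg_le_quadratic:
  fixes u :: real
  assumes "u \<ge> 0"
  shows "exp (- u) \<le> 1 - u + u\<^sup>2 / 2"
proof -
  have "(\<lambda>u. 1 - u + u\<^sup>2 / 2 - exp (- u)) 0 \<le> (\<lambda>u. 1 - u + u\<^sup>2 / 2 - exp (- u)) u"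
  proof (rule DERIV_nonneg_imp_nondecreasing [OF assms])
    fix x :: real assume "0 \<le> x"
    have "((\<lambda>u. 1 - u + u\<^sup>2 / 2 - exp (- u)) has_real_derivative (x - 1 + exp (- x))) (at x)"
      by (auto intro!: derivative_eq_intros)
    moreover have "x - 1 + exp (- x) \<ge> 0"
      using exp_ge_add_one_self [of "- x"] by simp
    ultimately show "\<exists>y. ((\<lambda>u. 1 - u + u\<^sup>2 / 2 - exp (- u)) has_real_derivative y) (at x) \<and> 0 \<le> y"
      by blast
  qed
  then show ?thesis by simp
qed

lemma Cauchy_Schwarz_integral:
  fixes f g :: "'a \<Rightarrow> real"
  assumes [measurable]: "f \<in> borel_measurable M" "g \<in> borel_measurable M"
    and f2: "integrable M (\<lambda>x. (f x)\<^sup>2)" and g2: "integrable M (\<lambda>x. (g x)\<^sup>2)"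
  shows "integrable M (\<lambda>x. f x * g x)"
    and "(\<integral>x. \<bar>f x * g x\<bar> \<partial>M)\<^sup>2 \<le> (\<integral>x. (f x)\<^sup>2 \<partial>M) * (\<integral>x. (g x)\<^sup>2 \<partial>M)"
proof -
  show fg: "integrable M (\<lambda>x. f x * g x)"
  proof (rule Bochner_Integration.integrable_bound [OF Bochner_Integration.integrable_add [OF f2 g2]])
    show "AE x in M. norm (f x * g x) \<le> norm ((f x)\<^sup>2 + (g x)\<^sup>2)"
    proof (rule AE_I2)
      fix x
      have "0 \<le> (\<bar>f x\<bar> - \<bar>g x\<bar>)\<^sup>2" "0 \<le> \<bar>f x\<bar> * \<bar>g x\<bar>" by simp_all
      then show "norm (f x * g x) \<le> norm ((f x)\<^sup>2 + (g x)\<^sup>2)"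
        unfolding power2_diff real_norm_def abs_mult power2_abs by linarith
    qed
  qed simp
  define A B I where "A = (\<integral>x. (f x)\<^sup>2 \<partial>M)" "B = (\<integral>x. (g x)\<^sup>2 \<partial>M)" "I = (\<integral>x. \<bar>f x * g x\<bar> \<partial>M)"
  have quad: "0 \<le> A * t\<^sup>2 - 2 * I * t + B" for t
  proof -
    have "0 \<le> (\<integral>x. (\<bar>f x\<bar> * t - \<bar>g x\<bar>)\<^sup>2 \<partial>M)"
      by simp
    also have "\<dots> = (\<integral>x. (f x)\<^sup>2 * t\<^sup>2 - 2 * t * \<bar>f x * g x\<bar> + (g x)\<^sup>2 \<partial>M)"
      by (intro Bochner_Integration.integral_cong refl) (simp add: power2_diff abs_mult power_mult_distrib)
    also have "\<dots> = A * t\<^sup>2 - 2 * I * t + B"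
      using f2 g2 fg by (simp add: A_B_I_def)
    finally show ?thesis .
  qed
  have "A \<ge> 0" "I \<ge> 0" "B \<ge> 0" by (simp_all add: A_B_I_def)
  have "I\<^sup>2 \<le> A * B"
  proof (cases "A = 0")
    case True
    have "I = 0"
    proof (rule ccontr)
      assume "I \<noteq> 0"
      with quad [of "(B + 1) / (2 * I)"] True show False by simp
    qed
    with True show ?thesis by simp
  next
    case False
    with \<open>A \<ge> 0\<close> have "A > 0" by simp
    with quad [of "I / A"] show ?thesis
      by (simp add: field_simps power2_eq_square)
  qed
  then show "(\<integral>x. \<bar>f x * g x\<bar> \<partial>M)\<^sup>2 \<le> (\<integral>x. (f x)\<^sup>2 \<partial>M) * (\<integral>x. (g x)\<^sup>2 \<partial>M)"
    by (simp add: A_B_I_def)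
qed

lemma
  fixes f :: "'a \<Rightarrow> real"
  assumes "prob_space Q" "i \<in> I" and [measurable]: "f \<in> borel_measurable Q"
  shows integral_PiM_component: "(\<integral>x. f (x i) \<partial>PiM I (\<lambda>_. Q)) = (\<integral>y. f y \<partial>Q)"
    and integrable_PiM_component: "integrable (PiM I (\<lambda>_. Q)) (\<lambda>x. f (x i)) \<longleftrightarrow> integrable Q f"
proof -
  have D: "distr (PiM I (\<lambda>_. Q)) Q (\<lambda>x. x i) = Q"
    using assms by (intro distr_PiM_component) auto
  have [measurable]: "(\<lambda>x. x i) \<in> measurable (PiM I (\<lambda>_. Q)) Q"
    using assms(2) by simp
  show "(\<integral>x. f (x i) \<partial>PiM I (\<lambda>_. Q)) = (\<integral>y. f y \<partial>Q)"
    using integral_distr [of "\<lambda>x. x i" "PiM I (\<lambda>_. Q)" Q f] by (simp add: D)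
  show "integrable (PiM I (\<lambda>_. Q)) (\<lambda>x. f (x i)) \<longleftrightarrow> integrable Q f"
    using integrable_distr_eq [of "\<lambda>x. x i" "PiM I (\<lambda>_. Q)" Q f] by (simp add: D)
qed

lemma integral_PiM_components_mult:
  fixes f g :: "'a \<Rightarrow> real"
  assumes "prob_space Q" "finite I" "i \<in> I" "j \<in> I" "i \<noteq> j" "integrable Q f" "integrable Q g"
  shows "integrable (PiM I (\<lambda>_. Q)) (\<lambda>x. f (x i) * g (x j))"
    and "(\<integral>x. f (x i) * g (x j) \<partial>PiM I (\<lambda>_. Q)) = (\<integral>y. f y \<partial>Q) * (\<integral>y. g y \<partial>Q)"
proof -
  interpret Q: prob_space Q by fact
  interpret product_sigma_finite "\<lambda>_. Q"
    by unfold_locales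
  define F where "F k = (if k = i then f else if k = j then g else (\<lambda>_. 1))" for k
  have F_int: "integrable Q (F k)" for k
    using assms by (simp add: F_def)
  have eq: "(\<Prod>k\<in>I. if k = i then a else if k = j then b else 1) = a * b" for a b :: real
    using assms(2-5)
    by (simp add: prod.remove [of I i] prod.remove [of "I - {i}" j])
  have *: "(\<Prod>k\<in>I. F k (x k)) = f (x i) * g (x j)" for x
    by (subst eq [symmetric], rule prod.cong) (auto simp: F_def)
  have **: "(\<Prod>k\<in>I. \<integral>y. F k y \<partial>Q) = (\<integral>y. f y \<partial>Q) * (\<integral>y. g y \<partial>Q)"
    by (subst eq [symmetric], rule prod.cong) (auto simp: F_def Q.prob_space)
  show "integrable (PiM I (\<lambda>_. Q)) (\<lambda>x. f (x i) * g (x j))"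
    using product_integrable_prod [of I F, OF assms(2) F_int] by (simp add: *)
  show "(\<integral>x. f (x i) * g (x j) \<partial>PiM I (\<lambda>_. Q)) = (\<integral>y. f y \<partial>Q) * (\<integral>y. g y \<partial>Q)"
    using product_integral_prod [of I F, OF assms(2) F_int] by (simp add: * **)
qed

lemma variance_sum_PiM_le:
  fixes f :: "'i \<Rightarrow> 'a \<Rightarrow> real"
  assumes "prob_space Q" "finite I"
    and meas [measurable]: "\<And>i. i \<in> I \<Longrightarrow> f i \<in> borel_measurable Q"
    and sq: "\<And>i. i \<in> I \<Longrightarrow> integrable Q (\<lambda>y. (f i y)\<^sup>2)"
  shows "integrable (PiM I (\<lambda>_. Q)) (\<lambda>x. ((\<Sum>i\<in>I. f i (x i)) - (\<Sum>i\<in>I. \<integral>y. f i y \<partial>Q))\<^sup>2)"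
    and "(\<integral>x. ((\<Sum>i\<in>I. f i (x i)) - (\<Sum>i\<in>I. \<integral>y. f i y \<partial>Q))\<^sup>2 \<partial>PiM I (\<lambda>_. Q))
           \<le> (\<Sum>i\<in>I. \<integral>y. (f i y)\<^sup>2 \<partial>Q)"
proof -
  interpret Q: prob_space Q by fact
  have int: "integrable Q (f i)" if "i \<in> I" for i
    using Q.square_integrable_imp_integrable [OF meas sq] that by simp
  define g where "g i y = f i y - (\<integral>y. f i y \<partial>Q)" for i y
  have g_sq: "integrable Q (\<lambda>y. (g i y)\<^sup>2)" if "i \<in> I" for i
    using that int sq by (simp add: g_def power2_diff)
  have g_int: "integrable Q (g i)" if "i \<in> I" for i
    using that int by (simp add: g_def [abs_def])
  have g0: "(\<integral>y. g i y \<partial>Q) = 0" if "i \<in> I" for i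
    using that int by (simp add: g_def Q.prob_space)
  have g_le: "(\<integral>y. (g i y)\<^sup>2 \<partial>Q) \<le> (\<integral>y. (f i y)\<^sup>2 \<partial>Q)" if "i \<in> I" for i
    using Q.variance_eq [OF int sq, of i] that by (simp add: g_def)
  have eq: "((\<Sum>i\<in>I. f i (x i)) - (\<Sum>i\<in>I. \<integral>y. f i y \<partial>Q))\<^sup>2
      = (\<Sum>i\<in>I. \<Sum>j\<in>I. g i (x i) * g j (x j))" for x
    by (simp add: g_def sum_subtractf [symmetric] power2_eq_square sum_product)
  have term_int: "integrable (PiM I (\<lambda>_. Q)) (\<lambda>x. g i (x i) * g j (x j))"
    if "i \<in> I" "j \<in> I" for i j
  proof (cases "i = j")
    case True
    have "integrable (PiM I (\<lambda>_. Q)) (\<lambda>x. (g i (x i))\<^sup>2)"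
      using that g_sq assms(1)
      by (subst integrable_PiM_component [where f = "\<lambda>y. (g i y)\<^sup>2"]) auto
    with True show ?thesis by (simp add: power2_eq_square)
  next
    case False
    then show ?thesis
      using that assms g_int by (intro integral_PiM_components_mult) auto
  qed
  then show "integrable (PiM I (\<lambda>_. Q)) (\<lambda>x. ((\<Sum>i\<in>I. f i (x i)) - (\<Sum>i\<in>I. \<integral>y. f i y \<partial>Q))\<^sup>2)"
    unfolding eq by (intro Bochner_Integration.integrable_sum) auto
  have "(\<integral>x. ((\<Sum>i\<in>I. f i (x i)) - (\<Sum>i\<in>I. \<integral>y. f i y \<partial>Q))\<^sup>2 \<partial>PiM I (\<lambda>_. Q))
      = (\<Sum>i\<in>I. \<Sum>j\<in>I. \<integral>x. g i (x i) * g j (x j) \<partial>PiM I (\<lambda>_. Q))"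
    unfolding eq using term_int by (simp add: Bochner_Integration.integral_sum)
  also have "\<dots> = (\<Sum>i\<in>I. \<Sum>j\<in>I. if i = j then \<integral>y. (g i y)\<^sup>2 \<partial>Q else 0)"
  proof (intro sum.cong refl)
    fix i j assume ij: "i \<in> I" "j \<in> I"
    show "(\<integral>x. g i (x i) * g j (x j) \<partial>PiM I (\<lambda>_. Q)) = (if i = j then \<integral>y. (g i y)\<^sup>2 \<partial>Q else 0)"
    proof (cases "i = j")
      case True
      have "(\<integral>x. (g i (x i))\<^sup>2 \<partial>PiM I (\<lambda>_. Q)) = (\<integral>y. (g i y)\<^sup>2 \<partial>Q)"
        using ij g_int assms(1)
        by (subst integral_PiM_component [where f = "\<lambda>y. (g i y)\<^sup>2"]) auto
      with True show ?thesis by (simp add: power2_eq_square)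
    next
      case False
      then show ?thesis
        using ij assms g_int by (subst integral_PiM_components_mult) (auto simp: g0)
    qed
  qed
  also have "\<dots> \<le> (\<Sum>i\<in>I. \<integral>y. (f i y)\<^sup>2 \<partial>Q)"
    using assms(2) g_le by (auto intro!: sum_mono)
  finally show "(\<integral>x. ((\<Sum>i\<in>I. f i (x i)) - (\<Sum>i\<in>I. \<integral>y. f i y \<partial>Q))\<^sup>2 \<partial>PiM I (\<lambda>_. Q))
           \<le> (\<Sum>i\<in>I. \<integral>y. (f i y)\<^sup>2 \<partial>Q)" .
qed

text \<open>For nonnegative summands \<open>exp (- u) \<le> 1 - u + u\<^sup>2 / 2\<close> bounds the Laplace transform, so second moments
  suffice.\<close>

lemma lower_tail_sum_PiM:
  fixes g :: "'i \<Rightarrow> 'a \<Rightarrow> real"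
  assumes "prob_space Q" "finite I"
    and meas [measurable]: "\<And>i. i \<in> I \<Longrightarrow> g i \<in> borel_measurable Q"
    and nonneg: "\<And>i y. i \<in> I \<Longrightarrow> g i y \<ge> 0"
    and sq: "\<And>i. i \<in> I \<Longrightarrow> integrable Q (\<lambda>y. (g i y)\<^sup>2)"
    and "c \<ge> 0"
  shows "measure (PiM I (\<lambda>_. Q)) {x \<in> space (PiM I (\<lambda>_. Q)). (\<Sum>i\<in>I. g i (x i)) \<le> t}
    \<le> exp (c * t - c * (\<Sum>i\<in>I. \<integral>y. g i y \<partial>Q) + c\<^sup>2 / 2 * (\<Sum>i\<in>I. \<integral>y. (g i y)\<^sup>2 \<partial>Q))"
proof -
  interpret Q: prob_space Q by fact
  interpret product_sigma_finite "\<lambda>_. Q"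
    by unfold_locales
  let ?P = "PiM I (\<lambda>_. Q)"
  interpret P: prob_space ?P
    by (intro prob_space_PiM) (rule assms(1))
  let ?S = "\<lambda>x. \<Sum>i\<in>I. g i (x i)"
  have [measurable]: "?S \<in> borel_measurable ?P" by measurable
  have int: "integrable Q (g i)" if "i \<in> I" for i
    using Q.square_integrable_imp_integrable [OF meas sq] that by simp
  have exp_int: "integrable Q (\<lambda>y. exp (- (c * g i y)))" if "i \<in> I" for i
    using that nonneg \<open>c \<ge> 0\<close> by (intro Q.integrable_const_bound [where B = 1]) auto
  have exp_le: "(\<integral>y. exp (- (c * g i y)) \<partial>Q)
      \<le> exp (- c * (\<integral>y. g i y \<partial>Q) + c\<^sup>2 / 2 * (\<integral>y. (g i y)\<^sup>2 \<partial>Q))" if i: "i \<in> I" for i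
  proof -
    have "(\<integral>y. exp (- (c * g i y)) \<partial>Q) \<le> (\<integral>y. 1 - c * g i y + (c * g i y)\<^sup>2 / 2 \<partial>Q)"
      using i int sq exp_int nonneg \<open>c \<ge> 0\<close>
      by (intro integral_mono exp_neg_le_quadratic) (auto simp: power_mult_distrib)
    also have "\<dots> = 1 + (- c * (\<integral>y. g i y \<partial>Q) + c\<^sup>2 / 2 * (\<integral>y. (g i y)\<^sup>2 \<partial>Q))"
      using i int sq by (simp add: power_mult_distrib Q.prob_space)
    also have "\<dots> \<le> exp (- c * (\<integral>y. g i y \<partial>Q) + c\<^sup>2 / 2 * (\<integral>y. (g i y)\<^sup>2 \<partial>Q))"
      by (rule exp_ge_add_one_self)
    finally show ?thesis .
  qed
  have exp_sum: "exp (- (c * ?S x)) = (\<Prod>i\<in>I. exp (- (c * g i (x i))))" for x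
    using assms(2) by (simp add: exp_sum [symmetric] sum_negf sum_distrib_left)
  have exp_S_int: "integrable ?P (\<lambda>x. exp (- (c * ?S x)))"
    unfolding exp_sum using exp_int
    by (intro product_integrable_prod [where f = "\<lambda>i y. exp (- (c * g i y))"] assms)
  have "measure ?P {x \<in> space ?P. ?S x \<le> t} = (\<integral>x. indicator {x \<in> space ?P. ?S x \<le> t} x \<partial>?P)"
    by simp
  also have "\<dots> \<le> (\<integral>x. exp (c * t) * exp (- (c * ?S x)) \<partial>?P)"
  proof (rule integral_mono)
    show "integrable ?P (\<lambda>x. exp (c * t) * exp (- (c * ?S x)))"
      using exp_S_int by simp
    show "indicator {x \<in> space ?P. ?S x \<le> t} x \<le> exp (c * t) * exp (- (c * ?S x))" for x
      using \<open>c \<ge> 0\<close>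
      by (auto simp: indicator_def exp_add [symmetric] mult_left_mono)
  qed (simp add: P.emeasure_eq_measure)
  also have "\<dots> = exp (c * t) * (\<Prod>i\<in>I. \<integral>y. exp (- (c * g i y)) \<partial>Q)"
    unfolding exp_sum using exp_int assms(2)
    by (simp add: product_integral_prod [where f = "\<lambda>i y. exp (- (c * g i y))"])
  also have "\<dots> \<le> exp (c * t) *
      (\<Prod>i\<in>I. exp (- c * (\<integral>y. g i y \<partial>Q) + c\<^sup>2 / 2 * (\<integral>y. (g i y)\<^sup>2 \<partial>Q)))"
    using exp_le by (intro mult_left_mono prod_mono) auto
  also have "\<dots> = exp (c * t - c * (\<Sum>i\<in>I. \<integral>y. g i y \<partial>Q) + c\<^sup>2 / 2 * (\<Sum>i\<in>I. \<integral>y. (g i y)\<^sup>2 \<partial>Q))"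
    using assms(2)
    by (simp add: Transcendental.exp_sum [symmetric] sum.distrib sum_distrib_left exp_add [symmetric] sum_subtractf sum_negf algebra_simps)
  finally show ?thesis .
qed

lemma integral_PiM_mono_coordinate:
  fixes f g :: "('i \<Rightarrow> 'a) \<Rightarrow> real"
  assumes "prob_space Q" "i \<in> I"
    and f: "integrable (PiM I (\<lambda>_. Q)) f" and g: "integrable (PiM I (\<lambda>_. Q)) g"
    and le: "\<And>x. x \<in> space (PiM (I - {i}) (\<lambda>_. Q)) \<Longrightarrow> (\<integral>y. f (x(i := y)) \<partial>Q) \<le> (\<integral>y. g (x(i := y)) \<partial>Q)"
  shows "(\<integral>x. f x \<partial>PiM I (\<lambda>_. Q)) \<le> (\<integral>x. g x \<partial>PiM I (\<lambda>_. Q))"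
proof -
  let ?J = "PiM (I - {i}) (\<lambda>_. Q)" and ?I = "PiM I (\<lambda>_. Q)"
  let ?u = "\<lambda>(y, x). x(i := y)"
  have ins: "insert i (I - {i}) = I" using assms(2) by auto
  interpret J: prob_space ?J by (intro prob_space_PiM) (rule assms(1))
  interpret Q: prob_space Q by fact
  interpret pair_sigma_finite Q ?J ..
  have D: "distr (Q \<Otimes>\<^sub>M ?J) ?I ?u = ?I"
    using distr_pair_PiM_eq_PiM [of "I - {i}" "\<lambda>_. Q" i] assms(1) by (simp only: ins)
  have u: "?u \<in> measurable (Q \<Otimes>\<^sub>M ?J) ?I"
    using measurable_fun_upd [of I "I - {i}" i] ins
    by (simp add: case_prod_beta') (intro measurable_fun_upd [of I "I - {i}" i], auto)
  have *: "integrable ?J (\<lambda>x. \<integral>y. k (x(i := y)) \<partial>Q)"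
    "(\<integral>x. k x \<partial>?I) = (\<integral>x. (\<integral>y. k (x(i := y)) \<partial>Q) \<partial>?J)"
    if k: "integrable ?I k" for k :: "('i \<Rightarrow> 'a) \<Rightarrow> real"
  proof -
    have kI: "integrable (Q \<Otimes>\<^sub>M ?J) (\<lambda>z. k (?u z))"
      using integrable_distr [OF u, of k] k by (simp add: D)
    then have kI': "integrable (Q \<Otimes>\<^sub>M ?J) (\<lambda>(y, x). k (x(i := y)))"
      by (simp add: case_prod_beta')
    show "integrable ?J (\<lambda>x. \<integral>y. k (x(i := y)) \<partial>Q)"
      using integrable_snd [OF kI'] .
    have "(\<integral>x. k x \<partial>?I) = (\<integral>z. k (?u z) \<partial>(Q \<Otimes>\<^sub>M ?J))"
      using integral_distr [OF u, of k] k by (simp add: D)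
    also have "\<dots> = (\<integral>x. (\<integral>y. k (x(i := y)) \<partial>Q) \<partial>?J)"
      using integral_snd [OF kI'] by (simp add: case_prod_beta')
    finally show "(\<integral>x. k x \<partial>?I) = (\<integral>x. (\<integral>y. k (x(i := y)) \<partial>Q) \<partial>?J)" .
  qed
  show ?thesis
    unfolding *(2) [OF f] *(2) [OF g] using le by (rule integral_mono [OF *(1) [OF f] *(1) [OF g]])
qed

section \<open>Kernel moments and the small ball function\<close>

lemma deriv01_eqI:
  assumes "(f has_vector_derivative D) (at s within {0..1})" "s \<in> {0..1}"
  shows "deriv01 f s = D"
  using vector_derivative_within_closed_interval [of 0 1 s f D] assms by (simp add: deriv01_def)

lemma has_vector_derivative_deriv01:
  assumes "f differentiable_on {0..1}" "s \<in> {0..1}"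
  shows "(f has_vector_derivative deriv01 f s) (at s within {0..1})"
  using assms by (simp add: deriv01_def differentiable_on_def vector_derivative_works)

lemma set_integrable_continuous_mult:
  fixes u g :: "real \<Rightarrow> real"
  assumes u: "continuous_on {0..1} u" and g: "set_integrable lborel {0..1} g"
  shows "set_integrable lborel {0..1} (\<lambda>s. u s * g s)"
proof -
  obtain C where "\<forall>x\<in>u ` {0..1}. norm x \<le> C"
    using compact_imp_bounded [OF compact_continuous_image [OF u compact_Icc]]
    unfolding bounded_iff by blast
  then have C: "\<bar>u s\<bar> \<le> C" if "s \<in> {0..1}" for s
    using that by auto
  have [measurable]: "(\<lambda>s. indicator {0..1} s *\<^sub>R u s) \<in> borel_measurable borel"
    by (rule borel_measurable_continuous_on_indicator) (auto intro: u)
  have g': "integrable lborel (\<lambda>s. indicator {0..1} s *\<^sub>R g s)"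
    using g by (simp add: set_integrable_def)
  have [measurable]: "(\<lambda>s. indicator {0..1} s *\<^sub>R g s) \<in> borel_measurable borel"
    using borel_measurable_integrable [OF g'] by simp
  have "integrable lborel (\<lambda>s. (indicator {0..1} s *\<^sub>R u s) * (indicator {0..1} s *\<^sub>R g s))"
  proof (rule Bochner_Integration.integrable_bound [OF integrable_mult_right [OF g', of C]])
    show "AE s in lborel. norm ((indicator {0..1} s *\<^sub>R u s) * (indicator {0..1} s *\<^sub>R g s))
        \<le> norm (C * (indicator {0..1} s *\<^sub>R g s))"
    proof (rule AE_I2)
      fix s :: real
      have "\<bar>u s\<bar> \<le> \<bar>C\<bar>" if "s \<in> {0..1}"
        using C [OF that] by linarith
      then show "norm ((indicator {0..1} s *\<^sub>R u s) * (indicator {0..1} s *\<^sub>R g s))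
        \<le> norm (C * (indicator {0..1} s *\<^sub>R g s))"
        by (auto simp: indicator_def abs_mult intro!: mult_right_mono)
    qed
  qed measurable
  moreover have "(indicator {0..1} s *\<^sub>R u s) * (indicator {0..1} s *\<^sub>R g s)
      = indicator {0..1} s *\<^sub>R (u s * g s)" for s :: real
    by (simp add: indicator_def)
  ultimately show ?thesis unfolding set_integrable_def by (simp only:)
qed

lemma deriv01_mult:
  fixes u v :: "real \<Rightarrow> real"
  assumes u: "u differentiable_on {0..1}" "set_integrable lborel {0..1} (deriv01 u)"
    and v: "v differentiable_on {0..1}" "set_integrable lborel {0..1} (deriv01 v)"
  shows differentiable_on_mult01: "(\<lambda>s. u s * v s) differentiable_on {0..1}"
    and set_integrable_deriv01_mult: "set_integrable lborel {0..1} (deriv01 (\<lambda>s. u s * v s))"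
proof -
  show "(\<lambda>s. u s * v s) differentiable_on {0..1}"
    using u v by (auto simp: differentiable_on_def)
  have "set_integrable lborel {0..1} (\<lambda>s. u s * deriv01 v s + v s * deriv01 u s)"
    using u v by (intro set_integral_add set_integrable_continuous_mult differentiable_imp_continuous_on)
  also have "?this \<longleftrightarrow> set_integrable lborel {0..1} (deriv01 (\<lambda>s. u s * v s))"
  proof (rule set_integrable_cong [OF refl refl])
    fix s :: real assume s: "s \<in> {0..1}"
    have "((\<lambda>s. u s * v s) has_vector_derivative (u s * deriv01 v s + deriv01 u s * v s)) (at s within {0..1})"
      by (intro has_vector_derivative_mult has_vector_derivative_deriv01 u v s)
    from deriv01_eqI [OF this s]
    show "u s * deriv01 v s + v s * deriv01 u s = deriv01 (\<lambda>s. u s * v s) s"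
      by (simp add: mult.commute)
  qed
  finally show "set_integrable lborel {0..1} (deriv01 (\<lambda>s. u s * v s))" .
qed

lemma deriv01_ident:
  shows "(\<lambda>s::real. s) differentiable_on {0..1}"
    and "set_integrable lborel {0..1} (deriv01 (\<lambda>s. s))"
proof -
  show "(\<lambda>s::real. s) differentiable_on {0..1}"
    by (auto simp: differentiable_on_def)
  have "set_integrable lborel {0..1} (\<lambda>s::real. 1::real)"
    by (rule borel_integrable_atLeastAtMost') auto
  also have "?this \<longleftrightarrow> set_integrable lborel {0..1} (deriv01 (\<lambda>s. s))"
    by (rule set_integrable_cong [OF refl refl]) (rule deriv01_eqI [symmetric], auto intro!: derivative_eq_intros)
  finally show "set_integrable lborel {0..1} (deriv01 (\<lambda>s. s))" .
qed

lemma FTC_deriv01: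
  fixes G :: "real \<Rightarrow> real"
  assumes G: "G differentiable_on {0..1}" "set_integrable lborel {0..1} (deriv01 G)"
    and u: "u \<in> {0..1}"
  shows "(LBINT s:{u..1}. deriv01 G s) = G 1 - G u"
proof -
  have "(deriv01 G has_integral (G 1 - G u)) {u..1}"
  proof (rule fundamental_theorem_of_calculus)
    fix s assume "s \<in> {u..1}"
    then have "(G has_vector_derivative deriv01 G s) (at s within {0..1})"
      using u by (intro has_vector_derivative_deriv01 G) auto
    then show "(G has_vector_derivative deriv01 G s) (at s within {u..1})"
      by (rule has_vector_derivative_within_subset) (use u in auto)
  qed (use u in auto)
  moreover have "set_integrable lborel {u..1} (deriv01 G)"
    by (rule set_integrable_subset [OF G(2)]) (use u in auto)
  ultimately show ?thesis
    using set_borel_integral_eq_integral(2) by (metis integral_unique)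
qed

locale small_ball_distribution = prob_space Q for Q :: "'q measure" +
  fixes \<rho> :: "'q \<Rightarrow> real" and F :: "real \<Rightarrow> real"
  assumes rho_meas [measurable]: "\<rho> \<in> borel_measurable Q"
    and F_def: "\<And>t. F t = measure Q {y \<in> space Q. \<rho> y \<le> t}"
    and F_0: "F 0 = 0"
begin

lemma F_mono: "s \<le> t \<Longrightarrow> F s \<le> F t"
  unfolding F_def by (rule finite_measure_mono) auto

lemma F_nonneg: "F t \<ge> 0"
  by (simp add: F_def)

lemma F_le_1: "F t \<le> 1"
  by (simp add: F_def)

lemma F_meas [measurable]: "F \<in> borel_measurable borel"
  by (rule borel_measurable_mono) (simp add: mono_def F_mono)

lemma AE_rho_pos: "AE y in Q. \<rho> y > 0"
proof -
  have "{y \<in> space Q. \<rho> y \<le> 0} \<in> null_sets Q"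
    using F_0 by (intro null_setsI) (auto simp: F_def emeasure_eq_measure)
  then show ?thesis
    by (rule AE_I') (auto simp: not_less)
qed

lemma expectation_kernel:
  fixes G :: "real \<Rightarrow> real"
  assumes G: "G differentiable_on {0..1}" "set_integrable lborel {0..1} (deriv01 G)"
    and h: "h > 0"
  shows "expectation (\<lambda>y. indicator {0..1} (\<rho> y / h) * G (\<rho> y / h))
    = G 1 * F h - (LBINT s:{0..1}. deriv01 G s * F (h * s))"
proof -
  interpret pair_sigma_finite Q lborel ..
  define g where "g s = indicator {0..1} s * deriv01 G s" for s :: real
  have g_int: "integrable lborel g"
    using G(2) by (simp add: g_def [abs_def] set_integrable_def)
  have [measurable]: "g \<in> borel_measurable borel"
    using borel_measurable_integrable [OF g_int] by simp
  let ?f = "\<lambda>(y, s). indicator {y. \<rho> y \<le> h * s} y * g s"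
  have ind_meas [measurable]: "?f \<in> borel_measurable (Q \<Otimes>\<^sub>M lborel)"
  proof -
    have "?f = (\<lambda>z. if \<rho> (fst z) \<le> h * snd z then g (snd z) else 0)"
      by (auto simp: fun_eq_iff indicator_def)
    also have "\<dots> \<in> borel_measurable (Q \<Otimes>\<^sub>M lborel)" by measurable
    finally show ?thesis .
  qed
  have sec_int: "integrable lborel (\<lambda>s. ?f (y, s))" for y
  proof (rule Bochner_Integration.integrable_bound [OF g_int])
    have "(\<lambda>s. ?f (y, s)) = (\<lambda>s. if \<rho> y \<le> h * s then g s else 0)"
      by (auto simp: fun_eq_iff indicator_def)
    also have "\<dots> \<in> borel_measurable lborel" by measurable
    finally show "(\<lambda>s. ?f (y, s)) \<in> borel_measurable lborel" .
  qed (auto simp: indicator_def)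
  have f_int: "integrable (Q \<Otimes>\<^sub>M lborel) ?f"
  proof (rule Fubini_integrable [OF ind_meas])
    show "integrable Q (\<lambda>y. \<integral>s. norm (?f (y, s)) \<partial>lborel)"
    proof (rule integrable_const_bound [where B = "\<integral>s. norm (g s) \<partial>lborel"])
      show "AE y in Q. norm (\<integral>s. norm (?f (y, s)) \<partial>lborel) \<le> (\<integral>s. norm (g s) \<partial>lborel)"
      proof (rule AE_I2)
        fix y
        have "(\<integral>s. norm (?f (y, s)) \<partial>lborel) \<le> (\<integral>s. norm (g s) \<partial>lborel)"
          using sec_int [of y] g_int by (intro integral_mono) (auto simp: indicator_def)
        then show "norm (\<integral>s. norm (?f (y, s)) \<partial>lborel) \<le> (\<integral>s. norm (g s) \<partial>lborel)"
          by simp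
      qed
    qed measurable
  qed (use sec_int in auto)
  have "expectation (\<lambda>y. indicator {0..1} (\<rho> y / h) * G (\<rho> y / h))
      = expectation (\<lambda>y. G 1 * indicator {y \<in> space Q. \<rho> y \<le> h} y - (\<integral>s. ?f (y, s) \<partial>lborel))"
  proof (rule integral_cong_AE)
    have [measurable]: "(\<lambda>s. indicator {0..1} s * G s) \<in> borel_measurable borel"
      using borel_measurable_continuous_on_indicator [of "{0..1}" G]
        differentiable_imp_continuous_on [OF G(1)] by simp
    have "(\<lambda>y. (\<lambda>s. indicator {0..1} s * G s) (\<rho> y / h)) \<in> borel_measurable Q"
      by measurable
    then show "(\<lambda>y. indicator {0..1} (\<rho> y / h) * G (\<rho> y / h)) \<in> borel_measurable Q"
      by simp
    show "(\<lambda>y. G 1 * indicator {y \<in> space Q. \<rho> y \<le> h} y - (\<integral>s. ?f (y, s) \<partial>lborel)) \<in> borel_measurable Q"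
      by measurable
    show "AE y in Q. indicator {0..1} (\<rho> y / h) * G (\<rho> y / h)
        = G 1 * indicator {y \<in> space Q. \<rho> y \<le> h} y - (\<integral>s. ?f (y, s) \<partial>lborel)"
      using AE_rho_pos AE_space
    proof eventually_elim
      case (elim y)
      show ?case
      proof (cases "\<rho> y \<le> h")
        case True
        have "?f (y, s) = indicator {\<rho> y / h..1} s *\<^sub>R deriv01 G s" for s
        proof (cases "s \<in> {0..1}")
          case True
          have "\<rho> y \<le> h * s \<longleftrightarrow> \<rho> y / h \<le> s"
            using h by (simp add: pos_divide_le_eq mult.commute)
          with True show ?thesis by (simp add: g_def indicator_def)
        next
          case False
          moreover have "\<rho> y / h \<ge> 0" using elim h by simp
          ultimately have "s \<notin> {\<rho> y / h..1}" by (auto dest: order.trans)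
          with False show ?thesis by (simp add: g_def)
        qed
        then have "(\<integral>s. ?f (y, s) \<partial>lborel) = (LBINT s:{\<rho> y / h..1}. deriv01 G s)"
          unfolding set_lebesgue_integral_def by (simp only:)
        also have "\<dots> = G 1 - G (\<rho> y / h)"
          using elim True h by (intro FTC_deriv01 G) auto
        finally show ?thesis using elim True h by simp
      next
        case False
        have "?f (y, s) = 0" for s
        proof (cases "s \<in> {0..1}")
          case True
          then have "h * s \<le> h" using h by simp
          with False show ?thesis by (simp add: indicator_def)
        qed (simp add: g_def)
        then have "(\<integral>s. ?f (y, s) \<partial>lborel) = 0" by (simp only: Bochner_Integration.integral_zero)
        with False h show ?thesis by simp
      qed
    qed
  qed
  also have "\<dots> = G 1 * F h - expectation (\<lambda>y. \<integral>s. ?f (y, s) \<partial>lborel)"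
  proof (subst Bochner_Integration.integral_diff)
    show "integrable Q (\<lambda>y. \<integral>s. ?f (y, s) \<partial>lborel)"
      using integrable_fst [OF f_int] by simp
  qed (auto simp: F_def intro!: integrable_mult_right simp: emeasure_eq_measure)
  also have "expectation (\<lambda>y. \<integral>s. ?f (y, s) \<partial>lborel) = (\<integral>s. expectation (\<lambda>y. ?f (y, s)) \<partial>lborel)"
    using Fubini_integral [of "\<lambda>y s. ?f (y, s)"] f_int by simp
  also have "\<dots> = (LBINT s:{0..1}. deriv01 G s * F (h * s))"
    unfolding set_lebesgue_integral_def
  proof (intro Bochner_Integration.integral_cong refl)
    fix s :: real
    have "expectation (\<lambda>y. ?f (y, s)) = expectation (\<lambda>y. g s * indicator {y \<in> space Q. \<rho> y \<le> h * s} y)"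
      by (intro Bochner_Integration.integral_cong refl) (auto simp: indicator_def)
    also have "\<dots> = g s * F (h * s)" by (simp add: F_def)
    finally show "expectation (\<lambda>y. ?f (y, s)) = indicator {0..1} s *\<^sub>R (deriv01 G s * F (h * s))"
      by (simp add: g_def)
  qed
  finally show ?thesis .
qed

lemma expectation_kernel_tendsto:
  fixes G \<tau>0 :: "real \<Rightarrow> real" and h :: "nat \<Rightarrow> real"
  assumes G: "G differentiable_on {0..1}" "set_integrable lborel {0..1} (deriv01 G)"
    and h: "filterlim h (at_right 0) sequentially"
    and F_pos: "\<And>t. t > 0 \<Longrightarrow> F t > 0"
    and \<tau>0: "\<And>s. s \<in> {0..1} \<Longrightarrow> ((\<lambda>t. F (t * s) / F t) \<longlongrightarrow> \<tau>0 s) (at_right 0)"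
  shows "(\<lambda>i. expectation (\<lambda>y. indicator {0..1} (\<rho> y / h i) * G (\<rho> y / h i)) / F (h i))
           \<longlonglongrightarrow> G 1 - (LBINT s:{0..1}. deriv01 G s * \<tau>0 s)"
proof -
  define g where "g s = indicator {0..1} s * deriv01 G s" for s :: real
  have g_int: "integrable lborel g"
    using G(2) by (simp add: g_def [abs_def] set_integrable_def)
  have [measurable]: "g \<in> borel_measurable borel"
    using borel_measurable_integrable [OF g_int] by simp
  have h_pos: "\<forall>\<^sub>F i in sequentially. h i > 0"
    using h by (simp add: filterlim_at eventually_conj_iff)
  have ratio: "(\<lambda>i. g s * (F (h i * s) / F (h i))) \<longlonglongrightarrow> g s * \<tau>0 s" for s
  proof (cases "s \<in> {0..1}")
    case True
    show ?thesis
      by (intro tendsto_mult tendsto_const filterlim_compose [OF \<tau>0 [OF True] h])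
  qed (simp add: g_def)
  have lim: "(\<lambda>i. \<integral>s. g s * (F (h i * s) / F (h i)) \<partial>lborel) \<longlonglongrightarrow> (\<integral>s. g s * \<tau>0 s \<partial>lborel)"
  proof (rule integral_dominated_convergence [where w = "\<lambda>s. norm (g s)"])
    show "(\<lambda>s. g s * \<tau>0 s) \<in> borel_measurable lborel"
      by (rule borel_measurable_LIMSEQ_real [OF ratio]) measurable
    show "AE s in lborel. norm (g s * (F (h i * s) / F (h i))) \<le> norm (g s)" for i
    proof (rule AE_I2)
      fix s :: real
      show "norm (g s * (F (h i * s) / F (h i))) \<le> norm (g s)"
      proof (cases "s \<in> {0..1} \<and> h i > 0")
        case True
        then have "F (h i * s) \<le> F (h i)" by (intro F_mono) simp
        then have "\<bar>F (h i * s) / F (h i)\<bar> \<le> 1"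
          using F_nonneg [of "h i * s"] F_nonneg [of "h i"] by (auto simp: divide_le_eq_1)
        then show ?thesis
          using mult_left_mono [of "\<bar>F (h i * s) / F (h i)\<bar>" 1 "\<bar>g s\<bar>"] by (simp add: abs_mult)
      next
        case False
        have "F (h i) = 0" if "h i \<le> 0"
          using F_mono [OF that] F_nonneg [of "h i"] by (simp add: F_0)
        with False show ?thesis by (auto simp: g_def)
      qed
    qed
  qed (use ratio g_int in auto)
  have eq: "\<forall>\<^sub>F i in sequentially.
      G 1 - (\<integral>s. g s * (F (h i * s) / F (h i)) \<partial>lborel) =
      expectation (\<lambda>y. indicator {0..1} (\<rho> y / h i) * G (\<rho> y / h i)) / F (h i)"
    using h_pos
  proof eventually_elim
    case (elim i)
    have "(\<integral>s. g s * (F (h i * s) / F (h i)) \<partial>lborel) = (LBINT s:{0..1}. deriv01 G s * F (h i * s)) / F (h i)"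
      unfolding set_lebesgue_integral_def g_def integral_divide_zero [symmetric]
      by (intro Bochner_Integration.integral_cong refl) simp
    then show ?case
      using F_pos [OF elim] by (simp add: expectation_kernel [OF G elim] diff_divide_distrib)
  qed
  have "(\<lambda>i. G 1 - (\<integral>s. g s * (F (h i * s) / F (h i)) \<partial>lborel)) \<longlonglongrightarrow> G 1 - (\<integral>s. g s * \<tau>0 s \<partial>lborel)"
    by (intro tendsto_diff tendsto_const lim)
  also have "(\<integral>s. g s * \<tau>0 s \<partial>lborel) = (LBINT s:{0..1}. deriv01 G s * \<tau>0 s)"
    unfolding set_lebesgue_integral_def g_def by (simp add: mult.assoc)
  finally show ?thesis
    using tendsto_cong [OF eq] by simp
qed

end

section \<open>The kernel weights\<close>

locale kernel_weights = small_ball_distribution Q \<rho> F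
  for Q :: "'q measure" and \<rho> :: "'q \<Rightarrow> real" and F :: "real \<Rightarrow> real" +
  fixes K :: "real \<Rightarrow> real" and h :: "nat \<Rightarrow> real" and l K_lo K_hi \<mu>1 \<mu>2 :: real
    and \<beta> :: "real \<Rightarrow> real"
  assumes F_pos: "\<And>t. t > 0 \<Longrightarrow> F t > 0"
    and h_pos: "\<And>n. n \<ge> 1 \<Longrightarrow> h n > 0"
    and h_lim: "h \<longlonglongrightarrow> 0"
    and N_lim: "filterlim (\<lambda>n. real n * F (h n)) at_top sequentially"
    and K_meas [measurable]: "K \<in> borel_measurable borel"
    and K_le: "\<And>t. K t \<le> K_hi"
    and K_lo: "K_lo > 0" "\<And>t. t \<in> {0..1} \<Longrightarrow> K_lo \<le> K t"
    and K_0: "\<And>t. t \<notin> {0..1} \<Longrightarrow> K t = 0"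
    and l: "l \<in> {0..1}"
    and B_lim: "\<And>q. q \<le> 2 \<Longrightarrow> B_avg F h q \<longlonglongrightarrow> \<beta> q"
    and \<mu>1: "(\<lambda>i. expectation (\<lambda>y. K (\<rho> y / h i)) / F (h i)) \<longlonglongrightarrow> \<mu>1"
    and \<mu>2: "(\<lambda>i. expectation (\<lambda>y. (K (\<rho> y / h i))\<^sup>2) / F (h i)) \<longlonglongrightarrow> \<mu>2"
begin

definition N :: "nat \<Rightarrow> real" where
  "N n = real n * F (h n)"

definition P :: "nat \<Rightarrow> (nat \<Rightarrow> 'q) measure" where
  "P n = PiM {1..n} (\<lambda>_. Q)"

definition kern :: "nat \<Rightarrow> 'q \<Rightarrow> real" where
  "kern i y = K (\<rho> y / h i)"

text \<open>The common factor \<open>F (h n) powr l / N n\<close> cancels in the estimator; it makes the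
  denominator converge to a positive constant.\<close>

definition coef :: "nat \<Rightarrow> nat \<Rightarrow> real" where
  "coef n i = (F (h i) / F (h n)) powr (- l) / N n"

definition D_except :: "nat \<Rightarrow> nat \<Rightarrow> (nat \<Rightarrow> 'q) \<Rightarrow> real" where
  "D_except j n x = (\<Sum>i\<in>{1..n} - {j}. coef n i * kern i (x i))"

definition D :: "nat \<Rightarrow> (nat \<Rightarrow> 'q) \<Rightarrow> real" where
  "D n x = (\<Sum>i=1..n. coef n i * kern i (x i))"

definition w :: "nat \<Rightarrow> nat \<Rightarrow> (nat \<Rightarrow> 'q) \<Rightarrow> real" where
  "w n i x = coef n i * kern i (x i) / D n x"

definition m :: "nat \<Rightarrow> real" where
  "m n = (\<Sum>i=1..n. coef n i * expectation (kern i))"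

definition m_lim :: real where
  "m_lim = \<beta> (1 - l) * \<mu>1"

sublocale P: prob_space "P n" for n
  unfolding P_def by (intro prob_space_PiM prob_space_axioms)

abbreviation EP :: "nat \<Rightarrow> ((nat \<Rightarrow> 'q) \<Rightarrow> real) \<Rightarrow> real" where
  "EP n f \<equiv> integral\<^sup>L (P n) f"

lemma prob_space_Q: "prob_space Q"
  by (rule prob_space_axioms)

lemma component_P [measurable]: "i \<in> {1..n} \<Longrightarrow> (\<lambda>x. x i) \<in> measurable (P n) Q"
  by (simp add: P_def)

lemma kern_meas [measurable]: "kern i \<in> borel_measurable Q"
  unfolding kern_def [abs_def] by measurable

lemma K_nonneg: "K t \<ge> 0"
  using K_lo(1) K_lo(2) [of t] K_0 [of t] by (cases "t \<in> {0..1}") auto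

lemma K_hi_pos: "K_hi > 0"
  using K_lo(1) K_lo(2) [of 0] K_le [of 0] by simp

lemma kern_nonneg: "kern i y \<ge> 0" and kern_le: "kern i y \<le> K_hi"
  by (simp_all add: kern_def K_nonneg K_le)

lemma kern_nz: "i \<ge> 1 \<Longrightarrow> kern i y \<noteq> 0 \<Longrightarrow> \<rho> y \<in> {0..h i}"
  using K_0 [of "\<rho> y / h i"] h_pos [of i]
  by (auto simp: kern_def zero_le_divide_iff divide_le_eq_1 not_less)

lemma Fh_pos: "n \<ge> 1 \<Longrightarrow> F (h n) > 0"
  by (simp add: F_pos h_pos)

lemma Fh_cancel: "i \<ge> 1 \<Longrightarrow> F (h i) * (e / F (h i)) = e"
  using Fh_pos [of i] by simp

lemma N_pos: "n \<ge> 1 \<Longrightarrow> N n > 0"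
  by (simp add: N_def Fh_pos)

lemma N_at_top: "filterlim N at_top sequentially"
  using N_lim by (simp add: N_def [abs_def])

lemma N_inverse: "(\<lambda>n. 1 / N n) \<longlonglongrightarrow> 0"
  using tendsto_inverse_0_at_top [OF N_at_top] by (simp add: inverse_eq_divide)

lemma N_nonneg: "N n \<ge> 0"
  by (simp add: N_def F_nonneg)

lemma coef_nonneg: "coef n i \<ge> 0"
  by (simp add: coef_def N_nonneg)

lemma D_meas [measurable]: "D n \<in> borel_measurable (P n)"
  unfolding D_def [abs_def] by measurable

lemma D_except_meas [measurable]: "D_except j n \<in> borel_measurable (P n)"
  unfolding D_except_def [abs_def] by measurable

lemma w_meas [measurable]: "i \<in> {1..n} \<Longrightarrow> w n i \<in> borel_measurable (P n)"
  unfolding w_def [abs_def] by measurable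

lemma term_nonneg: "coef n i * kern i y \<ge> 0"
  by (simp add: coef_nonneg kern_nonneg)

lemma D_nonneg: "D n x \<ge> 0"
  by (simp add: D_def sum_nonneg term_nonneg)

lemma D_except_le: "D_except j n x \<le> D n x"
  unfolding D_except_def D_def by (rule sum_mono2) (auto simp: term_nonneg)

lemma D_except_0: "D_except 0 n = D n"
  by (auto simp: fun_eq_iff D_except_def D_def intro!: sum.cong)

lemma w_nonneg: "w n i x \<ge> 0"
  by (simp add: w_def D_nonneg term_nonneg)

lemma term_le_D: "i \<in> {1..n} \<Longrightarrow> coef n i * kern i (x i) \<le> D n x"
  unfolding D_def by (rule member_le_sum) (auto simp: term_nonneg)

lemma w_le_1: "i \<in> {1..n} \<Longrightarrow> w n i x \<le> 1"
  using term_le_D [of i n x] D_nonneg [of n x] by (auto simp: w_def divide_le_eq_1)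

lemma w_nz: "i \<ge> 1 \<Longrightarrow> w n i x \<noteq> 0 \<Longrightarrow> \<rho> (x i) \<in> {0..h i}"
  using kern_nz by (auto simp: w_def)

lemma sum_w: "(\<Sum>i=1..n. w n i x) = (if D n x = 0 then 0 else 1)"
proof -
  have "(\<Sum>i=1..n. w n i x) = D n x / D n x"
    by (simp only: w_def sum_divide_distrib [symmetric] D_def [symmetric])
  then show ?thesis by simp
qed

lemma sum_w_le_1: "(\<Sum>i=1..n. w n i x) \<le> 1"
  unfolding sum_w by simp

lemma w_sq_le: "i \<in> {1..n} \<Longrightarrow> (w n i x)\<^sup>2 \<le> w n i x"
  using w_le_1 [of i n x] w_nonneg [of n i x] by (simp add: power2_eq_square mult_left_le)

lemma sum_w_sq_le_1: "(\<Sum>i=1..n. (w n i x)\<^sup>2) \<le> 1"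
  by (rule order.trans [OF sum_mono sum_w_le_1]) (rule w_sq_le)

lemma kern_pow_integrable: "integrable Q (\<lambda>y. (kern i y) ^ p)"
  by (rule integrable_const_bound [where B = "K_hi ^ p"])
     (auto simp: kern_nonneg kern_le intro!: power_mono)

lemma kern_integrable: "integrable Q (kern i)"
  using kern_pow_integrable [of i 1] by simp

lemma
  fixes f :: "'q \<Rightarrow> real"
  assumes i: "i \<ge> 1" and C: "C \<ge> 0" and f: "\<And>y. kern i y \<noteq> 0 \<Longrightarrow> \<bar>f y\<bar> \<le> C"
    and [measurable]: "f \<in> borel_measurable Q" and p: "p \<ge> 1"
  shows integrable_kern_mult: "integrable Q (\<lambda>y. kern i y ^ p * f y)"
    and expectation_kern_mult_le: "\<bar>expectation (\<lambda>y. kern i y ^ p * f y)\<bar> \<le> K_hi ^ p * C * F (h i)"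
proof -
  have bound: "\<bar>kern i y ^ p * f y\<bar> \<le> K_hi ^ p * C * indicator {y \<in> space Q. \<rho> y \<le> h i} y"
    if "y \<in> space Q" for y
  proof (cases "kern i y = 0")
    case True
    then show ?thesis using p C K_hi_pos by (simp add: zero_power)
  next
    case False
    have "\<bar>kern i y ^ p * f y\<bar> \<le> K_hi ^ p * C"
      unfolding abs_mult using f [OF False] kern_nonneg kern_le
      by (intro mult_mono) (auto simp: power_mono K_hi_pos less_imp_le)
    then show ?thesis using kern_nz [OF i False] that by simp
  qed
  have ind: "integrable Q (\<lambda>y. K_hi ^ p * C * indicator {y \<in> space Q. \<rho> y \<le> h i} y)"
    by (intro integrable_mult_right) (simp add: emeasure_eq_measure)
  show int: "integrable Q (\<lambda>y. kern i y ^ p * f y)"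
    by (rule Bochner_Integration.integrable_bound [OF ind])
       (use bound in \<open>auto intro!: AE_I2 order.trans [OF bound]\<close>)
  have "\<bar>expectation (\<lambda>y. kern i y ^ p * f y)\<bar> \<le> expectation (\<lambda>y. \<bar>kern i y ^ p * f y\<bar>)"
    by (rule integral_abs_bound)
  also have "\<dots> \<le> expectation (\<lambda>y. K_hi ^ p * C * indicator {y \<in> space Q. \<rho> y \<le> h i} y)"
    using int ind bound by (intro integral_mono) auto
  finally show "\<bar>expectation (\<lambda>y. kern i y ^ p * f y)\<bar> \<le> K_hi ^ p * C * F (h i)"
    by (simp add: F_def)
qed

lemma expectation_kern_pow_le:
  "i \<ge> 1 \<Longrightarrow> p \<ge> 1 \<Longrightarrow> expectation (\<lambda>y. kern i y ^ p) \<le> K_hi ^ p * F (h i)"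
  using expectation_kern_mult_le [of i 1 "\<lambda>_. 1" p] by simp

lemma coef_sum_lim:
  assumes p: "p \<ge> 1" and y: "y \<longlonglongrightarrow> L"
  shows "(\<lambda>n. N n ^ (p - 1) * (\<Sum>i=1..n. coef n i ^ p * (F (h i) * y i)))
           \<longlonglongrightarrow> \<beta> (1 - real p * l) * L"
proof -
  define q where "q = 1 - real p * l"
  have "q \<le> 1" using l by (simp add: q_def)
  have ratio: "(F (h i) / F (h n)) powr q = F (h i) powr q / F (h n) powr q" for i n
    by (simp add: powr_divide F_nonneg)
  have "(\<lambda>n. 1 / real n * (\<Sum>i=1..n. F (h i) powr q / F (h n) powr q * y i)) \<longlonglongrightarrow> \<beta> q * L"
  proof (rule weighted_Cesaro [OF _ _ y])
    show "0 < F (h i) powr q" if "i \<ge> 1" for i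
      using Fh_pos [OF that] by simp
    show "(\<lambda>n. 1 / real n * (\<Sum>i=1..n. F (h i) powr q / F (h n) powr q)) \<longlonglongrightarrow> \<beta> q"
      using B_lim [of q] \<open>q \<le> 1\<close> by (simp add: B_avg_def [abs_def] ratio)
  qed
  moreover have "\<forall>\<^sub>F n in sequentially.
      1 / real n * (\<Sum>i=1..n. F (h i) powr q / F (h n) powr q * y i) =
      N n ^ (p - 1) * (\<Sum>i=1..n. coef n i ^ p * (F (h i) * y i))"
    using eventually_ge_at_top [of 1]
  proof eventually_elim
    case (elim n)
    have Nn: "N n > 0" "F (h n) > 0" using elim by (simp_all add: N_pos Fh_pos)
    have "N n ^ (p - 1) * (coef n i ^ p * (F (h i) * y i)) =
        1 / real n * (F (h i) powr q / F (h n) powr q * y i)" if i: "i \<in> {1..n}" for i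
    proof -
      define a where "a = F (h i) / F (h n)"
      have a: "a > 0" using i Nn Fh_pos [of i] by (simp add: a_def)
      have "N n ^ (p - 1) * coef n i ^ p * F (h i) = (a powr (- l)) ^ p * F (h i) / N n"
        using Nn p by (cases p) (simp_all add: coef_def a_def power_divide field_simps)
      also have "(a powr (- l)) ^ p = a powr (- (real p * l))"
        using a by (simp add: powr_power mult.commute)
      also have "\<dots> * F (h i) = a powr q * F (h n)"
        using a Nn by (simp add: q_def powr_diff powr_minus field_simps a_def)
      also have "\<dots> / N n = 1 / real n * (F (h i) powr q / F (h n) powr q)"
        using Nn by (simp add: N_def a_def ratio)
      finally have *: "N n ^ (p - 1) * coef n i ^ p * F (h i)
          = 1 / real n * (F (h i) powr q / F (h n) powr q)" .
      have "N n ^ (p - 1) * (coef n i ^ p * (F (h i) * y i)) = (N n ^ (p - 1) * coef n i ^ p * F (h i)) * y i"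
        by (simp only: mult.assoc)
      also have "\<dots> = 1 / real n * (F (h i) powr q / F (h n) powr q) * y i"
        by (simp only: *)
      finally show ?thesis by (simp only: mult.assoc)
    qed
    then show ?case by (simp add: sum_distrib_left)
  qed
  ultimately show ?thesis
    unfolding q_def by (rule Lim_transform_eventually)
qed

lemma beta_pos:
  assumes "\<bar>q\<bar> \<le> 2"
  shows "\<beta> q > 0"
proof -
  have "1 \<le> B_avg F h q n * B_avg F h (- q) n" if n: "n \<ge> 1" for n
  proof -
    define a where "a i = F (h i) / F (h n)" for i
    have a: "a i > 0" if "i \<in> {1..n}" for i
      using that Fh_pos [of i] Fh_pos [of n] n by (simp add: a_def)
    have "(\<Sum>i=1..n. a i powr (q / 2) * a i powr (- q / 2))\<^sup>2
        \<le> (\<Sum>i=1..n. (a i powr (q / 2))\<^sup>2) * (\<Sum>i=1..n. (a i powr (- q / 2))\<^sup>2)"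
      by (rule Cauchy_Schwarz_ineq_sum)
    also have "(\<Sum>i=1..n. a i powr (q / 2) * a i powr (- q / 2)) = (\<Sum>i=1..n. 1)"
      by (intro sum.cong refl) (use a in \<open>force simp: powr_add [symmetric]\<close>)
    also have "(\<Sum>i=1..n. (a i powr (q / 2))\<^sup>2) = (\<Sum>i=1..n. a i powr q)"
      by (intro sum.cong refl) (use a in \<open>auto simp: power2_eq_square powr_add [symmetric]\<close>)
    also have "(\<Sum>i=1..n. (a i powr (- q / 2))\<^sup>2) = (\<Sum>i=1..n. a i powr - q)"
      by (intro sum.cong refl) (use a in \<open>auto simp: power2_eq_square powr_add [symmetric]\<close>)
    finally show ?thesis
      using n by (simp add: B_avg_def a_def field_simps power2_eq_square)
  qed
  moreover have "(\<lambda>n. B_avg F h q n * B_avg F h (- q) n) \<longlonglongrightarrow> \<beta> q * \<beta> (- q)"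
    using assms by (intro tendsto_mult B_lim) auto
  ultimately have "1 \<le> \<beta> q * \<beta> (- q)"
    by (intro tendsto_lowerbound [where f = "\<lambda>n. B_avg F h q n * B_avg F h (- q) n" and F = sequentially])
       (auto intro: eventually_sequentiallyI)
  moreover have "\<beta> q \<ge> 0"
  proof (rule tendsto_lowerbound [OF B_lim])
    show "\<forall>\<^sub>F n in sequentially. 0 \<le> B_avg F h q n"
      by (auto simp: B_avg_def intro!: always_eventually divide_nonneg_nonneg sum_nonneg)
  qed (use assms in auto)
  ultimately show ?thesis
    by (cases "\<beta> q = 0") auto
qed

lemma \<mu>1_pos: "\<mu>1 > 0"
proof -
  have "K_lo \<le> expectation (kern i) / F (h i)" if i: "i \<ge> 1" for i
  proof -
    have "expectation (\<lambda>y. K_lo * indicator {y \<in> space Q. \<rho> y \<le> h i} y) \<le> expectation (kern i)"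
    proof (rule integral_mono_AE)
      show "AE y in Q. K_lo * indicator {y \<in> space Q. \<rho> y \<le> h i} y \<le> kern i y"
        using AE_rho_pos
      proof eventually_elim
        case (elim y)
        then show ?case
          using K_lo(2) [of "\<rho> y / h i"] h_pos [OF i] kern_nonneg [of i y]
          by (auto simp: indicator_def kern_def)
      qed
    qed (auto simp: kern_integrable emeasure_eq_measure intro!: integrable_mult_right)
    then show ?thesis using Fh_pos [OF i] by (simp add: F_def pos_le_divide_eq)
  qed
  then have "K_lo \<le> \<mu>1"
    using \<mu>1 unfolding kern_def [abs_def]
    by (intro tendsto_lowerbound [OF \<mu>1]) (auto intro: eventually_sequentiallyI)
  with K_lo(1) show ?thesis by simp
qed

lemma m_lim_pos: "m_lim > 0"
  using beta_pos [of "1 - l"] \<mu>1_pos l by (simp add: m_lim_def)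

lemma m_tendsto: "m \<longlonglongrightarrow> m_lim"
proof -
  have "(\<lambda>n. N n ^ (1 - 1) * (\<Sum>i=1..n. coef n i ^ 1 * (F (h i) * (expectation (kern i) / F (h i)))))
      \<longlonglongrightarrow> \<beta> (1 - real 1 * l) * \<mu>1"
    using \<mu>1 by (intro coef_sum_lim) (simp_all add: kern_def [abs_def])
  also have "(\<lambda>n. N n ^ (1 - 1) * (\<Sum>i=1..n. coef n i ^ 1 * (F (h i) * (expectation (kern i) / F (h i))))) = m"
    by (auto simp: m_def fun_eq_iff Fh_cancel simp del: times_divide_eq_right intro!: sum.cong)
  finally show ?thesis by (simp add: m_lim_def)
qed

lemma m_ge: "\<forall>\<^sub>F n in sequentially. m n \<ge> m_lim / 2"
  using order_tendstoD(1) [OF m_tendsto, of "m_lim / 2"] m_lim_pos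
  by (auto elim: eventually_mono)

lemma second_moment_sum_lim:
  "(\<lambda>n. N n * (\<Sum>i=1..n. (coef n i)\<^sup>2 * expectation (\<lambda>y. (kern i y)\<^sup>2))) \<longlonglongrightarrow> \<beta> (1 - 2 * l) * \<mu>2"
proof -
  have "(\<lambda>n. N n ^ (2 - 1) * (\<Sum>i=1..n. coef n i ^ 2 * (F (h i) * (expectation (\<lambda>y. (kern i y)\<^sup>2) / F (h i)))))
      \<longlonglongrightarrow> \<beta> (1 - real 2 * l) * \<mu>2"
    using \<mu>2 by (intro coef_sum_lim) (simp_all add: kern_def [abs_def])
  also have "(\<lambda>n. N n ^ (2 - 1) * (\<Sum>i=1..n. coef n i ^ 2 * (F (h i) * (expectation (\<lambda>y. (kern i y)\<^sup>2) / F (h i))))) =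
      (\<lambda>n. N n * (\<Sum>i=1..n. (coef n i)\<^sup>2 * expectation (\<lambda>y. (kern i y)\<^sup>2)))"
    by (auto simp: fun_eq_iff Fh_cancel simp del: times_divide_eq_right intro!: sum.cong)
  finally show ?thesis by simp
qed

lemma variance_kern_sum_le:
  fixes f :: "nat \<Rightarrow> 'q \<Rightarrow> real"
  assumes "\<And>i. i \<in> {1..n} \<Longrightarrow> f i \<in> borel_measurable Q"
    and "\<And>i. i \<in> {1..n} \<Longrightarrow> integrable Q (\<lambda>y. (f i y)\<^sup>2)"
  shows "integrable (P n) (\<lambda>x. ((\<Sum>i=1..n. f i (x i)) - (\<Sum>i=1..n. expectation (f i)))\<^sup>2)"
    and "EP n (\<lambda>x. ((\<Sum>i=1..n. f i (x i)) - (\<Sum>i=1..n. expectation (f i)))\<^sup>2)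
           \<le> (\<Sum>i=1..n. expectation (\<lambda>y. (f i y)\<^sup>2))"
  using variance_sum_PiM_le [OF prob_space_Q, of "{1..n}" f] assms by (simp_all add: P_def)

lemma variance_D:
  shows "integrable (P n) (\<lambda>x. (D n x - m n)\<^sup>2)"
    and "EP n (\<lambda>x. (D n x - m n)\<^sup>2) \<le> (\<Sum>i=1..n. (coef n i)\<^sup>2 * expectation (\<lambda>y. (kern i y)\<^sup>2))"
  using variance_kern_sum_le [of n "\<lambda>i y. coef n i * kern i y"] kern_pow_integrable [of _ 2]
  by (simp_all add: D_def m_def power_mult_distrib)

lemma N_variance_D_bounded: "\<exists>C. \<forall>\<^sub>F n in sequentially. N n * EP n (\<lambda>x. (D n x - m n)\<^sup>2) \<le> C"
proof -
  have "\<forall>\<^sub>F n in sequentially.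
      N n * (\<Sum>i=1..n. (coef n i)\<^sup>2 * expectation (\<lambda>y. (kern i y)\<^sup>2)) < \<beta> (1 - 2 * l) * \<mu>2 + 1"
    by (rule order_tendstoD(2) [OF second_moment_sum_lim]) simp
  then show ?thesis
    by (intro exI [of _ "\<beta> (1 - 2 * l) * \<mu>2 + 1"], elim eventually_mono)
       (use mult_left_mono [OF variance_D(2) N_nonneg] in \<open>fastforce intro: order.trans\<close>)
qed

lemma N_coef:
  assumes "n \<ge> 1" "j \<ge> 1"
  shows "N n * coef n j \<le> F (h j) powr (- l)"
proof -
  have "N n * coef n j = F (h j) powr (- l) * F (h n) powr l"
    using assms N_pos [of n] Fh_pos [of n] Fh_pos [of j]
    by (simp add: coef_def powr_divide powr_minus field_simps)
  also have "\<dots> \<le> F (h j) powr (- l) * 1"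
    using l F_le_1 [of "h n"] F_nonneg [of "h n"] by (intro mult_left_mono powr_le1) auto
  finally show ?thesis by simp
qed

definition tail :: "nat \<Rightarrow> nat \<Rightarrow> real" where
  "tail j n = measure (P n) {x \<in> space (P n). D_except j n x \<le> m_lim / 2}"

lemma tail_lim: "(\<lambda>n. (N n)\<^sup>2 * tail j n) \<longlonglongrightarrow> 0"
proof -
  define V where "V n = (\<Sum>i=1..n. (coef n i)\<^sup>2 * expectation (\<lambda>y. (kern i y)\<^sup>2))" for n
  define C where "C = \<bar>\<beta> (1 - 2 * l) * \<mu>2\<bar> + 1"
  have C: "C > 0" by (simp add: C_def)
  define \<eta> where "\<eta> = m_lim / (4 * C)"
  have \<eta>: "\<eta> > 0" using m_lim_pos C by (simp add: \<eta>_def)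
  define \<gamma> where "\<gamma> = m_lim\<^sup>2 / (32 * C)"
  have \<gamma>: "\<gamma> > 0" using m_lim_pos C by (simp add: \<gamma>_def)
  have ev_V: "\<forall>\<^sub>F n in sequentially. N n * V n < C"
    unfolding V_def C_def by (rule order_tendstoD(2) [OF second_moment_sum_lim]) linarith
  have ev_m: "\<forall>\<^sub>F n in sequentially. m n > 7 / 8 * m_lim"
    by (rule order_tendstoD(1) [OF m_tendsto]) (use m_lim_pos in simp)
  have ev_c: "\<forall>\<^sub>F n in sequentially. 1 / N n * (F (h j) powr (- l) * K_hi) < m_lim / 8"
    by (rule order_tendstoD(2) [of _ 0])
       (use m_lim_pos tendsto_mult_left_zero [OF N_inverse] in auto)
  have bound: "\<forall>\<^sub>F n in sequentially. tail j n \<le> exp (- (\<gamma> * N n))"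
    using ev_V ev_m ev_c eventually_ge_at_top [of 1]
  proof eventually_elim
    case (elim n)
    have Nn: "N n > 0" using elim by (simp add: N_pos)
    define g where "g i y = (if i = j then 0 else coef n i * kern i y)" for i y
    have g_sum: "(\<Sum>i\<in>{1..n}. g i (x i)) = D_except j n x" for x
      unfolding D_except_def g_def
      by (rule sum.mono_neutral_cong_right) auto
    have g_sq: "(\<Sum>i\<in>{1..n}. expectation (\<lambda>y. (g i y)\<^sup>2)) \<le> V n"
      unfolding V_def
    proof (rule sum_mono)
      show "expectation (\<lambda>y. (g i y)\<^sup>2) \<le> (coef n i)\<^sup>2 * expectation (\<lambda>y. (kern i y)\<^sup>2)" for i
        by (cases "i = j") (simp_all add: g_def power_mult_distrib)
    qed
    have g_mean: "(\<Sum>i\<in>{1..n}. expectation (g i)) \<ge> 3 / 4 * m_lim"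
    proof -
      have "m n - (\<Sum>i\<in>{1..n}. expectation (g i)) = (\<Sum>i\<in>{1..n}. if i = j then coef n i * expectation (kern i) else 0)"
        unfolding m_def sum_subtractf [symmetric] by (rule sum.cong) (auto simp: g_def [abs_def])
      also have "\<dots> \<le> m_lim / 8"
      proof (cases "j \<in> {1..n}")
        case True
        have "expectation (kern j) \<le> K_hi"
          using integral_mono [OF kern_integrable [of j] integrable_const [of K_hi] kern_le] prob_space by simp
        then have "coef n j * expectation (kern j) \<le> coef n j * K_hi"
          by (intro mult_left_mono coef_nonneg)
        also have "coef n j \<le> F (h j) powr (- l) / N n"
          using N_coef [of n j] True elim Nn by (simp add: field_simps)
        finally have "coef n j * expectation (kern j) \<le> F (h j) powr (- l) / N n * K_hi"
          using K_hi_pos by simp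
        also have "\<dots> = 1 / N n * (F (h j) powr (- l) * K_hi)" by simp
        also have "\<dots> < m_lim / 8" using elim by blast
        finally show ?thesis using True by simp
      next
        case False
        then show ?thesis using m_lim_pos by auto
      qed
      finally show ?thesis using elim by simp
    qed
    have "tail j n \<le> exp (\<eta> * N n * (m_lim / 2) - \<eta> * N n * (\<Sum>i\<in>{1..n}. expectation (g i))
        + (\<eta> * N n)\<^sup>2 / 2 * (\<Sum>i\<in>{1..n}. expectation (\<lambda>y. (g i y)\<^sup>2)))"
      unfolding tail_def P_def g_sum [symmetric]
    proof (rule lower_tail_sum_PiM [OF prob_space_Q])
      show "integrable Q (\<lambda>y. (g i y)\<^sup>2)" for i
        using kern_pow_integrable [of i 2] by (cases "i = j") (simp_all add: g_def power_mult_distrib)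
    qed (use \<eta> Nn in \<open>auto simp: g_def [abs_def] term_nonneg\<close>)
    also have "\<dots> \<le> exp (- (\<gamma> * N n))"
    proof -
      have "(\<eta> * N n)\<^sup>2 / 2 * (\<Sum>i\<in>{1..n}. expectation (\<lambda>y. (g i y)\<^sup>2)) \<le> (\<eta> * N n)\<^sup>2 / 2 * V n"
        by (intro mult_left_mono g_sq) simp
      also have "\<dots> = \<eta>\<^sup>2 / 2 * N n * (N n * V n)"
        by (simp add: power2_eq_square)
      also have "\<dots> \<le> \<eta>\<^sup>2 / 2 * N n * C"
        using elim Nn by (intro mult_left_mono) auto
      finally have 1: "(\<eta> * N n)\<^sup>2 / 2 * (\<Sum>i\<in>{1..n}. expectation (\<lambda>y. (g i y)\<^sup>2)) \<le> \<eta>\<^sup>2 / 2 * N n * C" .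
      have 2: "\<eta> * N n * (3 / 4 * m_lim) \<le> \<eta> * N n * (\<Sum>i\<in>{1..n}. expectation (g i))"
        using \<eta> Nn by (intro mult_left_mono g_mean) auto
      have "\<eta> * N n * (m_lim / 2) - \<eta> * N n * (3 / 4 * m_lim) + \<eta>\<^sup>2 / 2 * N n * C = - (\<gamma> * N n)"
        using C by (simp add: \<eta>_def \<gamma>_def field_simps power2_eq_square)
      with 1 2 show ?thesis by simp
    qed
    finally show ?case .
  qed
  have "(\<lambda>n. (\<gamma> * N n) ^ 2 / exp (\<gamma> * N n)) \<longlonglongrightarrow> 0"
    by (rule filterlim_compose [OF tendsto_power_div_exp_0])
       (rule filterlim_tendsto_pos_mult_at_top [OF tendsto_const \<gamma> N_at_top])
  then have "(\<lambda>n. (\<gamma> * N n) ^ 2 / exp (\<gamma> * N n) / \<gamma>\<^sup>2) \<longlonglongrightarrow> 0"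
    using tendsto_divide_zero by blast
  also have "(\<lambda>n. (\<gamma> * N n) ^ 2 / exp (\<gamma> * N n) / \<gamma>\<^sup>2) = (\<lambda>n. (N n)\<^sup>2 * exp (- (\<gamma> * N n)))"
    using \<gamma> by (simp add: fun_eq_iff power_mult_distrib exp_minus field_simps)
  finally have lim: "(\<lambda>n. (N n)\<^sup>2 * exp (- (\<gamma> * N n))) \<longlonglongrightarrow> 0" .
  show ?thesis
    by (rule tendsto_sandwich [OF _ _ tendsto_const lim])
       (use bound in \<open>auto simp: tail_def elim!: eventually_mono intro!: mult_left_mono\<close>)
qed

lemma N_tail_lim: "(\<lambda>n. N n * tail j n) \<longlonglongrightarrow> 0"
proof -
  have "(\<lambda>n. 1 / N n * ((N n)\<^sup>2 * tail j n)) \<longlonglongrightarrow> 0 * 0"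
    by (intro tendsto_mult N_inverse tail_lim)
  moreover have "\<forall>\<^sub>F n in sequentially. 1 / N n * ((N n)\<^sup>2 * tail j n) = N n * tail j n"
    using eventually_ge_at_top [of 1]
    by eventually_elim (use N_pos in \<open>simp add: power2_eq_square\<close>)
  ultimately show ?thesis
    using Lim_transform_eventually by force
qed

lemma prob_D_small_le: "P.prob n {x \<in> space (P n). D n x \<le> m_lim / 2} = tail 0 n"
  by (simp add: tail_def D_except_0)

lemma integrable_P_component_iff:
  fixes f :: "'q \<Rightarrow> real"
  assumes "i \<in> {1..n}" "f \<in> borel_measurable Q"
  shows "integrable (P n) (\<lambda>x. f (x i)) \<longleftrightarrow> integrable Q f"
    and "EP n (\<lambda>x. f (x i)) = expectation f"
  using integrable_PiM_component [OF prob_space_Q assms] integral_PiM_component [OF prob_space_Q assms]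
  by (simp_all add: P_def)

lemma integrable_w_mult:
  fixes f :: "'q \<Rightarrow> real"
  assumes i: "i \<in> {1..n}" and [measurable]: "f \<in> borel_measurable Q"
    and int: "integrable Q (\<lambda>y. indicator {0..h i} (\<rho> y) * f y)"
  shows "integrable (P n) (\<lambda>x. w n i x * f (x i))"
    and "integrable (P n) (\<lambda>x. (w n i x)\<^sup>2 * f (x i))"
proof -
  note [measurable] = w_meas [OF i] component_P [OF i]
  have dom: "integrable (P n) (\<lambda>x. indicator {0..h i} (\<rho> (x i)) * f (x i))"
    using integrable_P_component_iff(1) [OF i, of "\<lambda>y. indicator {0..h i} (\<rho> y) * f y"] int by simp
  have le: "\<bar>u * f (x i)\<bar> \<le> \<bar>indicator {0..h i} (\<rho> (x i)) * f (x i)\<bar>"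
    if "0 \<le> u" "u \<le> w n i x" for u x
  proof (cases "w n i x = 0")
    case False
    then have "\<rho> (x i) \<in> {0..h i}" using w_nz [of i n x] i by auto
    moreover have "u \<le> 1" using w_le_1 [OF i, of x] that by simp
    ultimately show ?thesis using that by (simp add: abs_mult mult_left_le_one_le)
  qed (use that in simp)
  show "integrable (P n) (\<lambda>x. w n i x * f (x i))"
    by (rule Bochner_Integration.integrable_bound [OF dom])
       (use le w_nonneg in \<open>auto intro!: AE_I2\<close>)
  show "integrable (P n) (\<lambda>x. (w n i x)\<^sup>2 * f (x i))"
    by (rule Bochner_Integration.integrable_bound [OF dom])
       (use le w_sq_le [OF i] in \<open>auto intro!: AE_I2\<close>)
qed

text \<open>A single observation has weight of order \<open>1 / N n\<close>, except on the exponentially unlikely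
  event that the denominator formed by the other observations is small. That event is
  independent of the observation itself.\<close>

lemma fixed_weight_bound:
  fixes f :: "'q \<Rightarrow> real"
  assumes j: "j \<ge> 1" and f_meas [measurable]: "f \<in> borel_measurable Q" and f: "\<And>y. f y \<ge> 0"
    and int: "integrable Q (\<lambda>y. indicator {0..h j} (\<rho> y) * f y)"
  shows "\<exists>C. \<forall>\<^sub>F n in sequentially. (N n)\<^sup>2 * EP n (\<lambda>x. (w n j x)\<^sup>2 * f (x j)) \<le> C"
proof -
  define f' where "f' y = indicator {0..h j} (\<rho> y) * f y" for y
  have f'_meas [measurable]: "f' \<in> borel_measurable Q"
    unfolding f'_def [abs_def] by measurable
  have f'_int: "integrable Q f'" using int by (simp add: f'_def [abs_def])
  have f'_nonneg: "f' y \<ge> 0" for y using f by (simp add: f'_def)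
  have E_nonneg: "expectation f' \<ge> 0" using f'_nonneg by simp
  define A where "A = 2 * K_hi * F (h j) powr (- l) / m_lim"
  have "\<forall>\<^sub>F n in sequentially. (N n)\<^sup>2 * tail j n < 1"
    by (rule order_tendstoD(2) [OF tail_lim]) simp
  then have "\<forall>\<^sub>F n in sequentially. (N n)\<^sup>2 * EP n (\<lambda>x. (w n j x)\<^sup>2 * f (x j))
      \<le> (A\<^sup>2 + 1) * expectation f'"
    using eventually_ge_at_top [of j]
  proof eventually_elim
    case (elim n)
    have jn: "j \<in> {1..n}" and n: "n \<ge> 1" using j elim by auto
    note [measurable] = component_P [OF jn] w_meas [OF jn]
    define u where "u = 2 * K_hi * coef n j / m_lim"
    define small :: "(nat \<Rightarrow> 'q) \<Rightarrow> real"
      where small_eq: "small = (\<lambda>x. if D_except j n x \<le> m_lim / 2 then 1 else 0)"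
    have small_meas [measurable]: "small \<in> borel_measurable (P n)"
      unfolding small_eq by measurable
    have small_bd: "0 \<le> small x" "small x \<le> 1" for x
      by (simp_all add: small_eq)
    have NA: "N n * u \<le> A"
      using mult_left_mono [OF N_coef [OF n j], of "2 * K_hi / m_lim"] m_lim_pos K_hi_pos
      by (simp add: u_def A_def mult_ac)
    have Nu: "N n * u \<ge> 0"
      using m_lim_pos K_hi_pos by (simp add: u_def N_nonneg coef_nonneg)
    have pw: "(w n j x)\<^sup>2 * f (x j) \<le> u\<^sup>2 * f' (x j) + f' (x j) * small x" for x
    proof (cases "w n j x = 0")
      case True
      then show ?thesis using f'_nonneg small_bd by simp
    next
      case False
      then have f'_eq: "f' (x j) = f (x j)" using w_nz [of j n x] j by (simp add: f'_def)
      have "(w n j x)\<^sup>2 \<le> u\<^sup>2 + small x"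
      proof (cases "D_except j n x \<le> m_lim / 2")
        case True
        have "(w n j x)\<^sup>2 \<le> 1" using w_sq_le [OF jn, of x] w_le_1 [OF jn, of x] by simp
        then show ?thesis using True by (simp add: small_eq add_increasing)
      next
        case False
        then have "D n x \<ge> m_lim / 2" using D_except_le [of j n x] by simp
        then have "w n j x \<le> coef n j * K_hi / (m_lim / 2)"
          unfolding w_def using m_lim_pos kern_le coef_nonneg term_nonneg
          by (intro frac_le mult_left_mono) (auto intro: mult_nonneg_nonneg K_hi_pos [THEN less_imp_le])
        also have "\<dots> = u" by (simp add: u_def)
        finally have "(w n j x)\<^sup>2 \<le> u\<^sup>2" using w_nonneg by (intro power_mono)
        then show ?thesis using small_bd [of x] by simp
      qed
      then have "(w n j x)\<^sup>2 * f (x j) \<le> (u\<^sup>2 + small x) * f (x j)"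
        using f by (rule mult_right_mono)
      then show ?thesis unfolding f'_eq by (simp add: algebra_simps)
    qed
    have int1: "integrable (P n) (\<lambda>x. f' (x j))"
      using integrable_P_component_iff(1) [OF jn f'_meas] f'_int by simp
    have int2: "integrable (P n) (\<lambda>x. f' (x j) * small x)"
      by (rule Bochner_Integration.integrable_bound [OF int1])
         (use small_bd f'_nonneg in \<open>auto intro!: AE_I2 simp: abs_mult mult_left_le\<close>)
    have int3: "integrable (P n) small"
      by (rule P.integrable_const_bound [where B = 1]) (use small_bd in auto)
    have indep: "EP n (\<lambda>x. f' (x j) * small x) \<le> EP n (\<lambda>x. expectation f' * small x)"
      unfolding P_def
    proof (rule integral_PiM_mono_coordinate [OF prob_space_Q jn])
      fix x
      have "small (x(j := y)) = small x" for y
        by (simp add: small_eq D_except_def)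
      then show "expectation (\<lambda>y. f' ((x(j := y)) j) * small (x(j := y)))
          \<le> expectation (\<lambda>y. expectation f' * small (x(j := y)))"
        using f'_int by (simp add: prob_space)
    qed (use int2 int3 in \<open>simp_all add: P_def\<close>)
    have E_small: "EP n small = tail j n"
    proof -
      have "EP n small = EP n (indicator {x \<in> space (P n). D_except j n x \<le> m_lim / 2})"
        by (intro Bochner_Integration.integral_cong refl) (simp add: small_eq indicator_def)
      then show ?thesis by (simp add: tail_def)
    qed
    have "EP n (\<lambda>x. (w n j x)\<^sup>2 * f (x j)) \<le> EP n (\<lambda>x. u\<^sup>2 * f' (x j) + f' (x j) * small x)"
      using int1 int2 pw integrable_w_mult(2) [OF jn f_meas int]
      by (intro integral_mono) auto
    also have "\<dots> \<le> u\<^sup>2 * expectation f' + expectation f' * tail j n"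
      using int1 int2 indep integrable_P_component_iff(2) [OF jn f'_meas] by (simp add: E_small)
    finally have "(N n)\<^sup>2 * EP n (\<lambda>x. (w n j x)\<^sup>2 * f (x j))
        \<le> (N n)\<^sup>2 * (u\<^sup>2 * expectation f' + expectation f' * tail j n)"
      by (intro mult_left_mono) auto
    also have "\<dots> = ((N n * u)\<^sup>2 + (N n)\<^sup>2 * tail j n) * expectation f'"
      by (simp add: algebra_simps power_mult_distrib)
    also have "\<dots> \<le> (A\<^sup>2 + 1) * expectation f'"
      using elim NA Nu E_nonneg by (intro mult_right_mono add_mono power_mono) auto
    finally show ?case .
  qed
  then show ?thesis by blast
qed

lemma sum_w_mult_le:
  fixes g :: "nat \<Rightarrow> real"
  assumes "\<And>i. i \<in> {1..n} \<Longrightarrow> w n i x \<noteq> 0 \<Longrightarrow> \<bar>g i\<bar> \<le> C" "C \<ge> 0"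
  shows "\<bar>\<Sum>i=1..n. w n i x * g i\<bar> \<le> C"
proof -
  have "\<bar>\<Sum>i=1..n. w n i x * g i\<bar> \<le> (\<Sum>i=1..n. \<bar>w n i x * g i\<bar>)"
    by (rule sum_abs)
  also have "\<dots> \<le> (\<Sum>i=1..n. w n i x * C)"
  proof (rule sum_mono)
    show "\<bar>w n i x * g i\<bar> \<le> w n i x * C" if "i \<in> {1..n}" for i
      using assms(1) [OF that] w_nonneg [of n i x]
      by (cases "w n i x = 0") (auto simp: abs_mult intro!: mult_left_mono)
  qed
  also have "\<dots> \<le> C"
    using mult_right_mono [OF sum_w_le_1 assms(2)] by (simp add: sum_distrib_right [symmetric])
  finally show ?thesis .
qed

lemma P_integrable_bounded:
  fixes f :: "(nat \<Rightarrow> 'q) \<Rightarrow> real"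
  assumes "f \<in> borel_measurable (P n)" "\<And>x. x \<in> space (P n) \<Longrightarrow> \<bar>f x\<bar> \<le> C"
  shows "integrable (P n) f"
  using assms by (intro P.integrable_const_bound [where B = C]) auto

lemma sq_dev_expand:
  assumes "prob_space M" "integrable M f" "integrable M (\<lambda>x. (f x :: real)\<^sup>2)"
  shows "(\<integral>x. (f x)\<^sup>2 \<partial>M) = (\<integral>x. (f x - integral\<^sup>L M f)\<^sup>2 \<partial>M) + (integral\<^sup>L M f)\<^sup>2"
  using prob_space.variance_eq [OF assms] by simp

lemma sum_w_sq_lim:
  "(\<lambda>n. N n * EP n (\<lambda>x. \<Sum>i=1..n. (w n i x)\<^sup>2)) \<longlonglongrightarrow> \<beta> (1 - 2 * l) * \<mu>2 / m_lim\<^sup>2"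
proof -
  define V where "V n = N n * (\<Sum>i=1..n. (coef n i)\<^sup>2 * expectation (\<lambda>y. (kern i y)\<^sup>2))" for n
  define U where "U n x = (\<Sum>i=1..n. N n * (coef n i)\<^sup>2 * (kern i (x i))\<^sup>2)" for n and x :: "nat \<Rightarrow> 'q"
  define G where "G n = K_hi ^ 4 * (N n ^ (4 - 1) * (\<Sum>i=1..n. coef n i ^ 4 * (F (h i) * 1)))" for n
  have V_lim: "V \<longlonglongrightarrow> \<beta> (1 - 2 * l) * \<mu>2"
    using second_moment_sum_lim by (simp add: V_def [abs_def])
  have G_lim: "G \<longlonglongrightarrow> K_hi ^ 4 * (\<beta> (1 - real 4 * l) * 1)"
    unfolding G_def by (intro tendsto_mult tendsto_const coef_sum_lim) auto
  have U_meas [measurable]: "U n \<in> borel_measurable (P n)" for n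
    unfolding U_def [abs_def] by measurable
  have U_nonneg: "U n x \<ge> 0" for n x
    unfolding U_def by (intro sum_nonneg) (simp add: N_nonneg)
  have sum_w_U: "N n * (\<Sum>i=1..n. (w n i x)\<^sup>2) = U n x / (D n x)\<^sup>2" for n x
    unfolding U_def w_def by (simp add: sum_divide_distrib sum_distrib_left power_divide power_mult_distrib mult_ac)
  have U_le: "U n x \<le> N n * (D n x)\<^sup>2" for n x
  proof (cases "D n x = 0")
    case True
    have "coef n i * kern i (x i) = 0" if "i \<in> {1..n}" for i
      using term_le_D [OF that, of x] term_nonneg [of n i "x i"] True by simp
    then have "(coef n i)\<^sup>2 * (kern i (x i))\<^sup>2 = 0" if "i \<in> {1..n}" for i
      using that by (simp flip: power_mult_distrib)
    then have "U n x = 0" unfolding U_def by (intro sum.neutral) (simp add: mult.assoc)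
    then show ?thesis using True by simp
  next
    case False
    have "U n x / (D n x)\<^sup>2 \<le> N n"
      using mult_left_mono [OF sum_w_sq_le_1 [of n x] N_nonneg [of n]] unfolding sum_w_U by simp
    with False show ?thesis by (simp add: pos_divide_le_eq)
  qed
  have U_var: "EP n (\<lambda>x. (U n x - V n)\<^sup>2) \<le> G n / N n"
    "integrable (P n) (\<lambda>x. (U n x - V n)\<^sup>2)" if n: "n \<ge> 1" for n
  proof -
    have 1: "integrable Q (\<lambda>y. (N n * (coef n i)\<^sup>2 * (kern i y)\<^sup>2)\<^sup>2)" for i
      using kern_pow_integrable [of i 4] by (simp add: power_mult_distrib flip: power_mult)
    have V_eq: "V n = (\<Sum>i=1..n. expectation (\<lambda>y. N n * (coef n i)\<^sup>2 * (kern i y)\<^sup>2))"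
      by (simp add: V_def sum_distrib_left mult.assoc)
    have "EP n (\<lambda>x. (U n x - V n)\<^sup>2) \<le> (\<Sum>i=1..n. expectation (\<lambda>y. (N n * (coef n i)\<^sup>2 * (kern i y)\<^sup>2)\<^sup>2))"
      unfolding U_def V_eq by (rule variance_kern_sum_le(2)) (use 1 in auto)
    also have "\<dots> \<le> (\<Sum>i=1..n. (N n)\<^sup>2 * coef n i ^ 4 * (K_hi ^ 4 * F (h i)))"
    proof (rule sum_mono)
      fix i assume "i \<in> {1..n}"
      then have "expectation (\<lambda>y. kern i y ^ 4) \<le> K_hi ^ 4 * F (h i)"
        by (intro expectation_kern_pow_le) auto
      then have "(N n)\<^sup>2 * coef n i ^ 4 * expectation (\<lambda>y. kern i y ^ 4) \<le> (N n)\<^sup>2 * coef n i ^ 4 * (K_hi ^ 4 * F (h i))"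
        by (intro mult_left_mono) auto
      then show "expectation (\<lambda>y. (N n * (coef n i)\<^sup>2 * (kern i y)\<^sup>2)\<^sup>2) \<le> (N n)\<^sup>2 * coef n i ^ 4 * (K_hi ^ 4 * F (h i))"
        by (simp add: power_mult_distrib flip: power_mult)
    qed
    also have "\<dots> = G n / N n"
      using N_pos [OF n] by (simp add: G_def sum_distrib_left sum_divide_distrib power_numeral_reduce mult_ac)
    finally show "EP n (\<lambda>x. (U n x - V n)\<^sup>2) \<le> G n / N n" .
    show "integrable (P n) (\<lambda>x. (U n x - V n)\<^sup>2)"
      unfolding U_def V_eq by (rule variance_kern_sum_le(1)) (use 1 in auto)
  qed
  obtain CD where CD: "\<forall>\<^sub>F n in sequentially. N n * EP n (\<lambda>x. (D n x - m n)\<^sup>2) \<le> CD"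
    using N_variance_D_bounded by blast
  define R where "R n = sqrt ((G n / N n + (V n)\<^sup>2) * (CD * (1 / N n)))" for n
  define B where "B = 2 * (2 / m_lim) ^ 3"
  have bound: "\<forall>\<^sub>F n in sequentially.
      \<bar>N n * EP n (\<lambda>x. \<Sum>i=1..n. (w n i x)\<^sup>2) - V n / (m n)\<^sup>2\<bar> \<le> B * R n + N n * tail 0 n"
    using CD m_ge eventually_ge_at_top [of 1]
  proof eventually_elim
    case (elim n)
    have Nn: "N n > 0" and mn: "m n > 0"
      using elim N_pos [of n] m_lim_pos by auto
    have U_sq_int: "integrable (P n) (\<lambda>x. (U n x)\<^sup>2)" and U_int: "integrable (P n) (U n)"
    proof -
      define C where "C = (\<Sum>i=1..n. N n * (coef n i)\<^sup>2 * K_hi\<^sup>2)"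
      have "U n x \<le> C" for x
        unfolding U_def C_def using kern_nonneg kern_le Nn by (intro sum_mono mult_left_mono power_mono) auto
      then have *: "\<bar>U n x\<bar> \<le> C" "\<bar>(U n x)\<^sup>2\<bar> \<le> C\<^sup>2" for x
        using U_nonneg [of n x] by (auto intro: power_mono)
      show "integrable (P n) (\<lambda>x. (U n x)\<^sup>2)" "integrable (P n) (U n)"
        by (rule P_integrable_bounded [OF _ *(2)], measurable, rule P_integrable_bounded [OF _ *(1)], measurable)
    qed
    have U_mean: "EP n (U n) = V n"
    proof -
      have kP: "integrable (P n) (\<lambda>x. (kern i (x i))\<^sup>2)"
        "EP n (\<lambda>x. (kern i (x i))\<^sup>2) = expectation (\<lambda>y. (kern i y)\<^sup>2)" if "i \<in> {1..n}" for i
        using integrable_P_component_iff [OF that, of "\<lambda>y. (kern i y)\<^sup>2"] kern_pow_integrable [of i 2] by auto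
      have "EP n (U n) = (\<Sum>i=1..n. EP n (\<lambda>x. N n * (coef n i)\<^sup>2 * (kern i (x i))\<^sup>2))"
        unfolding U_def by (intro Bochner_Integration.integral_sum integrable_mult_right kP)
      also have "\<dots> = (\<Sum>i=1..n. N n * (coef n i)\<^sup>2 * expectation (\<lambda>y. (kern i y)\<^sup>2))"
        by (intro sum.cong refl) (simp only: integral_mult_right_zero kP)
      also have "\<dots> = V n"
        unfolding V_def sum_distrib_left by (simp only: mult.assoc)
      finally show ?thesis .
    qed
    have U_sq: "EP n (\<lambda>x. (U n x)\<^sup>2) \<le> G n / N n + (V n)\<^sup>2"
      using sq_dev_expand [OF P.prob_space_axioms U_int U_sq_int] U_var(1) [of n] elim by (simp add: U_mean)
    have D_int: "integrable (P n) (\<lambda>x. (D n x - m n)\<^sup>2)" by (rule variance_D)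
    have D_sq: "EP n (\<lambda>x. (D n x - m n)\<^sup>2) \<le> CD * (1 / N n)"
      using elim Nn by (simp add: field_simps)
    have [measurable]: "(\<lambda>x. D n x - m n) \<in> borel_measurable (P n)" by measurable
    note CS = Cauchy_Schwarz_integral [OF U_meas this U_sq_int D_int]
    have UD: "EP n (\<lambda>x. \<bar>U n x * (D n x - m n)\<bar>) \<le> R n"
    proof -
      have "(EP n (\<lambda>x. \<bar>U n x * (D n x - m n)\<bar>))\<^sup>2 \<le> (G n / N n + (V n)\<^sup>2) * (CD * (1 / N n))"
        by (rule order.trans [OF CS(2) mult_mono [OF U_sq D_sq]])
           (use order.trans [OF _ U_sq] in auto)
      then show ?thesis
        unfolding R_def by (rule real_le_rsqrt)
    qed
    have pw: "\<bar>U n x / (D n x)\<^sup>2 - U n x / (m n)\<^sup>2\<bar>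
        \<le> B * \<bar>U n x * (D n x - m n)\<bar> + N n * indicator {x \<in> space (P n). D n x \<le> m_lim / 2} x"
      if x: "x \<in> space (P n)" for x
    proof (cases "D n x \<le> m_lim / 2")
      case True
      have "U n x / (D n x)\<^sup>2 \<le> N n"
        using mult_left_mono [OF sum_w_sq_le_1 [of n x] N_nonneg [of n]] unfolding sum_w_U by simp
      moreover have "U n x / (m n)\<^sup>2 \<le> N n"
      proof -
        have "(D n x)\<^sup>2 \<le> (m n)\<^sup>2" using True elim D_nonneg [of n x] by (intro power_mono) auto
        then have "U n x \<le> N n * (m n)\<^sup>2"
          using U_le [of n x] mult_left_mono [of "(D n x)\<^sup>2" "(m n)\<^sup>2" "N n"] Nn by linarith
        then show ?thesis using mn by (simp add: pos_divide_le_eq)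
      qed
      moreover have "U n x / (D n x)\<^sup>2 \<ge> 0" "U n x / (m n)\<^sup>2 \<ge> 0" using U_nonneg by auto
      moreover have "0 \<le> B * \<bar>U n x * (D n x - m n)\<bar>" using m_lim_pos by (simp add: B_def)
      ultimately show ?thesis using True x by simp
    next
      case False
      define d where "d = D n x"
      have d: "d > m_lim / 2" "d > 0" using False m_lim_pos by (auto simp: d_def)
      have inv_d: "1 / d \<le> 2 / m_lim" and inv_m: "1 / m n \<le> 2 / m_lim"
        using d mn elim m_lim_pos by (simp_all add: field_simps)
      have "1 / d\<^sup>2 - 1 / (m n)\<^sup>2 = (m n - d) * ((1 / d) * (1 / d) * (1 / m n) + (1 / d) * (1 / m n) * (1 / m n))"
        using d mn by (simp add: field_simps power2_eq_square)
      then have "\<bar>1 / d\<^sup>2 - 1 / (m n)\<^sup>2\<bar> = \<bar>d - m n\<bar> * ((1 / d) * (1 / d) * (1 / m n) + (1 / d) * (1 / m n) * (1 / m n))"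
        using d mn by (simp add: abs_mult abs_minus_commute)
      also have "\<dots> \<le> \<bar>d - m n\<bar> * ((2 / m_lim) * (2 / m_lim) * (2 / m_lim) + (2 / m_lim) * (2 / m_lim) * (2 / m_lim))"
        using d mn inv_d inv_m m_lim_pos by (intro mult_left_mono add_mono mult_mono) auto
      also have "\<dots> = B * \<bar>d - m n\<bar>" by (simp add: B_def power3_eq_cube mult_ac)
      finally have "\<bar>1 / d\<^sup>2 - 1 / (m n)\<^sup>2\<bar> \<le> B * \<bar>d - m n\<bar>" .
      then have "U n x * \<bar>1 / d\<^sup>2 - 1 / (m n)\<^sup>2\<bar> \<le> U n x * (B * \<bar>d - m n\<bar>)"
        using U_nonneg by (rule mult_left_mono)
      moreover have "\<bar>U n x / d\<^sup>2 - U n x / (m n)\<^sup>2\<bar> = U n x * \<bar>1 / d\<^sup>2 - 1 / (m n)\<^sup>2\<bar>"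
      proof -
        have "U n x / d\<^sup>2 - U n x / (m n)\<^sup>2 = U n x * (1 / d\<^sup>2 - 1 / (m n)\<^sup>2)"
          by (simp add: right_diff_distrib)
        then show ?thesis using U_nonneg [of n x] by (simp add: abs_mult)
      qed
      ultimately show ?thesis
        using False U_nonneg [of n x] by (simp add: d_def abs_mult mult_ac)
    qed
    have w_int: "integrable (P n) (\<lambda>x. U n x / (D n x)\<^sup>2)"
    proof (rule P_integrable_bounded [where C = "N n"])
      show "\<bar>U n x / (D n x)\<^sup>2\<bar> \<le> N n" for x
        using mult_left_mono [OF sum_w_sq_le_1 [of n x] N_nonneg [of n]] U_nonneg [of n x]
        unfolding sum_w_U by simp
    qed measurable
    have "\<bar>EP n (\<lambda>x. U n x / (D n x)\<^sup>2) - V n / (m n)\<^sup>2\<bar>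
        = \<bar>EP n (\<lambda>x. U n x / (D n x)\<^sup>2 - U n x / (m n)\<^sup>2)\<bar>"
      using w_int U_int by (simp add: U_mean)
    also have "\<dots> \<le> EP n (\<lambda>x. \<bar>U n x / (D n x)\<^sup>2 - U n x / (m n)\<^sup>2\<bar>)"
      by (rule integral_abs_bound)
    also have "\<dots> \<le> EP n (\<lambda>x. B * \<bar>U n x * (D n x - m n)\<bar>
        + N n * indicator {x \<in> space (P n). D n x \<le> m_lim / 2} x)"
      using w_int U_int CS(1) pw
      by (intro integral_mono) (auto simp: P.emeasure_eq_measure)
    also have "\<dots> = B * EP n (\<lambda>x. \<bar>U n x * (D n x - m n)\<bar>) + N n * tail 0 n"
      using CS(1) prob_D_small_le [of n] by (simp add: P.emeasure_eq_measure)
    also have "\<dots> \<le> B * R n + N n * tail 0 n"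
      using UD m_lim_pos by (intro add_right_mono mult_left_mono) (auto simp: B_def)
    also have "EP n (\<lambda>x. U n x / (D n x)\<^sup>2) = N n * EP n (\<lambda>x. \<Sum>i=1..n. (w n i x)\<^sup>2)"
      unfolding sum_w_U [symmetric] by simp
    finally show ?case .
  qed
  have "R \<longlonglongrightarrow> sqrt ((K_hi ^ 4 * (\<beta> (1 - real 4 * l) * 1) * 0 + (\<beta> (1 - 2 * l) * \<mu>2)\<^sup>2) * (CD * 0))"
    unfolding R_def divide_inverse [of "G _"] inverse_eq_divide [of "N _"]
    by (intro tendsto_real_sqrt tendsto_mult tendsto_add tendsto_power tendsto_const V_lim G_lim N_inverse)
  then have "(\<lambda>n. B * R n + N n * tail 0 n) \<longlonglongrightarrow> B * 0 + 0"
    by (intro tendsto_add tendsto_mult tendsto_const N_tail_lim) simp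
  then have "(\<lambda>n. N n * EP n (\<lambda>x. \<Sum>i=1..n. (w n i x)\<^sup>2) - V n / (m n)\<^sup>2) \<longlonglongrightarrow> 0"
    by (intro Lim_null_comparison [OF bound [folded real_norm_def]]) simp
  moreover have "(\<lambda>n. V n / (m n)\<^sup>2) \<longlonglongrightarrow> \<beta> (1 - 2 * l) * \<mu>2 / m_lim\<^sup>2"
    using m_lim_pos by (intro tendsto_divide V_lim tendsto_power m_tendsto) auto
  ultimately show ?thesis
    using Lim_transform by fastforce
qed

text \<open>The ratio is compared with the centred numerator \<open>\<xi>\<close>, whose weighted version
  \<open>\<xi> / D\<close> differs from \<open>S - b\<close> only where the denominator vanishes.\<close>

lemma ratio_linearization:
  fixes f :: "nat \<Rightarrow> 'q \<Rightarrow> real" and C :: "nat \<Rightarrow> real"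
  assumes f_meas [measurable]: "\<And>i. f i \<in> borel_measurable Q"
    and f_le: "\<And>i y. i \<ge> 1 \<Longrightarrow> \<rho> y \<in> {0..h i} \<Longrightarrow> \<bar>f i y\<bar> \<le> C i"
    and C_lim: "C \<longlonglongrightarrow> 0"
  defines "S \<equiv> \<lambda>n x. \<Sum>i=1..n. w n i x * f i (x i)"
    and "b \<equiv> \<lambda>n. (\<Sum>i=1..n. coef n i * expectation (\<lambda>y. kern i y * f i y)) / m n"
  shows "(\<lambda>n. N n * EP n (\<lambda>x. (S n x - b n)\<^sup>2)) \<longlonglongrightarrow> 0"
    and "(\<lambda>n. N n * (EP n (S n) - b n)) \<longlonglongrightarrow> 0"
proof -
  obtain C0 where C0: "\<And>i. \<bar>C i\<bar> \<le> C0" and C0_nonneg: "C0 \<ge> 0"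
    using convergent_imp_Bseq [OF convergentI [OF C_lim]] unfolding Bseq_def real_norm_def using less_imp_le by blast
  have f_kern: "\<bar>f i y\<bar> \<le> \<bar>C i\<bar>" if "i \<ge> 1" "kern i y \<noteq> 0" for i y
    using f_le [OF that(1) kern_nz [OF that]] by simp
  have kf_int: "integrable Q (\<lambda>y. kern i y * f i y)" if "i \<ge> 1" for i
    using integrable_kern_mult [of i "\<bar>C i\<bar>" "f i" 1] that f_kern by simp
  have kf_le: "\<bar>expectation (\<lambda>y. kern i y * f i y)\<bar> \<le> K_hi * \<bar>C i\<bar> * F (h i)" if "i \<ge> 1" for i
    using expectation_kern_mult_le [of i "\<bar>C i\<bar>" "f i" 1] that f_kern by simp
  have b_lim: "b \<longlonglongrightarrow> 0"
  proof -
    have "(\<lambda>n. K_hi * (N n ^ (1 - 1) * (\<Sum>i=1..n. coef n i ^ 1 * (F (h i) * \<bar>C i\<bar>))))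
        \<longlonglongrightarrow> K_hi * (\<beta> (1 - real 1 * l) * \<bar>0\<bar>)"
      by (intro tendsto_mult tendsto_const coef_sum_lim tendsto_rabs C_lim) simp
    then have lim: "(\<lambda>n. K_hi * (\<Sum>i=1..n. coef n i * (F (h i) * \<bar>C i\<bar>))) \<longlonglongrightarrow> 0" by simp
    have "(\<lambda>n. \<Sum>i=1..n. coef n i * expectation (\<lambda>y. kern i y * f i y)) \<longlonglongrightarrow> 0"
    proof (rule Lim_null_comparison [OF always_eventually lim], rule allI)
      fix n
      have "\<bar>\<Sum>i=1..n. coef n i * expectation (\<lambda>y. kern i y * f i y)\<bar>
          \<le> (\<Sum>i=1..n. coef n i * (K_hi * \<bar>C i\<bar> * F (h i)))"
        by (rule order.trans [OF sum_abs])
           (auto intro!: sum_mono mult_left_mono kf_le simp: abs_mult coef_nonneg)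
      then show "norm (\<Sum>i=1..n. coef n i * expectation (\<lambda>y. kern i y * f i y))
          \<le> K_hi * (\<Sum>i=1..n. coef n i * (F (h i) * \<bar>C i\<bar>))"
        by (simp add: sum_distrib_left mult_ac)
    qed
    then have "b \<longlonglongrightarrow> 0 / m_lim"
      unfolding b_def using m_lim_pos by (intro tendsto_divide m_tendsto) auto
    then show ?thesis by simp
  qed
  have b_le_1: "\<forall>\<^sub>F n in sequentially. \<bar>b n\<bar> \<le> 1"
    using tendstoD [OF b_lim, of 1] by (auto simp: dist_real_def elim!: eventually_mono)
  define \<xi> where "\<xi> n x = (\<Sum>i=1..n. coef n i * (kern i (x i) * (f i (x i) - b n)))" for n and x :: "nat \<Rightarrow> 'q"
  define T where "T n x = \<xi> n x / D n x" for n x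
  have \<xi>_meas [measurable]: "\<xi> n \<in> borel_measurable (P n)" for n
    unfolding \<xi>_def [abs_def] by measurable
  have T_meas [measurable]: "T n \<in> borel_measurable (P n)" for n
    unfolding T_def [abs_def] by measurable
  have S_meas [measurable]: "S n \<in> borel_measurable (P n)" for n
    unfolding S_def by measurable
  have T_sum: "T n x = (\<Sum>i=1..n. w n i x * (f i (x i) - b n))" for n x
    by (simp add: T_def \<xi>_def w_def sum_divide_distrib mult.assoc)
  have T_S: "S n x - b n = T n x - (if D n x = 0 then b n else 0)" for n x
    using sum_w [of n x]
    by (simp add: T_sum S_def right_diff_distrib sum_subtractf flip: sum_distrib_right)
  have T_0: "T n x = 0" if "D n x = 0" for n x
    using that by (simp add: T_def)
  define G where "G n = N n * (\<Sum>i=1..n. (coef n i)\<^sup>2 * (K_hi\<^sup>2 * (2 * (C i)\<^sup>2 + 2 * (b n)\<^sup>2) * F (h i)))" for n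
  have G_lim: "G \<longlonglongrightarrow> 0"
  proof -
    let ?s = "\<lambda>y n. N n ^ (2 - 1) * (\<Sum>i=1..n. coef n i ^ 2 * (F (h i) * y i))"
    have "(\<lambda>n. 2 * K_hi\<^sup>2 * ?s (\<lambda>i. (C i)\<^sup>2) n + 2 * K_hi\<^sup>2 * (b n)\<^sup>2 * ?s (\<lambda>_. 1) n)
      \<longlonglongrightarrow> 2 * K_hi\<^sup>2 * (\<beta> (1 - real 2 * l) * 0\<^sup>2) + 2 * K_hi\<^sup>2 * 0\<^sup>2 * (\<beta> (1 - real 2 * l) * 1)"
      by (intro tendsto_add tendsto_mult tendsto_const tendsto_power b_lim C_lim coef_sum_lim) auto
    also have "(\<lambda>n. 2 * K_hi\<^sup>2 * ?s (\<lambda>i. (C i)\<^sup>2) n + 2 * K_hi\<^sup>2 * (b n)\<^sup>2 * ?s (\<lambda>_. 1) n) = G"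
      by (simp add: G_def fun_eq_iff sum_distrib_left sum.distrib [symmetric] algebra_simps)
    finally show ?thesis by simp
  qed
  have main: "\<forall>\<^sub>F n in sequentially. integrable (P n) (\<lambda>x. (T n x)\<^sup>2) \<and>
      N n * EP n (\<lambda>x. (T n x)\<^sup>2) \<le> (4 / m_lim\<^sup>2) * G n + (C0 + 1)\<^sup>2 * (N n * tail 0 n) \<and>
      EP n (\<xi> n) = 0 \<and> integrable (P n) (\<xi> n)"
    using b_le_1 m_ge eventually_ge_at_top [of 1]
  proof eventually_elim
    case (elim n)
    have mn: "m n > 0" using elim m_lim_pos by simp
    define g where "g i y = coef n i * (kern i y * (f i y - b n))" for i y
    have g_meas [measurable]: "g i \<in> borel_measurable Q" for i
      unfolding g_def [abs_def] by measurable
    have g_int: "integrable Q (g i)" if "i \<ge> 1" for i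
      using kf_int [OF that] kern_integrable [of i] by (simp add: g_def [abs_def] right_diff_distrib)
    have k2: "integrable Q (\<lambda>y. kern i y ^ 2 * (f i y - b n)\<^sup>2)"
        "\<bar>expectation (\<lambda>y. kern i y ^ 2 * (f i y - b n)\<^sup>2)\<bar> \<le> K_hi ^ 2 * (2 * (C i)\<^sup>2 + 2 * (b n)\<^sup>2) * F (h i)"
      if i: "i \<ge> 1" for i
    proof -
      have *: "\<bar>(f i y - b n)\<^sup>2\<bar> \<le> 2 * (C i)\<^sup>2 + 2 * (b n)\<^sup>2" if "kern i y \<noteq> 0" for y
      proof -
        have "(f i y)\<^sup>2 \<le> (C i)\<^sup>2" using f_kern [OF i that] by (simp add: abs_le_square_iff)
        moreover have "(f i y - b n)\<^sup>2 \<le> 2 * (f i y)\<^sup>2 + 2 * (b n)\<^sup>2"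
          using zero_le_power2 [of "f i y + b n"] by (simp add: power2_sum power2_diff)
        ultimately show ?thesis by simp
      qed
      show "integrable Q (\<lambda>y. kern i y ^ 2 * (f i y - b n)\<^sup>2)"
        by (rule integrable_kern_mult [OF i _ *]) auto
      show "\<bar>expectation (\<lambda>y. kern i y ^ 2 * (f i y - b n)\<^sup>2)\<bar> \<le> K_hi ^ 2 * (2 * (C i)\<^sup>2 + 2 * (b n)\<^sup>2) * F (h i)"
        by (rule expectation_kern_mult_le [OF i _ *]) auto
    qed
    have g_sq_int: "integrable Q (\<lambda>y. (g i y)\<^sup>2)" if "i \<ge> 1" for i
      using k2(1) [OF that] by (simp add: g_def power_mult_distrib)
    have g_sum0: "(\<Sum>i=1..n. expectation (g i)) = 0"
    proof -
      have "(\<Sum>i=1..n. expectation (g i))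
          = (\<Sum>i=1..n. coef n i * expectation (\<lambda>y. kern i y * f i y) - b n * (coef n i * expectation (kern i)))"
      proof (intro sum.cong refl)
        fix i assume "i \<in> {1..n}"
        moreover have "g i = (\<lambda>y. coef n i * (kern i y * f i y - b n * kern i y))"
          by (simp add: g_def fun_eq_iff algebra_simps)
        ultimately have "expectation (g i) =
            coef n i * (expectation (\<lambda>y. kern i y * f i y) - b n * expectation (kern i))"
          using kf_int [of i] kern_integrable [of i] by simp
        then show "expectation (g i) =
            coef n i * expectation (\<lambda>y. kern i y * f i y) - b n * (coef n i * expectation (kern i))"
          by (simp add: right_diff_distrib mult.left_commute)
      qed
      also have "\<dots> = m n * b n - b n * m n"
      proof -
        have mb: "m n * b n = (\<Sum>i=1..n. coef n i * expectation (\<lambda>y. kern i y * f i y))"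
          using mn by (simp add: b_def)
        show ?thesis
          unfolding sum_subtractf sum_distrib_left [symmetric] m_def [symmetric] mb ..
      qed
      finally show ?thesis by simp
    qed
    have \<xi>_g: "\<xi> n x = (\<Sum>i=1..n. g i (x i))" for x
      by (simp add: \<xi>_def g_def)
    have var: "integrable (P n) (\<lambda>x. (\<xi> n x)\<^sup>2)"
      "EP n (\<lambda>x. (\<xi> n x)\<^sup>2) \<le> (\<Sum>i=1..n. expectation (\<lambda>y. (g i y)\<^sup>2))"
      using variance_kern_sum_le [of n g] g_sq_int unfolding \<xi>_g g_sum0 by simp_all
    have G_ge: "N n * EP n (\<lambda>x. (\<xi> n x)\<^sup>2) \<le> G n"
      unfolding G_def
    proof (intro mult_left_mono N_nonneg order.trans [OF var(2)] sum_mono)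
      fix i assume "i \<in> {1..n}"
      then have "expectation (\<lambda>y. kern i y ^ 2 * (f i y - b n)\<^sup>2) \<le> K_hi ^ 2 * (2 * (C i)\<^sup>2 + 2 * (b n)\<^sup>2) * F (h i)"
        using k2(2) [of i] by (simp add: abs_le_iff)
      then show "expectation (\<lambda>y. (g i y)\<^sup>2) \<le> (coef n i)\<^sup>2 * (K_hi\<^sup>2 * (2 * (C i)\<^sup>2 + 2 * (b n)\<^sup>2) * F (h i))"
        by (simp add: g_def power_mult_distrib mult_left_mono)
    qed
    have T_le: "\<bar>T n x\<bar> \<le> C0 + 1" for x
      unfolding T_sum
    proof (rule sum_w_mult_le)
      fix i assume "i \<in> {1..n}" "w n i x \<noteq> 0"
      then have "\<bar>f i (x i)\<bar> \<le> C i" using w_nz [of i n x] f_le by auto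
      then show "\<bar>f i (x i) - b n\<bar> \<le> C0 + 1" using C0 [of i] elim by linarith
    qed (use C0_nonneg in simp)
    have T_sq_le: "(T n x)\<^sup>2 \<le> 4 / m_lim\<^sup>2 * (\<xi> n x)\<^sup>2
        + (C0 + 1)\<^sup>2 * indicator {x \<in> space (P n). D n x \<le> m_lim / 2} x" if x: "x \<in> space (P n)" for x
    proof (cases "D n x \<le> m_lim / 2")
      case True
      have "(T n x)\<^sup>2 \<le> (C0 + 1)\<^sup>2" using T_le [of x] C0_nonneg by (simp add: abs_le_square_iff [symmetric])
      then show ?thesis using True x by (simp add: add_increasing)
    next
      case False
      have "(\<xi> n x)\<^sup>2 / (D n x)\<^sup>2 \<le> (\<xi> n x)\<^sup>2 / (m_lim / 2)\<^sup>2"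
        using False m_lim_pos by (intro divide_left_mono power_mono mult_pos_pos) auto
      then show ?thesis using False by (simp add: T_def power_divide mult.commute)
    qed
    have T_sq_int: "integrable (P n) (\<lambda>x. (T n x)\<^sup>2)"
      by (rule P_integrable_bounded [where C = "(C0 + 1)\<^sup>2"])
         (use T_le C0_nonneg in \<open>auto simp: abs_le_square_iff [symmetric]\<close>)
    have "EP n (\<lambda>x. (T n x)\<^sup>2) \<le> EP n (\<lambda>x. 4 / m_lim\<^sup>2 * (\<xi> n x)\<^sup>2
        + (C0 + 1)\<^sup>2 * indicator {x \<in> space (P n). D n x \<le> m_lim / 2} x)"
      using T_sq_int var(1) T_sq_le by (intro integral_mono) (auto simp: P.emeasure_eq_measure)
    also have "\<dots> = 4 / m_lim\<^sup>2 * EP n (\<lambda>x. (\<xi> n x)\<^sup>2) + (C0 + 1)\<^sup>2 * tail 0 n"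
      using var(1) prob_D_small_le [of n] by (simp add: P.emeasure_eq_measure)
    finally have "N n * EP n (\<lambda>x. (T n x)\<^sup>2)
        \<le> N n * (4 / m_lim\<^sup>2 * EP n (\<lambda>x. (\<xi> n x)\<^sup>2) + (C0 + 1)\<^sup>2 * tail 0 n)"
      by (intro mult_left_mono N_nonneg)
    also have "\<dots> = 4 / m_lim\<^sup>2 * (N n * EP n (\<lambda>x. (\<xi> n x)\<^sup>2)) + (C0 + 1)\<^sup>2 * (N n * tail 0 n)"
      by (simp add: algebra_simps)
    also have "\<dots> \<le> 4 / m_lim\<^sup>2 * G n + (C0 + 1)\<^sup>2 * (N n * tail 0 n)"
      using G_ge by (intro add_right_mono mult_left_mono) auto
    finally have T_bound: "N n * EP n (\<lambda>x. (T n x)\<^sup>2)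
        \<le> 4 / m_lim\<^sup>2 * G n + (C0 + 1)\<^sup>2 * (N n * tail 0 n)" .
    have gP: "integrable (P n) (\<lambda>x. g i (x i))" "EP n (\<lambda>x. g i (x i)) = expectation (g i)"
      if "i \<in> {1..n}" for i
      using integrable_P_component_iff [OF that g_meas] g_int [of i] that by auto
    have "EP n (\<xi> n) = (\<Sum>i=1..n. expectation (g i))"
      unfolding \<xi>_g using gP by (simp add: Bochner_Integration.integral_sum)
    moreover have "integrable (P n) (\<xi> n)"
      unfolding \<xi>_g using gP by (intro Bochner_Integration.integrable_sum) auto
    ultimately show ?case using T_sq_int T_bound g_sum0 by simp
  qed
  have up_lim: "(\<lambda>n. 4 / m_lim\<^sup>2 * G n + (C0 + 1)\<^sup>2 * (N n * tail 0 n)) \<longlonglongrightarrow> 0"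
    using tendsto_add [OF tendsto_mult [OF tendsto_const [of "4 / m_lim\<^sup>2"] G_lim]
        tendsto_mult [OF tendsto_const [of "(C0 + 1)\<^sup>2"] N_tail_lim [of 0]]] by simp
  have T_lim: "(\<lambda>n. N n * EP n (\<lambda>x. (T n x)\<^sup>2)) \<longlonglongrightarrow> 0"
    by (rule tendsto_sandwich [OF _ _ tendsto_const up_lim])
       (use main in \<open>auto simp: N_nonneg elim!: eventually_mono\<close>)
  define Z where "Z n = P.prob n {x \<in> space (P n). D n x = 0}" for n
  have Z_le: "Z n \<le> tail 0 n" for n
    unfolding Z_def prob_D_small_le [symmetric] using m_lim_pos
    by (intro P.finite_measure_mono) auto
  have Z_nonneg: "Z n \<ge> 0" for n by (simp add: Z_def)
  have Z_lim: "(\<lambda>n. N n * Z n) \<longlonglongrightarrow> 0"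
    by (rule tendsto_sandwich [OF _ _ tendsto_const N_tail_lim [of 0]])
       (auto simp: Z_le Z_nonneg N_nonneg mult_left_mono)
  have Z_int: "EP n (\<lambda>x. if D n x = 0 then a else 0) = a * Z n"
    "integrable (P n) (\<lambda>x. if D n x = 0 then a else 0)" for n and a :: real
  proof -
    have "EP n (\<lambda>x. if D n x = 0 then a else 0)
        = EP n (\<lambda>x. a * indicator {x \<in> space (P n). D n x = 0} x)"
      by (intro Bochner_Integration.integral_cong refl) simp
    then show "EP n (\<lambda>x. if D n x = 0 then a else 0) = a * Z n"
      by (simp add: Z_def)
    show "integrable (P n) (\<lambda>x. if D n x = 0 then a else 0)"
      by (rule P_integrable_bounded [where C = "\<bar>a\<bar>"]) auto
  qed
  show "(\<lambda>n. N n * EP n (\<lambda>x. (S n x - b n)\<^sup>2)) \<longlonglongrightarrow> 0"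
  proof -
    have "\<forall>\<^sub>F n in sequentially. N n * EP n (\<lambda>x. (T n x)\<^sup>2) + (b n)\<^sup>2 * (N n * Z n)
        = N n * EP n (\<lambda>x. (S n x - b n)\<^sup>2)"
      using main
    proof eventually_elim
      case (elim n)
      have "(S n x - b n)\<^sup>2 = (T n x)\<^sup>2 + (if D n x = 0 then (b n)\<^sup>2 else 0)" for x
        unfolding T_S using T_0 by auto
      then show ?case
        using elim Z_int [of n "(b n)\<^sup>2"] by (simp add: algebra_simps)
    qed
    moreover have "(\<lambda>n. N n * EP n (\<lambda>x. (T n x)\<^sup>2) + (b n)\<^sup>2 * (N n * Z n)) \<longlonglongrightarrow> 0 + 0\<^sup>2 * 0"
      by (intro tendsto_intros T_lim b_lim Z_lim)
    ultimately show ?thesis by (simp add: filterlim_cong)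
  qed
  obtain CD where CD: "\<forall>\<^sub>F n in sequentially. N n * EP n (\<lambda>x. (D n x - m n)\<^sup>2) \<le> CD"
    using N_variance_D_bounded by blast
  define W where "W n = N n * EP n (\<lambda>x. (T n x)\<^sup>2)" for n
  have bound: "\<forall>\<^sub>F n in sequentially. norm (N n * (EP n (S n) - b n))
      \<le> 2 / m_lim * sqrt (W n * CD) + \<bar>b n\<bar> * (N n * Z n)"
    using main CD m_ge eventually_ge_at_top [of 1]
  proof eventually_elim
    case (elim n)
    have Nn: "N n > 0" and mn: "m n > 0"
      using elim N_pos [of n] m_lim_pos by auto
    have [measurable]: "(\<lambda>x. D n x - m n) \<in> borel_measurable (P n)" by measurable
    note CS = Cauchy_Schwarz_integral [OF T_meas this _ variance_D(1)]
    have TD_int: "integrable (P n) (\<lambda>x. T n x * (D n x - m n))"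
      using CS(1) elim by blast
    have T_eq: "T n x = (\<xi> n x - T n x * (D n x - m n)) / m n" for x
    proof (cases "D n x = 0")
      case True
      have "coef n i * kern i (x i) = 0" if "i \<in> {1..n}" for i
        using term_le_D [OF that, of x] term_nonneg [of n i "x i"] True by simp
      then have "\<xi> n x = 0" unfolding \<xi>_def by (intro sum.neutral) (force simp: mult.assoc [symmetric])
      then show ?thesis using True by (simp add: T_def)
    next
      case False
      then show ?thesis using mn by (simp add: T_def field_simps)
    qed
    have "EP n (T n) = EP n (\<lambda>x. (\<xi> n x - T n x * (D n x - m n)) / m n)"
      by (intro Bochner_Integration.integral_cong refl) (rule T_eq)
    then have ET: "EP n (T n) = - EP n (\<lambda>x. T n x * (D n x - m n)) / m n"
      using elim TD_int by simp
    have T_int: "integrable (P n) (T n)"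
      using P.square_integrable_imp_integrable [OF T_meas] elim by simp
    have "EP n (S n) - b n = EP n (\<lambda>x. S n x - b n)"
    proof -
      have "integrable (P n) (\<lambda>x. b n + (T n x - (if D n x = 0 then b n else 0)))"
        using T_int Z_int by simp
      then have "integrable (P n) (S n)" by (simp add: T_S [symmetric])
      then show ?thesis by (simp add: P.prob_space)
    qed
    also have "\<dots> = EP n (T n) - b n * Z n"
      unfolding T_S using T_int Z_int by simp
    finally have ES: "EP n (S n) - b n = EP n (T n) - b n * Z n" .
    have "(N n * EP n (\<lambda>x. \<bar>T n x * (D n x - m n)\<bar>))\<^sup>2
        \<le> (N n)\<^sup>2 * (EP n (\<lambda>x. (T n x)\<^sup>2) * EP n (\<lambda>x. (D n x - m n)\<^sup>2))"
      unfolding power_mult_distrib using CS(2) elim by (intro mult_left_mono) auto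
    also have "\<dots> = W n * (N n * EP n (\<lambda>x. (D n x - m n)\<^sup>2))"
      by (simp add: W_def power2_eq_square)
    also have "\<dots> \<le> W n * CD"
      using elim by (intro mult_left_mono) (auto simp: W_def N_nonneg)
    finally have TD: "N n * EP n (\<lambda>x. \<bar>T n x * (D n x - m n)\<bar>) \<le> sqrt (W n * CD)"
      by (rule real_le_rsqrt)
    have "N n * \<bar>EP n (\<lambda>x. T n x * (D n x - m n))\<bar> \<le> sqrt (W n * CD)"
      by (rule order.trans [OF mult_left_mono [OF integral_abs_bound N_nonneg] TD])
    then have "N n * \<bar>EP n (T n)\<bar> \<le> sqrt (W n * CD) / m n"
      using mn by (simp add: ET divide_right_mono)
    also have "\<dots> = 1 / m n * sqrt (W n * CD)" by simp
    also have "\<dots> \<le> 2 / m_lim * sqrt (W n * CD)"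
    proof (rule mult_right_mono)
      show "1 / m n \<le> 2 / m_lim" using elim m_lim_pos mn by (simp add: field_simps)
      show "0 \<le> sqrt (W n * CD)" using TD
        by (rule order.trans [rotated]) (simp add: N_nonneg)
    qed
    finally have "N n * \<bar>EP n (T n)\<bar> \<le> 2 / m_lim * sqrt (W n * CD)" .
    moreover have "norm (N n * (EP n (S n) - b n)) \<le> N n * \<bar>EP n (T n)\<bar> + \<bar>b n\<bar> * (N n * Z n)"
    proof -
      have "\<bar>EP n (T n) - b n * Z n\<bar> \<le> \<bar>EP n (T n)\<bar> + \<bar>b n\<bar> * Z n"
        using Z_nonneg [of n] abs_triangle_ineq4 [of "EP n (T n)" "b n * Z n"]
        by (simp add: abs_mult)
      from mult_left_mono [OF this N_nonneg [of n]]
      have "N n * \<bar>EP n (T n) - b n * Z n\<bar> \<le> N n * \<bar>EP n (T n)\<bar> + \<bar>b n\<bar> * (N n * Z n)"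
        by (simp only: distrib_left mult.left_commute)
      moreover have "norm (N n * (EP n (S n) - b n)) = N n * \<bar>EP n (T n) - b n * Z n\<bar>"
        unfolding ES real_norm_def abs_mult by (simp add: N_nonneg)
      ultimately show ?thesis by simp
    qed
    ultimately show ?case by linarith
  qed
  have "(\<lambda>n. 2 / m_lim * sqrt (W n * CD) + \<bar>b n\<bar> * (N n * Z n)) \<longlonglongrightarrow> 2 / m_lim * sqrt (0 * CD) + \<bar>0\<bar> * 0"
    using T_lim by (intro tendsto_intros b_lim Z_lim) (simp_all add: W_def)
  then show "(\<lambda>n. N n * (EP n (S n) - b n)) \<longlonglongrightarrow> 0"
    by (intro Lim_null_comparison [OF bound]) simp
qed

end

section \<open>Bias and variance of the weighted mean\<close>

locale kernel_regression = kernel_weights Q \<rho> F K h l K_lo K_hi \<mu>1 \<mu>2 \<beta>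
  for Q :: "'q measure" and \<rho> :: "'q \<Rightarrow> real" and F K :: "real \<Rightarrow> real" and h :: "nat \<Rightarrow> real"
    and l K_lo K_hi \<mu>1 \<mu>2 :: real and \<beta> :: "real \<Rightarrow> real" +
  fixes Z :: "'q \<Rightarrow> real" and \<phi> :: "real \<Rightarrow> real" and \<phi>' s \<alpha> \<mu>0 :: real
  assumes Z_meas [measurable]: "Z \<in> borel_measurable Q"
    and Z_int: "integrable Q Z"
    and Z_sq_int: "\<And>i. i \<ge> 1 \<Longrightarrow> integrable Q (\<lambda>y. indicator {0..h i} (\<rho> y) * (Z y)\<^sup>2)"
    and \<phi>_meas [measurable]: "\<phi> \<in> borel_measurable borel"
    and \<phi>_int: "integrable Q (\<lambda>y. \<phi> (\<rho> y))"
    and cond_mean: "\<And>g. g \<in> borel_measurable borel \<Longrightarrow> bounded (range g) \<Longrightarrow>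
      expectation (\<lambda>y. g (\<rho> y) * Z y) = expectation (\<lambda>y. g (\<rho> y) * \<phi> (\<rho> y))"
    and cond_var: "\<And>\<epsilon>. \<epsilon> > 0 \<Longrightarrow> \<exists>t>0. \<forall>g\<in>borel_measurable borel.
      (\<forall>u. 0 \<le> g u \<and> g u \<le> 1) \<longrightarrow> (\<forall>u. u \<notin> {0..t} \<longrightarrow> g u = 0) \<longrightarrow>
      \<bar>expectation (\<lambda>y. g (\<rho> y) * ((Z y)\<^sup>2 - (\<phi> (\<rho> y))\<^sup>2)) - s * expectation (\<lambda>y. g (\<rho> y))\<bar>
        \<le> \<epsilon> * expectation (\<lambda>y. g (\<rho> y))"
    and \<phi>_0: "\<phi> 0 = 0"
    and \<phi>_deriv: "(\<phi> has_real_derivative \<phi>') (at 0 within {0..})"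
    and \<mu>0: "(\<lambda>i. expectation (\<lambda>y. \<rho> y / h i * K (\<rho> y / h i)) / F (h i)) \<longlonglongrightarrow> \<mu>0"
    and A_lim: "A_avg F h l \<longlonglongrightarrow> \<alpha>"
begin

definition w_of :: "nat \<Rightarrow> nat \<Rightarrow> (nat \<Rightarrow> real) \<Rightarrow> real" where
  "w_of n i r = coef n i * K (r i / h i) / (\<Sum>j=1..n. coef n j * K (r j / h j))"

lemma w_eq_w_of: "w n i x = w_of n i (\<lambda>j. \<rho> (x j))"
  by (simp add: w_def w_of_def D_def kern_def)

lemma w_upd: "w n i (x(j := y)) = w_of n i ((\<lambda>k. \<rho> (x k))(j := \<rho> y))"
  unfolding w_eq_w_of by (rule arg_cong [where f = "w_of n i"]) auto

lemma w_of_meas [measurable]: "(\<lambda>t. w_of n i (r(j := t))) \<in> borel_measurable borel"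
proof -
  have [measurable]: "(\<lambda>t. K ((r(j := t)) k / h k)) \<in> borel_measurable borel" for k
    by (cases "k = j") simp_all
  show ?thesis unfolding w_of_def by measurable
qed

lemma w_of_bounds:
  assumes "i \<in> {1..n}"
  shows "0 \<le> w_of n i r" "w_of n i r \<le> 1"
proof -
  have nonneg: "coef n j * K (r j / h j) \<ge> 0" for j
    by (simp add: coef_nonneg K_nonneg)
  have "coef n i * K (r i / h i) \<le> (\<Sum>j=1..n. coef n j * K (r j / h j))"
    by (rule member_le_sum [OF assms]) (use nonneg in auto)
  then show "0 \<le> w_of n i r" "w_of n i r \<le> 1"
    using nonneg [of i] sum_nonneg [of "{1..n}" "\<lambda>j. coef n j * K (r j / h j)", OF nonneg]
    by (auto simp: w_of_def divide_le_eq_1 intro!: divide_nonneg_nonneg)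
qed

lemma w_of_0:
  assumes "i \<ge> 1" "r i \<notin> {0..h i}"
  shows "w_of n i r = 0"
  using assms h_pos [of i] K_0 [of "r i / h i"]
  by (auto simp: w_of_def zero_le_divide_iff divide_le_eq_1 not_le)

lemma replace_conditional_mean:
  fixes G :: "(nat \<Rightarrow> 'q) \<Rightarrow> real"
  assumes i: "i \<in> {1..n}"
    and int: "integrable (P n) (\<lambda>x. G x * Z (x i))" "integrable (P n) (\<lambda>x. G x * \<phi> (\<rho> (x i)))"
    and G: "\<And>x. \<exists>g\<in>borel_measurable borel. bounded (range g) \<and> (\<forall>y. G (x(i := y)) = g (\<rho> y))"
  shows "EP n (\<lambda>x. G x * Z (x i)) = EP n (\<lambda>x. G x * \<phi> (\<rho> (x i)))"
proof -
  have "expectation (\<lambda>y. G (x(i := y)) * Z ((x(i := y)) i))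
      = expectation (\<lambda>y. G (x(i := y)) * \<phi> (\<rho> ((x(i := y)) i)))" for x
    using G [of x] cond_mean by auto
  then show ?thesis
    using int unfolding P_def
    by (intro antisym integral_PiM_mono_coordinate [OF prob_space_Q i]) simp_all
qed

lemma expectation_w_Z:
  assumes i: "i \<in> {1..n}"
  shows "EP n (\<lambda>x. w n i x * Z (x i)) = EP n (\<lambda>x. w n i x * \<phi> (\<rho> (x i)))"
proof (rule replace_conditional_mean [OF i])
  have ind: "integrable Q (\<lambda>y. indicator {0..h i} (\<rho> y) * f y)" if f: "integrable Q f" for f :: "'q \<Rightarrow> real"
    by (rule Bochner_Integration.integrable_bound [OF f])
       (use borel_measurable_integrable [OF f] in \<open>auto simp: indicator_def intro!: AE_I2\<close>)
  show "integrable (P n) (\<lambda>x. w n i x * Z (x i))"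
    using integrable_w_mult(1) [OF i Z_meas ind [OF Z_int]] .
  show "integrable (P n) (\<lambda>x. w n i x * \<phi> (\<rho> (x i)))"
    using integrable_w_mult(1) [OF i _ ind [OF \<phi>_int]] by simp
  show "\<exists>g\<in>borel_measurable borel. bounded (range g) \<and> (\<forall>y. w n i (x(i := y)) = g (\<rho> y))" for x
    unfolding w_upd using w_of_bounds [OF i]
    by (intro bexI [of _ "\<lambda>t. w_of n i ((\<lambda>k. \<rho> (x k))(i := t))"])
       (auto simp: bounded_iff intro!: exI [of _ 1])
qed

lemma expectation_w_w_Z_Z:
  assumes ij: "i \<in> {1..n}" "j \<in> {1..n}" "i \<noteq> j"
  shows "EP n (\<lambda>x. w n i x * w n j x * (Z (x i) * Z (x j)))
    = EP n (\<lambda>x. w n i x * w n j x * (\<phi> (\<rho> (x i)) * \<phi> (\<rho> (x j))))"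
    and integrable_w_w_mult: "\<And>f g. integrable Q f \<Longrightarrow> integrable Q g \<Longrightarrow>
      integrable (P n) (\<lambda>x. w n i x * w n j x * (f (x i) * g (x j)))"
proof -
  note [measurable] = w_meas [OF ij(1)] w_meas [OF ij(2)] component_P [OF ij(1)] component_P [OF ij(2)]
  show int: "integrable (P n) (\<lambda>x. w n i x * w n j x * (f (x i) * g (x j)))"
    if fg: "integrable Q f" "integrable Q g" for f g
  proof -
    have [measurable]: "f \<in> borel_measurable Q" "g \<in> borel_measurable Q"
      using fg by auto
    have dom: "integrable (P n) (\<lambda>x. f (x i) * g (x j))"
      using integral_PiM_components_mult(1) [OF prob_space_Q _ ij fg] by (simp add: P_def)
    show ?thesis
    proof (rule Bochner_Integration.integrable_bound [OF dom])
      show "AE x in P n. norm (w n i x * w n j x * (f (x i) * g (x j))) \<le> norm (f (x i) * g (x j))"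
      proof (rule AE_I2)
        fix x
        have "0 \<le> w n i x * w n j x" "w n i x * w n j x \<le> 1"
          using w_nonneg w_le_1 [OF ij(1)] w_le_1 [OF ij(2)] by (auto intro: mult_le_one)
        then show "norm (w n i x * w n j x * (f (x i) * g (x j))) \<le> norm (f (x i) * g (x j))"
          unfolding norm_mult [of "w n i x * w n j x"] by (intro mult_left_le_one_le) auto
      qed
    qed measurable
  qed
  have sec: "\<exists>g\<in>borel_measurable borel. bounded (range g) \<and>
      (\<forall>y. w n i (x(k := y)) * w n j (x(k := y)) * c = g (\<rho> y))" for k x c
  proof (intro bexI [of _ "\<lambda>t. w_of n i ((\<lambda>k. \<rho> (x k))(k := t)) * w_of n j ((\<lambda>k. \<rho> (x k))(k := t)) * c"] conjI)
    have "\<bar>u * v * c\<bar> \<le> \<bar>c\<bar>" if "0 \<le> u" "u \<le> 1" "0 \<le> v" "v \<le> 1" for u v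
      using that mult_le_one [of u v] by (auto simp: abs_mult intro!: mult_left_le_one_le)
    then show "bounded (range (\<lambda>t. w_of n i ((\<lambda>k. \<rho> (x k))(k := t)) * w_of n j ((\<lambda>k. \<rho> (x k))(k := t)) * c))"
      unfolding bounded_iff using w_of_bounds [OF ij(1)] w_of_bounds [OF ij(2)]
      by (intro exI [of _ "\<bar>c\<bar>"]) auto
  qed (auto simp: w_upd)
  have "EP n (\<lambda>x. w n i x * w n j x * (Z (x i) * Z (x j)))
      = EP n (\<lambda>x. (w n i x * w n j x * Z (x j)) * Z (x i))"
    by (simp only: mult_ac)
  also have "\<dots> = EP n (\<lambda>x. (w n i x * w n j x * Z (x j)) * \<phi> (\<rho> (x i)))"
  proof (rule replace_conditional_mean [OF ij(1)])
    show "integrable (P n) (\<lambda>x. w n i x * w n j x * Z (x j) * Z (x i))"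
      "integrable (P n) (\<lambda>x. w n i x * w n j x * Z (x j) * \<phi> (\<rho> (x i)))"
      using int [OF Z_int Z_int] int [OF \<phi>_int Z_int] by (simp_all only: mult_ac)
    show "\<exists>g\<in>borel_measurable borel. bounded (range g) \<and>
        (\<forall>y. w n i (x(i := y)) * w n j (x(i := y)) * Z ((x(i := y)) j) = g (\<rho> y))" for x
      using sec [of x i "Z (x j)"]
      by (simp only: fun_upd_other [OF ij(3) [symmetric]])
  qed
  also have "\<dots> = EP n (\<lambda>x. (w n i x * w n j x * \<phi> (\<rho> (x i))) * Z (x j))"
    by (simp only: mult_ac)
  also have "\<dots> = EP n (\<lambda>x. (w n i x * w n j x * \<phi> (\<rho> (x i))) * \<phi> (\<rho> (x j)))"
  proof (rule replace_conditional_mean [OF ij(2)])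
    show "integrable (P n) (\<lambda>x. w n i x * w n j x * \<phi> (\<rho> (x i)) * Z (x j))"
      "integrable (P n) (\<lambda>x. w n i x * w n j x * \<phi> (\<rho> (x i)) * \<phi> (\<rho> (x j)))"
      using int [OF \<phi>_int Z_int] int [OF \<phi>_int \<phi>_int] by (simp_all only: mult_ac)
    show "\<exists>g\<in>borel_measurable borel. bounded (range g) \<and>
        (\<forall>y. w n i (x(j := y)) * w n j (x(j := y)) * \<phi> (\<rho> ((x(j := y)) i)) = g (\<rho> y))" for x
      using sec [of x j "\<phi> (\<rho> (x i))"]
      by (simp only: fun_upd_other [OF ij(3)])
  qed
  finally show "EP n (\<lambda>x. w n i x * w n j x * (Z (x i) * Z (x j)))
    = EP n (\<lambda>x. w n i x * w n j x * (\<phi> (\<rho> (x i)) * \<phi> (\<rho> (x j))))"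
    by (simp only: mult_ac)
qed

definition C\<phi> :: real where "C\<phi> = \<bar>\<phi>'\<bar> + 1"

lemma \<phi>_approx:
  assumes "\<epsilon> > 0"
  shows "\<exists>t>0. \<forall>u\<in>{0..t}. \<bar>\<phi> u - \<phi>' * u\<bar> \<le> \<epsilon> * u"
proof -
  have "((\<lambda>u. (\<phi> u - \<phi> 0) / (u - 0)) \<longlongrightarrow> \<phi>') (at 0 within {0..})"
    using \<phi>_deriv by (simp add: has_field_derivative_iff)
  then have "\<forall>\<^sub>F u in at 0 within {0..}. dist (\<phi> u / u) \<phi>' < \<epsilon>"
    using assms by (auto dest: tendstoD simp: \<phi>_0)
  then obtain d where d: "d > 0" "\<And>u. u \<in> {0..} \<Longrightarrow> u \<noteq> 0 \<Longrightarrow> dist u 0 < d \<Longrightarrow> dist (\<phi> u / u) \<phi>' < \<epsilon>"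
    unfolding eventually_at by blast
  have "\<bar>\<phi> u - \<phi>' * u\<bar> \<le> \<epsilon> * u" if u: "u \<in> {0..d / 2}" for u
  proof (cases "u = 0")
    case False
    then have "\<bar>\<phi> u / u - \<phi>'\<bar> < \<epsilon>"
      using d(2) [of u] u d(1) by (auto simp: dist_real_def)
    then have "\<bar>\<phi> u / u - \<phi>'\<bar> * u \<le> \<epsilon> * u"
      using u by (intro mult_right_mono) auto
    moreover have "\<bar>\<phi> u / u - \<phi>'\<bar> * u = \<bar>(\<phi> u / u - \<phi>') * u\<bar>"
      using u by (simp add: abs_mult)
    ultimately show ?thesis using False by (simp add: left_diff_distrib)
  qed (simp add: \<phi>_0)
  then show ?thesis using d(1) by (intro exI [of _ "d / 2"]) auto
qed

lemma bandwidths_below: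
  assumes "t > 0"
  shows "\<exists>i\<ge>1. \<forall>j\<ge>i. h j \<le> t"
proof -
  have "\<forall>\<^sub>F j in sequentially. h j < t"
    using order_tendstoD(2) [OF h_lim assms] .
  then obtain i where "\<And>j. j \<ge> i \<Longrightarrow> h j < t"
    by (auto simp: eventually_sequentially)
  then show ?thesis by (intro exI [of _ "max 1 i"]) (auto intro: less_imp_le)
qed

definition i0 :: nat where
  "i0 = (SOME i. i \<ge> 1 \<and> (\<forall>j\<ge>i. \<forall>u\<in>{0..h j}. \<bar>\<phi> u\<bar> \<le> C\<phi> * u))"

lemma i0: "i0 \<ge> 1" "j \<ge> i0 \<Longrightarrow> u \<in> {0..h j} \<Longrightarrow> \<bar>\<phi> u\<bar> \<le> C\<phi> * u"
proof -
  obtain t where t: "t > 0" "\<And>u. u \<in> {0..t} \<Longrightarrow> \<bar>\<phi> u - \<phi>' * u\<bar> \<le> 1 * u"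
    using \<phi>_approx [of 1] by auto
  obtain i where i: "i \<ge> 1" "\<And>j. j \<ge> i \<Longrightarrow> h j \<le> t"
    using bandwidths_below [OF t(1)] by blast
  have "\<bar>\<phi> u\<bar> \<le> C\<phi> * u" if "j \<ge> i" "u \<in> {0..h j}" for j u
  proof -
    have u: "u \<in> {0..t}" using i(2) [OF that(1)] that(2) by auto
    then have "\<bar>\<phi> u\<bar> \<le> \<bar>\<phi>' * u\<bar> + u" using t(2) [OF u] by linarith
    also have "\<dots> = C\<phi> * u" using u by (simp add: C\<phi>_def abs_mult algebra_simps)
    finally show ?thesis .
  qed
  then have "\<exists>i. i \<ge> 1 \<and> (\<forall>j\<ge>i. \<forall>u\<in>{0..h j}. \<bar>\<phi> u\<bar> \<le> C\<phi> * u)"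
    using i(1) by blast
  from someI_ex [OF this] show "i0 \<ge> 1" "j \<ge> i0 \<Longrightarrow> u \<in> {0..h j} \<Longrightarrow> \<bar>\<phi> u\<bar> \<le> C\<phi> * u"
    unfolding i0_def by blast+
qed

text \<open>The finitely many observations before \<open>i0\<close> may have large bandwidths, where nothing is known about
  \<open>\<phi>\<close>; they are split off and handled by \<open>fixed_weight_bound\<close>.\<close>

definition z :: "nat \<Rightarrow> 'q \<Rightarrow> real" where
  "z i y = (if i \<ge> i0 then Z y else 0)"

definition f :: "nat \<Rightarrow> 'q \<Rightarrow> real" where
  "f i y = (if i \<ge> i0 then \<phi> (\<rho> y) else 0)"

definition L :: "nat \<Rightarrow> (nat \<Rightarrow> 'q) \<Rightarrow> real" where
  "L n x = (\<Sum>i=1..n. w n i x * z i (x i))"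

definition S :: "nat \<Rightarrow> (nat \<Rightarrow> 'q) \<Rightarrow> real" where
  "S n x = (\<Sum>i=1..n. w n i x * f i (x i))"

definition b :: "nat \<Rightarrow> real" where
  "b n = (\<Sum>i=1..n. coef n i * expectation (\<lambda>y. kern i y * f i y)) / m n"

lemma z_meas [measurable]: "z i \<in> borel_measurable Q" and f_meas [measurable]: "f i \<in> borel_measurable Q"
  unfolding z_def [abs_def] f_def [abs_def] by measurable

lemma z_int: "integrable Q (z i)" and f_int: "integrable Q (f i)"
  unfolding z_def [abs_def] f_def [abs_def] using Z_int \<phi>_int by (cases "i0 \<le> i"; simp)+

lemma f_le: "\<rho> y \<in> {0..h i} \<Longrightarrow> \<bar>f i y\<bar> \<le> C\<phi> * \<bar>h i\<bar>"
proof -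
  assume y: "\<rho> y \<in> {0..h i}"
  have C: "C\<phi> \<ge> 0" by (simp add: C\<phi>_def)
  show "\<bar>f i y\<bar> \<le> C\<phi> * \<bar>h i\<bar>"
  proof (cases "i \<ge> i0")
    case True
    then have "\<bar>f i y\<bar> \<le> C\<phi> * \<rho> y" using i0(2) [OF True y] by (simp add: f_def)
    also have "\<dots> \<le> C\<phi> * \<bar>h i\<bar>" using y C by (intro mult_left_mono) auto
    finally show ?thesis .
  qed (use C in \<open>simp add: f_def\<close>)
qed

lemma S_lim:
  "(\<lambda>n. N n * EP n (\<lambda>x. (S n x - b n)\<^sup>2)) \<longlonglongrightarrow> 0"
  "(\<lambda>n. N n * (EP n (S n) - b n)) \<longlonglongrightarrow> 0"
proof -
  have C: "(\<lambda>i. C\<phi> * \<bar>h i\<bar>) \<longlonglongrightarrow> 0"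
    using tendsto_mult_right_zero [OF tendsto_rabs_zero [OF h_lim]] .
  show "(\<lambda>n. N n * EP n (\<lambda>x. (S n x - b n)\<^sup>2)) \<longlonglongrightarrow> 0"
    "(\<lambda>n. N n * (EP n (S n) - b n)) \<longlonglongrightarrow> 0"
    using ratio_linearization [OF f_meas f_le C] by (simp_all add: S_def [abs_def] b_def)
qed

lemma sq_int: "i \<ge> 1 \<Longrightarrow> integrable Q (\<lambda>y. indicator {0..h i} (\<rho> y) * (z i y)\<^sup>2)"
    "integrable Q (\<lambda>y. indicator {0..h i} (\<rho> y) * (f i y)\<^sup>2)"
    "integrable Q (\<lambda>y. indicator {0..h i} (\<rho> y) * (c :: real))"
proof -
  show "integrable Q (\<lambda>y. indicator {0..h i} (\<rho> y) * (z i y)\<^sup>2)" if "i \<ge> 1"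
    using Z_sq_int [OF that] by (cases "i \<ge> i0") (simp_all add: z_def)
  show "integrable Q (\<lambda>y. indicator {0..h i} (\<rho> y) * (f i y)\<^sup>2)"
  proof (rule integrable_const_bound [where B = "(C\<phi> * \<bar>h i\<bar>)\<^sup>2"])
    have "(f i y)\<^sup>2 \<le> (C\<phi> * \<bar>h i\<bar>)\<^sup>2" if "\<rho> y \<in> {0..h i}" for y
      using f_le [OF that] by (intro power2_le_iff_abs_le [THEN iffD2]) (auto simp: C\<phi>_def)
    then show "AE y in Q. norm (indicator {0..h i} (\<rho> y) * (f i y)\<^sup>2) \<le> (C\<phi> * \<bar>h i\<bar>)\<^sup>2"
      by (intro AE_I2) (simp add: indicator_def)
  qed measurable
  show "integrable Q (\<lambda>y. indicator {0..h i} (\<rho> y) * c)"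
    by (rule integrable_const_bound [where B = "\<bar>c\<bar>"]) (auto simp: indicator_def)
qed

lemma w_sq_int: "i \<in> {1..n} \<Longrightarrow> integrable (P n) (\<lambda>x. (w n i x)\<^sup>2 * (z i (x i))\<^sup>2)"
    "i \<in> {1..n} \<Longrightarrow> integrable (P n) (\<lambda>x. (w n i x)\<^sup>2 * (f i (x i))\<^sup>2)"
    "i \<in> {1..n} \<Longrightarrow> integrable (P n) (\<lambda>x. (w n i x)\<^sup>2)"
  using integrable_w_mult(2) [of i n "\<lambda>y. (z i y)\<^sup>2"] integrable_w_mult(2) [of i n "\<lambda>y. (f i y)\<^sup>2"]
    integrable_w_mult(2) [of i n "\<lambda>y. 1"] sq_int(1) [of i] sq_int(2) [of i] sq_int(3) [of i 1]
  by simp_all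

definition T :: "nat \<Rightarrow> nat \<Rightarrow> real" where
  "T n i = EP n (\<lambda>x. (w n i x)\<^sup>2 * ((z i (x i))\<^sup>2 - (f i (x i))\<^sup>2))"

lemma L_S:
  shows "EP n (L n) = EP n (S n)"
    and "EP n (\<lambda>x. (L n x)\<^sup>2) = EP n (\<lambda>x. (S n x)\<^sup>2) + (\<Sum>i=1..n. T n i)"
    and "integrable (P n) (\<lambda>x. (L n x)\<^sup>2)" "integrable (P n) (\<lambda>x. (S n x)\<^sup>2)"
    and "integrable (P n) (L n)" "integrable (P n) (S n)"
proof -
  have ind: "integrable Q (\<lambda>y. indicator {0..h i} (\<rho> y) * g y)" if g: "integrable Q g" for g :: "'q \<Rightarrow> real" and i
    by (rule Bochner_Integration.integrable_bound [OF g])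
       (use borel_measurable_integrable [OF g] in \<open>auto simp: indicator_def intro!: AE_I2\<close>)
  have int1: "integrable (P n) (\<lambda>x. w n i x * z i (x i))" "integrable (P n) (\<lambda>x. w n i x * f i (x i))"
    if "i \<in> {1..n}" for i
    using integrable_w_mult(1) [OF that z_meas ind [OF z_int]] integrable_w_mult(1) [OF that f_meas ind [OF f_int]] .
  then show "integrable (P n) (L n)" "integrable (P n) (S n)"
    unfolding L_def [abs_def] S_def [abs_def] by (intro Bochner_Integration.integrable_sum; simp)+
  have eq1: "EP n (\<lambda>x. w n i x * z i (x i)) = EP n (\<lambda>x. w n i x * f i (x i))"
    if "i \<in> {1..n}" for i
    using expectation_w_Z [OF that] by (cases "i \<ge> i0") (simp_all add: z_def f_def)
  show "EP n (L n) = EP n (S n)"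
    unfolding L_def [abs_def] S_def [abs_def]
    using int1 eq1 by (simp add: Bochner_Integration.integral_sum)
  define zz where "zz i j x = w n i x * w n j x * (z i (x i) * z j (x j))" for i j x
  define ff where "ff i j x = w n i x * w n j x * (f i (x i) * f j (x j))" for i j x
  have int2: "integrable (P n) (zz i j)" "integrable (P n) (ff i j)"
    if "i \<in> {1..n}" "j \<in> {1..n}" for i j
  proof -
    show "integrable (P n) (zz i j)"
    proof (cases "i = j")
      case True
      then show ?thesis using w_sq_int(1) [OF that(1)] by (simp add: zz_def [abs_def] power2_eq_square)
    next
      case False
      then show ?thesis using integrable_w_w_mult [OF that False z_int z_int] by (simp add: zz_def [abs_def])
    qed
    show "integrable (P n) (ff i j)"
    proof (cases "i = j")
      case True
      then show ?thesis using w_sq_int(2) [OF that(1)] by (simp add: ff_def [abs_def] power2_eq_square)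
    next
      case False
      then show ?thesis using integrable_w_w_mult [OF that False f_int f_int] by (simp add: ff_def [abs_def])
    qed
  qed
  have L2: "(L n x)\<^sup>2 = (\<Sum>i=1..n. \<Sum>j=1..n. zz i j x)" and S2: "(S n x)\<^sup>2 = (\<Sum>i=1..n. \<Sum>j=1..n. ff i j x)" for x
    by (simp_all add: L_def S_def zz_def ff_def power2_eq_square sum_product mult_ac)
  show "integrable (P n) (\<lambda>x. (L n x)\<^sup>2)" "integrable (P n) (\<lambda>x. (S n x)\<^sup>2)"
    unfolding L2 S2 using int2 by (intro Bochner_Integration.integrable_sum; simp)+
  have eq2: "EP n (zz i j) = EP n (ff i j) + (if i = j then T n i else 0)"
    if ij: "i \<in> {1..n}" "j \<in> {1..n}" for i j
  proof (cases "i = j")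
    case True
    have "T n i = EP n (\<lambda>x. zz i i x - ff i i x)"
      unfolding T_def zz_def ff_def by (simp add: power2_eq_square right_diff_distrib)
    then show ?thesis using True int2 [OF ij] by simp
  next
    case False
    then show ?thesis
      using expectation_w_w_Z_Z(1) [OF ij False]
      by (cases "i \<ge> i0"; cases "j \<ge> i0") (simp_all add: zz_def [abs_def] ff_def [abs_def] z_def f_def)
  qed
  have double: "EP n (\<lambda>x. \<Sum>i=1..n. \<Sum>j=1..n. g i j x) = (\<Sum>i=1..n. \<Sum>j=1..n. EP n (g i j))"
    if "\<And>i j. i \<in> {1..n} \<Longrightarrow> j \<in> {1..n} \<Longrightarrow> integrable (P n) (g i j)" for g
  proof -
    have "EP n (\<lambda>x. \<Sum>i=1..n. \<Sum>j=1..n. g i j x) = (\<Sum>i=1..n. EP n (\<lambda>x. \<Sum>j=1..n. g i j x))"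
      by (intro Bochner_Integration.integral_sum Bochner_Integration.integrable_sum that)
    also have "\<dots> = (\<Sum>i=1..n. \<Sum>j=1..n. EP n (g i j))"
      by (intro sum.cong refl Bochner_Integration.integral_sum that)
    finally show ?thesis .
  qed
  have "EP n (\<lambda>x. (L n x)\<^sup>2) = (\<Sum>i=1..n. \<Sum>j=1..n. EP n (zz i j))"
    unfolding L2 by (intro double int2)
  also have "\<dots> = (\<Sum>i=1..n. \<Sum>j=1..n. EP n (ff i j) + (if i = j then T n i else 0))"
    by (intro sum.cong refl eq2)
  also have "\<dots> = (\<Sum>i=1..n. \<Sum>j=1..n. EP n (ff i j)) + (\<Sum>i=1..n. T n i)"
    by (simp add: sum.distrib)
  also have "(\<Sum>i=1..n. \<Sum>j=1..n. EP n (ff i j)) = EP n (\<lambda>x. (S n x)\<^sup>2)"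
    unfolding S2 by (intro double [symmetric] int2)
  finally show "EP n (\<lambda>x. (L n x)\<^sup>2) = EP n (\<lambda>x. (S n x)\<^sup>2) + (\<Sum>i=1..n. T n i)" .
qed

lemma fixed_weight_lim:
  fixes g :: "'q \<Rightarrow> real"
  assumes "j \<ge> 1" "g \<in> borel_measurable Q" "\<And>y. g y \<ge> 0"
    and "integrable Q (\<lambda>y. indicator {0..h j} (\<rho> y) * g y)"
  shows "(\<lambda>n. N n * EP n (\<lambda>x. (w n j x)\<^sup>2 * g (x j))) \<longlonglongrightarrow> 0"
proof -
  obtain C where C: "\<forall>\<^sub>F n in sequentially. (N n)\<^sup>2 * EP n (\<lambda>x. (w n j x)\<^sup>2 * g (x j)) \<le> C"
    using fixed_weight_bound [OF assms] by blast
  have lim: "(\<lambda>n. C * (1 / N n)) \<longlonglongrightarrow> 0"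
    using tendsto_mult_right_zero [OF N_inverse] .
  show ?thesis
  proof (rule tendsto_sandwich [OF _ _ tendsto_const lim])
    show "\<forall>\<^sub>F n in sequentially. 0 \<le> N n * EP n (\<lambda>x. (w n j x)\<^sup>2 * g (x j))"
      using assms(3) by (intro always_eventually allI mult_nonneg_nonneg N_nonneg Bochner_Integration.integral_nonneg) auto
    show "\<forall>\<^sub>F n in sequentially. N n * EP n (\<lambda>x. (w n j x)\<^sup>2 * g (x j)) \<le> C * (1 / N n)"
      using C eventually_ge_at_top [of 1]
      by eventually_elim (use N_pos in \<open>auto simp: field_simps power2_eq_square\<close>)
  qed
qed

definition \<omega> :: real where "\<omega> = \<beta> (1 - 2 * l) * \<mu>2 / m_lim\<^sup>2"

lemma sum_T_lim: "(\<lambda>n. N n * (\<Sum>i=1..n. T n i)) \<longlonglongrightarrow> s * \<omega>"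
proof -
  define W where "W n i = EP n (\<lambda>x. (w n i x)\<^sup>2)" for n i
  have W_lim: "(\<lambda>n. N n * (\<Sum>i=1..n. W n i)) \<longlonglongrightarrow> \<omega>"
    using sum_w_sq_lim w_sq_int(3) by (simp add: \<omega>_def W_def Bochner_Integration.integral_sum)
  have W_nonneg: "W n i \<ge> 0" for n i
    by (simp add: W_def)
  have "(\<lambda>n. N n * (\<Sum>i=1..n. T n i) - s * (N n * (\<Sum>i=1..n. W n i))) \<longlonglongrightarrow> 0"
  proof (rule tendstoI)
    fix e :: real assume e: "e > 0"
    have \<omega>_nonneg: "\<omega> \<ge> 0"
      by (rule tendsto_lowerbound [OF W_lim]) (auto simp: N_nonneg W_nonneg sum_nonneg)
    define \<epsilon> where "\<epsilon> = e / (2 * (\<omega> + 1))"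
    have \<epsilon>: "\<epsilon> > 0" using e \<omega>_nonneg by (simp add: \<epsilon>_def)
    obtain t where t: "t > 0" and cv: "\<And>g. g \<in> borel_measurable borel \<Longrightarrow> (\<And>u. 0 \<le> g u \<and> g u \<le> 1) \<Longrightarrow>
        (\<And>u. u \<notin> {0..t} \<Longrightarrow> g u = 0) \<Longrightarrow>
        \<bar>expectation (\<lambda>y. g (\<rho> y) * ((Z y)\<^sup>2 - (\<phi> (\<rho> y))\<^sup>2)) - s * expectation (\<lambda>y. g (\<rho> y))\<bar>
          \<le> \<epsilon> * expectation (\<lambda>y. g (\<rho> y))"
      using cond_var [OF \<epsilon>] by blast
    obtain i1' where i1': "\<And>j. j \<ge> i1' \<Longrightarrow> h j \<le> t"
      using bandwidths_below [OF t] by blast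
    define i1 where "i1 = max i0 i1'"
    have i1: "i1 \<ge> i0" "i1 \<ge> 1" "\<And>j. j \<ge> i1 \<Longrightarrow> h j \<le> t"
      using i1' i0(1) by (auto simp: i1_def)
    have late: "\<bar>T n i - s * W n i\<bar> \<le> \<epsilon> * W n i" if i: "i \<in> {1..n}" "i \<ge> i1" for n i
    proof -
      have ii0: "i \<ge> i0" using i i1 by simp
      let ?g = "\<lambda>x t. (w_of n i ((\<lambda>k. \<rho> (x k))(i := t)))\<^sup>2"
      have g: "\<bar>expectation (\<lambda>y. ?g x (\<rho> y) * ((Z y)\<^sup>2 - (\<phi> (\<rho> y))\<^sup>2)) - s * expectation (\<lambda>y. ?g x (\<rho> y))\<bar>
          \<le> \<epsilon> * expectation (\<lambda>y. ?g x (\<rho> y))" for x :: "nat \<Rightarrow> 'q"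
      proof (rule cv)
        show "0 \<le> ?g x u \<and> ?g x u \<le> 1" for u
          using w_of_bounds [OF i(1)] by (auto intro: power_le_one)
        show "?g x u = 0" if "u \<notin> {0..t}" for u
          using w_of_0 [of i "(\<lambda>k. \<rho> (x k))(i := u)" n] that i i1(3) [OF i(2)] by auto
      qed measurable
      have g_up: "expectation (\<lambda>y. ?g x (\<rho> y) * ((Z y)\<^sup>2 - (\<phi> (\<rho> y))\<^sup>2)) \<le> (s + \<epsilon>) * expectation (\<lambda>y. ?g x (\<rho> y))"
        and g_lo: "(s - \<epsilon>) * expectation (\<lambda>y. ?g x (\<rho> y)) \<le> expectation (\<lambda>y. ?g x (\<rho> y) * ((Z y)\<^sup>2 - (\<phi> (\<rho> y))\<^sup>2))"
        for x :: "nat \<Rightarrow> 'q"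
        using g [of x] unfolding abs_le_iff distrib_right left_diff_distrib by linarith+
      have int_T: "integrable (P n) (\<lambda>x. (w n i x)\<^sup>2 * ((z i (x i))\<^sup>2 - (f i (x i))\<^sup>2))"
        using w_sq_int(1,2) [OF i(1)] by (simp add: right_diff_distrib)
      have int_W: "integrable (P n) (\<lambda>x. c * (w n i x)\<^sup>2)" for c
        using w_sq_int(3) [OF i(1)] by simp
      have "T n i \<le> EP n (\<lambda>x. (s + \<epsilon>) * (w n i x)\<^sup>2)"
        using int_T int_W [of "s + \<epsilon>"] unfolding T_def P_def
      proof (rule integral_PiM_mono_coordinate [OF prob_space_Q i(1)])
        fix x
        show "expectation (\<lambda>y. (w n i (x(i := y)))\<^sup>2 * ((z i ((x(i := y)) i))\<^sup>2 - (f i ((x(i := y)) i))\<^sup>2))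
            \<le> expectation (\<lambda>y. (s + \<epsilon>) * (w n i (x(i := y)))\<^sup>2)"
          using g_up [of x] ii0 by (simp add: w_upd z_def f_def)
      qed
      moreover have "EP n (\<lambda>x. (s - \<epsilon>) * (w n i x)\<^sup>2) \<le> T n i"
        using int_W [of "s - \<epsilon>"] int_T unfolding T_def P_def
      proof (rule integral_PiM_mono_coordinate [OF prob_space_Q i(1)])
        fix x
        show "expectation (\<lambda>y. (s - \<epsilon>) * (w n i (x(i := y)))\<^sup>2)
            \<le> expectation (\<lambda>y. (w n i (x(i := y)))\<^sup>2 * ((z i ((x(i := y)) i))\<^sup>2 - (f i ((x(i := y)) i))\<^sup>2))"
          using g_lo [of x] ii0 by (simp add: w_upd z_def f_def)
      qed
      ultimately have "T n i \<le> (s + \<epsilon>) * W n i" "(s - \<epsilon>) * W n i \<le> T n i"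
        unfolding W_def by simp_all
      then show ?thesis
        by (simp add: abs_le_iff distrib_right left_diff_distrib)
    qed
    define E where "E n i = EP n (\<lambda>x. (w n i x)\<^sup>2 * ((z i (x i))\<^sup>2 + (f i (x i))\<^sup>2 + \<bar>s\<bar>))" for n i
    have E_lim: "(\<lambda>n. \<Sum>i=1..<i1. N n * E n i) \<longlonglongrightarrow> 0"
    proof (rule tendsto_null_sum)
      fix i assume "i \<in> {1..<i1}"
      then have i: "i \<ge> 1" by simp
      show "(\<lambda>n. N n * E n i) \<longlonglongrightarrow> 0"
        unfolding E_def
      proof (rule fixed_weight_lim [OF i, where g = "\<lambda>y. (z i y)\<^sup>2 + (f i y)\<^sup>2 + \<bar>s\<bar>"])
        show "integrable Q (\<lambda>y. indicator {0..h i} (\<rho> y) * ((z i y)\<^sup>2 + (f i y)\<^sup>2 + \<bar>s\<bar>))"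
          using sq_int(1) [OF i] sq_int(2) [of i] sq_int(3) [of i "\<bar>s\<bar>"] by (simp add: distrib_left)
      qed auto
    qed
    have early: "\<bar>T n i - s * W n i\<bar> \<le> E n i" if i: "i \<in> {1..n}" for n i
    proof -
      have eq: "T n i - s * W n i = EP n (\<lambda>x. (w n i x)\<^sup>2 * ((z i (x i))\<^sup>2 - (f i (x i))\<^sup>2 - s))"
        using w_sq_int [OF i] by (simp add: T_def W_def right_diff_distrib)
      have "\<bar>T n i - s * W n i\<bar> \<le> EP n (\<lambda>x. \<bar>(w n i x)\<^sup>2 * ((z i (x i))\<^sup>2 - (f i (x i))\<^sup>2 - s)\<bar>)"
        unfolding eq by (rule integral_abs_bound)
      also have "\<dots> \<le> E n i"
        unfolding E_def
      proof (rule integral_mono)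
        show "\<bar>(w n i x)\<^sup>2 * ((z i (x i))\<^sup>2 - (f i (x i))\<^sup>2 - s)\<bar>
            \<le> (w n i x)\<^sup>2 * ((z i (x i))\<^sup>2 + (f i (x i))\<^sup>2 + \<bar>s\<bar>)" for x
        proof -
          have "\<bar>(z i (x i))\<^sup>2 - (f i (x i))\<^sup>2 - s\<bar> \<le> (z i (x i))\<^sup>2 + (f i (x i))\<^sup>2 + \<bar>s\<bar>"
            using zero_le_power2 [of "z i (x i)"] zero_le_power2 [of "f i (x i)"] by arith
          from mult_left_mono [OF this zero_le_power2 [of "w n i x"]] show ?thesis
            by (simp only: abs_mult abs_power2)
        qed
      qed (use w_sq_int [OF i] in \<open>simp_all add: right_diff_distrib distrib_left\<close>)
      finally show ?thesis .
    qed
    have E_nonneg: "E n i \<ge> 0" for n i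
      unfolding E_def by (intro Bochner_Integration.integral_nonneg) auto
    have W_ev: "\<forall>\<^sub>F n in sequentially. N n * (\<Sum>i=1..n. W n i) < \<omega> + 1"
      by (rule order_tendstoD(2) [OF W_lim]) simp
    have E_ev: "\<forall>\<^sub>F n in sequentially. (\<Sum>i=1..<i1. N n * E n i) < e / 2"
      by (rule order_tendstoD(2) [OF E_lim]) (use e in simp)
    show "\<forall>\<^sub>F n in sequentially. dist (N n * (\<Sum>i=1..n. T n i) - s * (N n * (\<Sum>i=1..n. W n i))) 0 < e"
      using W_ev E_ev eventually_ge_at_top [of i1]
    proof eventually_elim
      case (elim n)
      have "\<bar>\<Sum>i=1..n. T n i - s * W n i\<bar> \<le> (\<Sum>i=1..n. \<bar>T n i - s * W n i\<bar>)"
        by (rule sum_abs)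
      also have "\<dots> \<le> (\<Sum>i=1..n. \<epsilon> * W n i + (if i < i1 then E n i else 0))"
      proof (rule sum_mono)
        fix i assume i: "i \<in> {1..n}"
        show "\<bar>T n i - s * W n i\<bar> \<le> \<epsilon> * W n i + (if i < i1 then E n i else 0)"
        proof (cases "i < i1")
          case True
          have "0 \<le> \<epsilon> * W n i" using \<epsilon> W_nonneg [of n i] by simp
          with True early [OF i] show ?thesis by simp
        next
          case False
          with late [OF i] show ?thesis by simp
        qed
      qed
      also have "\<dots> = \<epsilon> * (\<Sum>i=1..n. W n i) + (\<Sum>i=1..<i1. E n i)"
      proof -
        have "(\<Sum>i=1..n. if i < i1 then E n i else 0) = (\<Sum>i=1..<i1. E n i)"
          by (rule sum.mono_neutral_cong_right) (use elim in auto)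
        then show ?thesis by (simp add: sum.distrib sum_distrib_left)
      qed
      finally have "N n * \<bar>\<Sum>i=1..n. T n i - s * W n i\<bar> \<le> N n * (\<epsilon> * (\<Sum>i=1..n. W n i) + (\<Sum>i=1..<i1. E n i))"
        by (intro mult_left_mono N_nonneg)
      also have "\<dots> = \<epsilon> * (N n * (\<Sum>i=1..n. W n i)) + (\<Sum>i=1..<i1. N n * E n i)"
        by (simp add: distrib_left sum_distrib_left mult.left_commute)
      also have "\<dots> < \<epsilon> * (\<omega> + 1) + e / 2"
        using elim \<epsilon> by (intro add_strict_mono mult_strict_left_mono)
      also have "\<dots> = e"
        using \<omega>_nonneg by (simp add: \<epsilon>_def field_simps)
      finally have *: "N n * \<bar>\<Sum>i=1..n. T n i - s * W n i\<bar> < e" .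
      have "N n * (\<Sum>i=1..n. T n i) - s * (N n * (\<Sum>i=1..n. W n i)) = N n * (\<Sum>i=1..n. T n i - s * W n i)"
        unfolding sum_subtractf sum_distrib_left [symmetric] by (simp add: right_diff_distrib)
      with * show ?case by (simp only: dist_real_def diff_zero abs_mult abs_of_nonneg [OF N_nonneg])
    qed
  qed
  then have "(\<lambda>n. (N n * (\<Sum>i=1..n. T n i) - s * (N n * (\<Sum>i=1..n. W n i))) + s * (N n * (\<Sum>i=1..n. W n i)))
      \<longlonglongrightarrow> 0 + s * \<omega>"
    by (intro tendsto_add tendsto_mult tendsto_const W_lim)
  then show ?thesis by simp
qed

lemma variance_L_lim: "(\<lambda>n. N n * P.variance n (L n)) \<longlonglongrightarrow> s * \<omega>"
proof -
  have var_S: "(\<lambda>n. N n * P.variance n (S n)) \<longlonglongrightarrow> 0"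
  proof (rule tendsto_sandwich [OF _ _ tendsto_const S_lim(1)])
    have "P.variance n (S n) \<le> EP n (\<lambda>x. (S n x - b n)\<^sup>2)" for n
    proof -
      have "EP n (\<lambda>x. (S n x - b n)\<^sup>2)
          = EP n (\<lambda>x. (S n x)\<^sup>2 - 2 * b n * S n x + (b n)\<^sup>2)"
        by (intro Bochner_Integration.integral_cong refl) (simp add: power2_diff)
      also have "\<dots> = EP n (\<lambda>x. (S n x)\<^sup>2) - 2 * b n * EP n (S n) + (b n)\<^sup>2"
        using L_S(4,6) [of n] by (simp add: P.prob_space)
      finally have "EP n (\<lambda>x. (S n x - b n)\<^sup>2) = P.variance n (S n) + (EP n (S n) - b n)\<^sup>2"
        using P.variance_eq [OF L_S(6,4), of n] by (simp add: power2_diff)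
      then show ?thesis by simp
    qed
    then show "\<forall>\<^sub>F n in sequentially. N n * P.variance n (S n) \<le> N n * EP n (\<lambda>x. (S n x - b n)\<^sup>2)"
      by (intro always_eventually allI mult_left_mono N_nonneg)
  qed (auto simp: N_nonneg P.variance_positive)
  have "P.variance n (L n) = (\<Sum>i=1..n. T n i) + P.variance n (S n)" for n
  proof -
    have "P.variance n (L n) = EP n (\<lambda>x. (L n x)\<^sup>2) - (EP n (L n))\<^sup>2"
      by (rule P.variance_eq [OF L_S(5,3)])
    also have "\<dots> = (\<Sum>i=1..n. T n i) + (EP n (\<lambda>x. (S n x)\<^sup>2) - (EP n (S n))\<^sup>2)"
      unfolding L_S(1,2) by simp
    finally show ?thesis unfolding P.variance_eq [OF L_S(6,4)] .
  qed
  then have "(\<lambda>n. N n * P.variance n (L n)) = (\<lambda>n. N n * (\<Sum>i=1..n. T n i) + N n * P.variance n (S n))"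
    by (simp add: distrib_left)
  then show ?thesis
    using tendsto_add [OF sum_T_lim var_S] by simp
qed

definition estimator :: "real \<Rightarrow> nat \<Rightarrow> (nat \<Rightarrow> 'q) \<Rightarrow> real" where
  "estimator a n x = (\<Sum>i=1..n. w n i x * (Z (x i) + a))"

definition R :: "real \<Rightarrow> nat \<Rightarrow> (nat \<Rightarrow> 'q) \<Rightarrow> real" where
  "R a n x = estimator a n x - a - L n x"

lemma R_bound:
  shows "\<exists>C. \<forall>\<^sub>F n in sequentially. integrable (P n) (R a n) \<and> integrable (P n) (\<lambda>x. (R a n x)\<^sup>2) \<and>
    (N n)\<^sup>2 * EP n (\<lambda>x. (R a n x)\<^sup>2) \<le> C"
proof -
  have Zi: "integrable Q (\<lambda>y. indicator {0..h i} (\<rho> y) * (Z y)\<^sup>2)" if "i \<in> {1..<i0}" for i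
    using Z_sq_int [of i] that by simp
  have "\<exists>C. \<forall>i\<in>{1..<i0}. \<forall>\<^sub>F n in sequentially. (N n)\<^sup>2 * EP n (\<lambda>x. (w n i x)\<^sup>2 * (Z (x i))\<^sup>2) \<le> C i"
    by (intro bchoice ballI fixed_weight_bound [where f = "\<lambda>y. (Z y)\<^sup>2"] Zi) auto
  then obtain C where "\<And>i. i \<in> {1..<i0} \<Longrightarrow>
      \<forall>\<^sub>F n in sequentially. (N n)\<^sup>2 * EP n (\<lambda>x. (w n i x)\<^sup>2 * (Z (x i))\<^sup>2) \<le> C i"
    by blast
  then have C: "\<forall>\<^sub>F n in sequentially. \<forall>i\<in>{1..<i0}. (N n)\<^sup>2 * EP n (\<lambda>x. (w n i x)\<^sup>2 * (Z (x i))\<^sup>2) \<le> C i"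
    by (simp add: eventually_ball_finite_distrib)
  have tail: "\<forall>\<^sub>F n in sequentially. (N n)\<^sup>2 * tail 0 n < 1"
    by (rule order_tendstoD(2) [OF tail_lim]) simp
  have "\<forall>\<^sub>F n in sequentially. integrable (P n) (R a n) \<and> integrable (P n) (\<lambda>x. (R a n x)\<^sup>2) \<and>
    (N n)\<^sup>2 * EP n (\<lambda>x. (R a n x)\<^sup>2) \<le> real i0 * (\<Sum>i=1..<i0. C i) + a\<^sup>2"
    using C tail eventually_ge_at_top [of i0]
  proof eventually_elim
    case (elim n)
    have in_n: "i \<in> {1..n}" if "i \<in> {1..<i0}" for i
      using that elim by auto
    define r where "r x = (\<Sum>i=1..<i0. w n i x * Z (x i))" for x
    have R_eq: "R a n x = (if D n x = 0 then - a else r x)" for x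
    proof -
      have "estimator a n x - L n x = (\<Sum>i=1..n. w n i x * (Z (x i) - z i (x i))) + a * (\<Sum>i=1..n. w n i x)"
        by (simp add: estimator_def L_def algebra_simps sum.distrib sum_subtractf sum_distrib_left)
      also have "(\<Sum>i=1..n. w n i x * (Z (x i) - z i (x i))) = r x"
        unfolding r_def by (rule sum.mono_neutral_cong_right) (use elim in \<open>auto simp: z_def\<close>)
      finally have "R a n x = r x + a * (\<Sum>i=1..n. w n i x) - a"
        by (simp add: R_def)
      moreover have "r x = 0" if "D n x = 0"
        using that by (simp add: r_def w_def)
      ultimately show ?thesis unfolding sum_w by simp
    qed
    have wZ_int: "integrable (P n) (\<lambda>x. (w n i x)\<^sup>2 * (Z (x i))\<^sup>2)" if "i \<in> {1..<i0}" for i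
      using integrable_w_mult(2) [OF in_n [OF that] _ Zi [OF that]] by simp
    have r_meas [measurable]: "r \<in> borel_measurable (P n)"
      unfolding r_def using in_n
      by (intro borel_measurable_sum borel_measurable_times w_meas measurable_compose [OF component_P Z_meas]) auto
    have R_meas [measurable]: "R a n \<in> borel_measurable (P n)"
      unfolding R_eq [abs_def] by measurable
    define U where "U x = real i0 * (\<Sum>i=1..<i0. (w n i x)\<^sup>2 * (Z (x i))\<^sup>2)
        + a\<^sup>2 * indicator {x \<in> space (P n). D n x \<le> m_lim / 2} x" for x
    have R_sq: "(R a n x)\<^sup>2 \<le> U x" if "x \<in> space (P n)" for x
    proof (cases "D n x = 0")
      case True
      then show ?thesis
        using that m_lim_pos by (simp add: R_eq U_def sum_nonneg)
    next
      case False
      have "(r x)\<^sup>2 \<le> real (card {1..<i0}) * (\<Sum>i=1..<i0. (w n i x * Z (x i))\<^sup>2)"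
        unfolding r_def using sum_squared_le_sum_of_squares [of "\<lambda>i. w n i x * Z (x i)" "{1..<i0}"]
        by (simp add: mult.commute)
      also have "\<dots> \<le> real i0 * (\<Sum>i=1..<i0. (w n i x * Z (x i))\<^sup>2)"
        by (intro mult_right_mono sum_nonneg) auto
      also have "\<dots> \<le> U x"
        by (simp add: U_def power_mult_distrib)
      finally show ?thesis using False by (simp add: R_eq)
    qed
    have U_int: "integrable (P n) U"
      unfolding U_def using wZ_int
      by (intro Bochner_Integration.integrable_add integrable_mult_right Bochner_Integration.integrable_sum)
         (auto simp: P.emeasure_eq_measure)
    have R_sq_int: "integrable (P n) (\<lambda>x. (R a n x)\<^sup>2)"
      by (rule Bochner_Integration.integrable_bound [OF U_int])
         (use R_sq in \<open>auto intro!: AE_I2 order.trans [OF R_sq]\<close>)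
    have R_int: "integrable (P n) (R a n)"
      using P.square_integrable_imp_integrable [OF R_meas R_sq_int] .
    have "EP n (\<lambda>x. (R a n x)\<^sup>2) \<le> EP n U"
      using R_sq_int U_int R_sq by (intro integral_mono) auto
    also have "\<dots> = real i0 * (\<Sum>i=1..<i0. EP n (\<lambda>x. (w n i x)\<^sup>2 * (Z (x i))\<^sup>2)) + a\<^sup>2 * tail 0 n"
      unfolding U_def using wZ_int prob_D_small_le [of n]
      by (subst Bochner_Integration.integral_add)
         (auto simp: P.emeasure_eq_measure Bochner_Integration.integral_sum)
    finally have "(N n)\<^sup>2 * EP n (\<lambda>x. (R a n x)\<^sup>2)
        \<le> (N n)\<^sup>2 * (real i0 * (\<Sum>i=1..<i0. EP n (\<lambda>x. (w n i x)\<^sup>2 * (Z (x i))\<^sup>2)) + a\<^sup>2 * tail 0 n)"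
      by (intro mult_left_mono) auto
    also have "\<dots> = real i0 * (\<Sum>i=1..<i0. (N n)\<^sup>2 * EP n (\<lambda>x. (w n i x)\<^sup>2 * (Z (x i))\<^sup>2))
        + a\<^sup>2 * ((N n)\<^sup>2 * tail 0 n)"
      by (simp add: distrib_left sum_distrib_left mult_ac)
    also have "\<dots> \<le> real i0 * (\<Sum>i=1..<i0. C i) + a\<^sup>2 * 1"
      using elim by (intro add_mono mult_left_mono sum_mono) auto
    finally show ?case using R_int R_sq_int by simp
  qed
  then show ?thesis by blast
qed

theorem estimator_variance:
  "(\<lambda>n. N n * P.variance n (estimator a n)) \<longlonglongrightarrow> \<beta> (1 - 2 * l) / (\<beta> (1 - l))\<^sup>2 * (\<mu>2 / \<mu>1\<^sup>2) * s"
proof -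
  obtain C where C: "\<forall>\<^sub>F n in sequentially. integrable (P n) (R a n) \<and> integrable (P n) (\<lambda>x. (R a n x)\<^sup>2) \<and>
    (N n)\<^sup>2 * EP n (\<lambda>x. (R a n x)\<^sup>2) \<le> C"
    using R_bound by blast
  define VL where "VL n = N n * P.variance n (L n)" for n
  have VL_lim: "VL \<longlonglongrightarrow> s * \<omega>" using variance_L_lim by (simp add: VL_def [abs_def])
  have bound: "\<forall>\<^sub>F n in sequentially. norm (N n * P.variance n (estimator a n) - VL n)
      \<le> 2 * sqrt (VL n * (C * (1 / N n))) + C * (1 / N n)"
    using C eventually_ge_at_top [of 1]
  proof eventually_elim
    case (elim n)
    have Nn: "N n > 0" using elim by (simp add: N_pos)
    have RI: "integrable (P n) (R a n)" "integrable (P n) (\<lambda>x. (R a n x)\<^sup>2)"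
      and RC: "(N n)\<^sup>2 * EP n (\<lambda>x. (R a n x)\<^sup>2) \<le> C" using elim by auto
    define lc rc where "lc x = L n x - EP n (L n)" and "rc x = R a n x - EP n (R a n)" for x
    have [measurable]: "L n \<in> borel_measurable (P n)" "R a n \<in> borel_measurable (P n)"
      using L_S(5) RI by auto
    have [measurable]: "lc \<in> borel_measurable (P n)" "rc \<in> borel_measurable (P n)"
      unfolding lc_def rc_def by measurable
    have lc2: "integrable (P n) (\<lambda>x. (lc x)\<^sup>2)" and rc2: "integrable (P n) (\<lambda>x. (rc x)\<^sup>2)"
      using L_S(3,5) RI by (simp_all add: lc_def rc_def power2_diff)
    note CS = Cauchy_Schwarz_integral [of lc "P n" rc, OF _ _ lc2 rc2]
    have est: "estimator a n x = a + (L n x + R a n x)" for x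
      by (simp add: R_def)
    have mean: "EP n (estimator a n) = a + (EP n (L n) + EP n (R a n))"
      unfolding est [abs_def] using L_S(5) RI by (simp add: P.prob_space)
    have "P.variance n (estimator a n) = EP n (\<lambda>x. (lc x)\<^sup>2 + 2 * (lc x * rc x) + (rc x)\<^sup>2)"
      unfolding mean unfolding est lc_def rc_def
      by (intro Bochner_Integration.integral_cong refl) (simp add: power2_eq_square algebra_simps)
    also have "\<dots> = P.variance n (L n) + 2 * EP n (\<lambda>x. lc x * rc x) + P.variance n (R a n)"
      using CS(1) lc2 rc2 by (simp add: lc_def rc_def)
    finally have var: "N n * P.variance n (estimator a n) - VL n
        = 2 * (N n * EP n (\<lambda>x. lc x * rc x)) + N n * P.variance n (R a n)"
      by (simp add: VL_def algebra_simps)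
    have "P.variance n (R a n) \<le> EP n (\<lambda>x. (R a n x)\<^sup>2)"
      using P.variance_eq [OF RI] by simp
    then have "N n * P.variance n (R a n) \<le> N n * EP n (\<lambda>x. (R a n x)\<^sup>2)"
      using Nn by simp
    also have "\<dots> \<le> C * (1 / N n)"
      using RC Nn by (simp add: field_simps power2_eq_square)
    finally have varR: "N n * P.variance n (R a n) \<le> C * (1 / N n)" .
    have "(N n * EP n (\<lambda>x. \<bar>lc x * rc x\<bar>))\<^sup>2 \<le> (N n)\<^sup>2 * (P.variance n (L n) * P.variance n (R a n))"
      unfolding power_mult_distrib using CS(2) by (intro mult_left_mono) (simp_all add: lc_def rc_def)
    also have "\<dots> = VL n * (N n * P.variance n (R a n))"
      by (simp add: VL_def power2_eq_square)
    also have "\<dots> \<le> VL n * (C * (1 / N n))"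
      by (intro mult_left_mono varR) (simp add: VL_def N_nonneg P.variance_positive)
    finally have "N n * EP n (\<lambda>x. \<bar>lc x * rc x\<bar>) \<le> sqrt (VL n * (C * (1 / N n)))"
      by (rule real_le_rsqrt)
    then have "N n * \<bar>EP n (\<lambda>x. lc x * rc x)\<bar> \<le> sqrt (VL n * (C * (1 / N n)))"
      by (rule order.trans [OF mult_left_mono [OF integral_abs_bound N_nonneg]])
    then have cov: "\<bar>N n * EP n (\<lambda>x. lc x * rc x)\<bar> \<le> sqrt (VL n * (C * (1 / N n)))"
      by (simp add: abs_mult N_nonneg)
    have "0 \<le> N n * P.variance n (R a n)"
      by (simp add: N_nonneg P.variance_positive)
    with cov varR show ?case unfolding var real_norm_def by linarith
  qed
  have "(\<lambda>n. 2 * sqrt (VL n * (C * (1 / N n))) + C * (1 / N n)) \<longlonglongrightarrow> 2 * sqrt (s * \<omega> * (C * 0)) + C * 0"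
    by (intro tendsto_add tendsto_mult tendsto_const tendsto_real_sqrt VL_lim N_inverse)
  then have "(\<lambda>n. N n * P.variance n (estimator a n) - VL n) \<longlonglongrightarrow> 0"
    by (intro Lim_null_comparison [OF bound]) simp
  then have "(\<lambda>n. (N n * P.variance n (estimator a n) - VL n) + VL n) \<longlonglongrightarrow> 0 + s * \<omega>"
    by (intro tendsto_add VL_lim)
  then show ?thesis
    by (simp add: \<omega>_def m_lim_def power_mult_distrib mult.commute mult.left_commute)
qed

lemma b_lim: "(\<lambda>n. b n / h n) \<longlonglongrightarrow> \<phi>' * (\<alpha> / \<beta> (1 - l)) * (\<mu>0 / \<mu>1)"
proof -
  define M where "M i = expectation (\<lambda>y. \<rho> y / h i * K (\<rho> y / h i)) / F (h i)" for i
  define y where "y i = expectation (\<lambda>q. kern i q * f i q) / (h i * F (h i))" for i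
  have M_int: "integrable Q (\<lambda>q. \<rho> q / h i * K (\<rho> q / h i))" "0 \<le> M i" "M i \<le> K_hi" if i: "i \<ge> 1" for i
  proof -
    have *: "\<bar>\<rho> q / h i\<bar> \<le> 1" "0 \<le> \<rho> q / h i" if "kern i q \<noteq> 0" for q
      using kern_nz [OF i that] h_pos [OF i] by auto
    have eq: "(\<lambda>q. \<rho> q / h i * K (\<rho> q / h i)) = (\<lambda>q. kern i q ^ 1 * (\<rho> q / h i))"
      by (simp add: kern_def fun_eq_iff mult.commute)
    show "integrable Q (\<lambda>q. \<rho> q / h i * K (\<rho> q / h i))"
      unfolding eq by (rule integrable_kern_mult [OF i _ *(1)]) auto
    have "\<bar>expectation (\<lambda>q. \<rho> q / h i * K (\<rho> q / h i))\<bar> \<le> K_hi ^ 1 * 1 * F (h i)"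
      unfolding eq by (rule expectation_kern_mult_le [OF i _ *(1)]) auto
    from abs_le_D1 [OF this] show "M i \<le> K_hi"
      unfolding M_def pos_divide_le_eq [OF Fh_pos [OF i]] by (simp only: power_one_right mult_1_right)
    have "0 \<le> kern i q ^ 1 * (\<rho> q / h i)" for q
      using *(2) [of q] kern_nonneg [of i q] by (cases "kern i q = 0") (auto intro: mult_nonneg_nonneg simp only: power_one_right)
    then show "0 \<le> M i"
      unfolding M_def eq by (intro divide_nonneg_nonneg Bochner_Integration.integral_nonneg) (simp_all add: F_nonneg)
  qed
  have y_M: "(\<lambda>i. y i - \<phi>' * M i) \<longlonglongrightarrow> 0"
  proof (rule tendstoI)
    fix e :: real assume e: "e > 0"
    define \<epsilon> where "\<epsilon> = e / (2 * K_hi)"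
    have \<epsilon>: "\<epsilon> > 0" using e K_hi_pos by (simp add: \<epsilon>_def)
    obtain t where t: "t > 0" "\<And>u. u \<in> {0..t} \<Longrightarrow> \<bar>\<phi> u - \<phi>' * u\<bar> \<le> \<epsilon> * u"
      using \<phi>_approx [OF \<epsilon>] by blast
    obtain i1 where i1: "\<And>j. j \<ge> i1 \<Longrightarrow> h j \<le> t"
      using bandwidths_below [OF t(1)] by blast
    show "\<forall>\<^sub>F i in sequentially. dist (y i - \<phi>' * M i) 0 < e"
      using eventually_ge_at_top [of i1] eventually_ge_at_top [of i0]
    proof eventually_elim
      case (elim i)
      then have i: "i \<ge> 1" using i0(1) by simp
      note pos = h_pos [OF i] Fh_pos [OF i]
      have f_bd: "\<bar>f i q - \<phi>' * \<rho> q\<bar> \<le> \<epsilon> * h i" if "kern i q \<noteq> 0" for q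
      proof -
        have q: "\<rho> q \<in> {0..h i}" using kern_nz [OF i that] .
        then have "\<bar>f i q - \<phi>' * \<rho> q\<bar> \<le> \<epsilon> * \<rho> q"
          using t(2) [of "\<rho> q"] i1 [OF elim(1)] elim(2) by (auto simp: f_def)
        also have "\<dots> \<le> \<epsilon> * h i" using q \<epsilon> by (intro mult_left_mono) auto
        finally show ?thesis .
      qed
      have kf: "integrable Q (\<lambda>q. kern i q * f i q)"
        using integrable_kern_mult [OF i _ f_le [OF kern_nz [OF i]] f_meas, of 1]
        by (simp add: C\<phi>_def)
      have "expectation (\<lambda>q. kern i q ^ 1 * (f i q - \<phi>' * \<rho> q))
          = expectation (\<lambda>q. kern i q * f i q - \<phi>' * h i * (\<rho> q / h i * K (\<rho> q / h i)))"
        using pos by (intro Bochner_Integration.integral_cong refl) (simp add: kern_def algebra_simps)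
      also have "\<dots> = expectation (\<lambda>q. kern i q * f i q)
          - \<phi>' * h i * expectation (\<lambda>q. \<rho> q / h i * K (\<rho> q / h i))"
        by (simp only: Bochner_Integration.integral_diff [OF kf integrable_mult_right [OF M_int(1) [OF i]]]
            integral_mult_right_zero)
      also have "expectation (\<lambda>q. kern i q * f i q) = h i * F (h i) * y i"
        using pos by (simp add: y_def)
      also have "expectation (\<lambda>q. \<rho> q / h i * K (\<rho> q / h i)) = F (h i) * M i"
        using pos by (simp add: M_def)
      also have "h i * F (h i) * y i - \<phi>' * h i * (F (h i) * M i) = h i * F (h i) * (y i - \<phi>' * M i)"
        by (simp add: algebra_simps)
      finally have eq: "h i * F (h i) * (y i - \<phi>' * M i) = expectation (\<lambda>q. kern i q ^ 1 * (f i q - \<phi>' * \<rho> q))" ..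
      have "\<bar>h i * F (h i) * (y i - \<phi>' * M i)\<bar> \<le> K_hi ^ 1 * (\<epsilon> * h i) * F (h i)"
        unfolding eq by (rule expectation_kern_mult_le [OF i _ f_bd]) (use \<epsilon> pos in auto)
      also have "\<dots> = h i * F (h i) * (e / 2)"
        using K_hi_pos by (simp add: \<epsilon>_def)
      finally have "\<bar>y i - \<phi>' * M i\<bar> \<le> e / 2"
        using pos by (simp add: abs_mult)
      then show ?case using e by (simp add: dist_real_def)
    qed
  qed
  have "(\<lambda>i. (y i - \<phi>' * M i) + \<phi>' * M i) \<longlonglongrightarrow> 0 + \<phi>' * \<mu>0"
    using \<mu>0 by (intro tendsto_add tendsto_mult tendsto_const y_M) (simp add: M_def [abs_def])
  then have y_lim: "y \<longlonglongrightarrow> \<phi>' * \<mu>0" by simp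
  define c where "c i = h i * F (h i) powr (1 - l)" for i
  have c_ratio: "c i / c n = h i / h n * (F (h i) / F (h n)) powr (1 - l)" for i n
    by (simp add: c_def powr_divide F_nonneg)
  have "(\<lambda>n. 1 / real n * (\<Sum>i=1..n. c i / c n * y i)) \<longlonglongrightarrow> \<alpha> * (\<phi>' * \<mu>0)"
  proof (rule weighted_Cesaro [OF _ _ y_lim])
    show "0 < c i" if "i \<ge> 1" for i
      using h_pos [OF that] Fh_pos [OF that] by (simp add: c_def)
    show "(\<lambda>n. 1 / real n * (\<Sum>i=1..n. c i / c n)) \<longlonglongrightarrow> \<alpha>"
      using A_lim by (simp add: c_ratio A_avg_def [abs_def])
  qed
  then have "(\<lambda>n. 1 / real n * (\<Sum>i=1..n. c i / c n * y i) / m n) \<longlonglongrightarrow> \<alpha> * (\<phi>' * \<mu>0) / m_lim"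
    using m_lim_pos by (intro tendsto_divide m_tendsto) auto
  moreover have "\<forall>\<^sub>F n in sequentially. 1 / real n * (\<Sum>i=1..n. c i / c n * y i) / m n = b n / h n"
    using eventually_ge_at_top [of 1]
  proof eventually_elim
    case (elim n)
    note posn = h_pos [OF elim] Fh_pos [OF elim]
    have "h n * (1 / real n * (c i / c n * y i)) = coef n i * expectation (\<lambda>q. kern i q * f i q)"
      if i: "i \<in> {1..n}" for i
    proof -
      have pos: "h i > 0" "F (h i) > 0" using i h_pos [of i] Fh_pos [of i] by auto
      have "(F (h i) / F (h n)) powr (1 - l) = F (h i) / F (h n) * (F (h i) / F (h n)) powr (- l)"
        using pos posn by (simp add: powr_diff powr_minus field_simps)
      then show ?thesis
        using pos posn elim by (simp add: c_ratio y_def coef_def N_def field_simps)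
    qed
    then have "(\<Sum>i=1..n. h n * (1 / real n * (c i / c n * y i))) = (\<Sum>i=1..n. coef n i * expectation (\<lambda>q. kern i q * f i q))"
      by (intro sum.cong refl)
    then have eq: "h n * (1 / real n * (\<Sum>i=1..n. c i / c n * y i)) = (\<Sum>i=1..n. coef n i * expectation (\<lambda>q. kern i q * f i q))"
      by (simp only: sum_distrib_left)
    then show ?case
      unfolding b_def eq [symmetric] using posn by simp
  qed
  ultimately have "(\<lambda>n. b n / h n) \<longlonglongrightarrow> \<alpha> * (\<phi>' * \<mu>0) / m_lim"
    by (rule Lim_transform_eventually)
  then show ?thesis
    by (simp add: m_lim_def mult_ac)
qed

theorem estimator_bias:
  "(\<lambda>n. EP n (estimator a n) - a - b n) \<in> O(\<lambda>n. 1 / (real n * F (h n)))"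
proof -
  obtain C where C: "\<forall>\<^sub>F n in sequentially. integrable (P n) (R a n) \<and> integrable (P n) (\<lambda>x. (R a n x)\<^sup>2) \<and>
    (N n)\<^sup>2 * EP n (\<lambda>x. (R a n x)\<^sup>2) \<le> C"
    using R_bound by blast
  have ev: "\<forall>\<^sub>F n in sequentially. \<bar>N n * (EP n (S n) - b n)\<bar> < 1"
    using tendstoD [OF S_lim(2), of 1] by (simp add: dist_real_def)
  have "\<forall>\<^sub>F n in sequentially. norm (EP n (estimator a n) - a - b n)
      \<le> (1 + sqrt C) * norm (1 / (real n * F (h n)))"
    using C ev eventually_ge_at_top [of 1]
  proof eventually_elim
    case (elim n)
    have Nn: "N n > 0" using elim by (simp add: N_pos)
    have RI: "integrable (P n) (R a n)" "integrable (P n) (\<lambda>x. (R a n x)\<^sup>2)" using elim by auto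
    have est: "estimator a n x = a + (L n x + R a n x)" for x
      by (simp add: R_def)
    have mean: "EP n (estimator a n) = a + (EP n (S n) + EP n (R a n))"
      unfolding est [abs_def] using L_S(1,5) RI by (simp add: P.prob_space)
    have "(EP n (R a n))\<^sup>2 \<le> EP n (\<lambda>x. (R a n x)\<^sup>2)"
      using P.variance_eq [OF RI] P.variance_positive [of n "R a n"] by simp
    then have "(N n * EP n (R a n))\<^sup>2 \<le> (N n)\<^sup>2 * EP n (\<lambda>x. (R a n x)\<^sup>2)"
      unfolding power_mult_distrib by (intro mult_left_mono) auto
    also have "\<dots> \<le> C" using elim by simp
    finally have "\<bar>N n * EP n (R a n)\<bar> \<le> sqrt C"
      using real_sqrt_le_mono by fastforce
    moreover have "N n * (EP n (estimator a n) - a - b n)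
        = N n * (EP n (S n) - b n) + N n * EP n (R a n)"
      by (simp add: mean algebra_simps)
    ultimately have "\<bar>N n * (EP n (estimator a n) - a - b n)\<bar> \<le> 1 + sqrt C"
      using elim by linarith
    then have "N n * \<bar>EP n (estimator a n) - a - b n\<bar> \<le> 1 + sqrt C"
      using Nn by (simp add: abs_mult)
    then show ?case
      unfolding N_def [symmetric] real_norm_def using Nn by (simp add: field_simps)
  qed
  then show ?thesis by (rule bigoI)
qed

end

section \<open>Reduction to the distance\<close>

lemma leading_termI:
  assumes lim: "(\<lambda>n. f n / g n) \<longlonglongrightarrow> c" and g: "\<forall>\<^sub>F n in sequentially. g n \<noteq> 0"
  shows "leading_term f c g"
proof (cases "c = 0")
  case True
  then show ?thesis
    using smalloI_tendsto [OF _ g, of f] lim by (simp add: leading_term_def)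
next
  case False
  have "(\<lambda>n. f n / g n / c - 1) \<longlonglongrightarrow> c / c - 1"
    using False by (intro tendsto_intros lim)
  moreover have "\<forall>\<^sub>F n in sequentially. f n = c * g n * (1 + (f n / g n / c - 1))"
    using g by eventually_elim (use False in simp)
  ultimately show ?thesis
    using False unfolding leading_term_def by auto
qed

context prob_space
begin

lemma finite_measure_subalgebra_sigma_gen:
  assumes "X \<in> borel_measurable M"
  shows "finite_measure_subalgebra M (sigma_gen M X)"
proof
  show "subalgebra M (sigma_gen M X)"
    using assms by (auto simp: subalgebra_def sigma_gen_def sets_image_in_sets)
qed

lemma measurable_sigma_gen:
  assumes "u \<in> borel_measurable borel"
  shows "(\<lambda>\<omega>. u (X \<omega>)) \<in> borel_measurable (sigma_gen M X)"
  unfolding sigma_gen_def by (rule measurable_compose [OF measurable_vimage_algebra1 assms]) auto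

lemma expectation_mult_regression:
  fixes X :: "'a \<Rightarrow> 'b::topological_space" and Y :: "'a \<Rightarrow> real" and r u :: "'b \<Rightarrow> real"
  assumes X [measurable]: "X \<in> borel_measurable M" and Y: "integrable M Y"
    and r [measurable]: "r \<in> borel_measurable borel"
    and cond: "AE \<omega> in M. real_cond_exp M (sigma_gen M X) Y \<omega> = r (X \<omega>)"
    and u [measurable]: "u \<in> borel_measurable borel" and C: "\<And>\<omega>. \<omega> \<in> space M \<Longrightarrow> \<bar>u (X \<omega>)\<bar> \<le> C"
  shows "integrable M (\<lambda>\<omega>. u (X \<omega>) * Y \<omega>)" "integrable M (\<lambda>\<omega>. u (X \<omega>) * r (X \<omega>))"
    and "expectation (\<lambda>\<omega>. u (X \<omega>) * Y \<omega>) = expectation (\<lambda>\<omega>. u (X \<omega>) * r (X \<omega>))"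
proof -
  interpret S: finite_measure_subalgebra M "sigma_gen M X"
    by (rule finite_measure_subalgebra_sigma_gen [OF X])
  have [measurable]: "Y \<in> borel_measurable M" using Y by simp
  have [measurable]: "real_cond_exp M (sigma_gen M X) Y \<in> borel_measurable M"
    using S.real_cond_exp_int(1) [OF Y] by simp
  show uY: "integrable M (\<lambda>\<omega>. u (X \<omega>) * Y \<omega>)"
  proof (rule Bochner_Integration.integrable_bound [OF integrable_mult_right [OF Y, of C]])
    show "AE \<omega> in M. norm (u (X \<omega>) * Y \<omega>) \<le> norm (C * Y \<omega>)"
    proof (rule AE_I2)
      fix \<omega> assume "\<omega> \<in> space M"
      from C [OF this] have "\<bar>u (X \<omega>)\<bar> \<le> \<bar>C\<bar>" by linarith
      then show "norm (u (X \<omega>) * Y \<omega>) \<le> norm (C * Y \<omega>)"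
        by (simp add: abs_mult mult_right_mono)
    qed
  qed simp
  note intg = S.real_cond_exp_intg [OF uY measurable_sigma_gen [OF u]]
  have ae: "AE \<omega> in M. u (X \<omega>) * real_cond_exp M (sigma_gen M X) Y \<omega> = u (X \<omega>) * r (X \<omega>)"
    using cond by eventually_elim simp
  show "integrable M (\<lambda>\<omega>. u (X \<omega>) * r (X \<omega>))"
    by (rule integrable_cong_AE_imp [OF intg(1)]) (use ae in \<open>auto elim: eventually_mono\<close>)
  have "expectation (\<lambda>\<omega>. u (X \<omega>) * real_cond_exp M (sigma_gen M X) Y \<omega>) = expectation (\<lambda>\<omega>. u (X \<omega>) * r (X \<omega>))"
    by (rule integral_cong_AE) (use ae in auto)
  then show "expectation (\<lambda>\<omega>. u (X \<omega>) * Y \<omega>) = expectation (\<lambda>\<omega>. u (X \<omega>) * r (X \<omega>))"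
    using intg(2) by simp
qed

lemma integrable_regression:
  fixes X :: "'a \<Rightarrow> 'b::topological_space" and Y :: "'a \<Rightarrow> real" and r :: "'b \<Rightarrow> real"
  assumes "X \<in> borel_measurable M" "integrable M Y" "r \<in> borel_measurable borel"
    and "AE \<omega> in M. real_cond_exp M (sigma_gen M X) Y \<omega> = r (X \<omega>)"
  shows "integrable M (\<lambda>\<omega>. r (X \<omega>))"
  using expectation_mult_regression(2) [OF assms, of "\<lambda>_. 1" 1] by simp

lemma expectation_mult_conditional_variance:
  fixes X :: "'a \<Rightarrow> 'b::topological_space" and e :: "'a \<Rightarrow> real" and v u :: "'b \<Rightarrow> real"
  assumes X [measurable]: "X \<in> borel_measurable M" and e [measurable]: "e \<in> borel_measurable M"
    and v [measurable]: "v \<in> borel_measurable borel" and v_nonneg: "\<And>x. v x \<ge> 0"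
    and cond: "AE \<omega> in M. nn_cond_exp M (sigma_gen M X) (\<lambda>\<omega>. ennreal ((e \<omega>)\<^sup>2)) \<omega> = ennreal (v (X \<omega>))"
    and u [measurable]: "u \<in> borel_measurable borel" and u_nonneg: "\<And>x. u x \<ge> 0"
    and int: "integrable M (\<lambda>\<omega>. u (X \<omega>) * v (X \<omega>))"
  shows "integrable M (\<lambda>\<omega>. u (X \<omega>) * (e \<omega>)\<^sup>2)"
    and "expectation (\<lambda>\<omega>. u (X \<omega>) * (e \<omega>)\<^sup>2) = expectation (\<lambda>\<omega>. u (X \<omega>) * v (X \<omega>))"
proof -
  interpret S: finite_measure_subalgebra M "sigma_gen M X"
    by (rule finite_measure_subalgebra_sigma_gen [OF X])
  have "(\<integral>\<^sup>+\<omega>. ennreal (u (X \<omega>)) * ennreal ((e \<omega>)\<^sup>2) \<partial>M)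
      = (\<integral>\<^sup>+\<omega>. ennreal (u (X \<omega>)) * nn_cond_exp M (sigma_gen M X) (\<lambda>\<omega>. ennreal ((e \<omega>)\<^sup>2)) \<omega> \<partial>M)"
    using measurable_sigma_gen [of "\<lambda>x. ennreal (u x)" X]
    by (intro S.nn_cond_exp_intg [symmetric]) (auto simp: sigma_gen_def intro: measurable_compose [OF measurable_vimage_algebra1])
  also have "\<dots> = (\<integral>\<^sup>+\<omega>. ennreal (u (X \<omega>)) * ennreal (v (X \<omega>)) \<partial>M)"
    using cond by (intro nn_integral_cong_AE) (auto elim: eventually_mono)
  finally have nn: "(\<integral>\<^sup>+\<omega>. ennreal (u (X \<omega>) * (e \<omega>)\<^sup>2) \<partial>M) = (\<integral>\<^sup>+\<omega>. ennreal (u (X \<omega>) * v (X \<omega>)) \<partial>M)"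
    by (simp add: ennreal_mult' u_nonneg v_nonneg)
  also have "\<dots> = ennreal (expectation (\<lambda>\<omega>. u (X \<omega>) * v (X \<omega>)))"
    by (rule nn_integral_eq_integral [OF int]) (simp add: u_nonneg v_nonneg)
  finally have nn': "(\<integral>\<^sup>+\<omega>. ennreal (u (X \<omega>) * (e \<omega>)\<^sup>2) \<partial>M) = ennreal (expectation (\<lambda>\<omega>. u (X \<omega>) * v (X \<omega>)))" .
  show "integrable M (\<lambda>\<omega>. u (X \<omega>) * (e \<omega>)\<^sup>2)"
    by (rule integrableI_nonneg) (auto simp: nn' u_nonneg)
  show "expectation (\<lambda>\<omega>. u (X \<omega>) * (e \<omega>)\<^sup>2) = expectation (\<lambda>\<omega>. u (X \<omega>) * v (X \<omega>))"
    using nn' by (subst integral_eq_nn_integral) (auto simp: u_nonneg v_nonneg)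
qed

end

lemma kernel_support:
  fixes K :: "real \<Rightarrow> real"
  assumes "closure {t. K t \<noteq> 0} = {0..1}" "t \<notin> {0..1}"
  shows "K t = 0"
  using assms closure_subset [of "{t. K t \<noteq> 0}"] by blast

lemma kernel_measurable:
  fixes K :: "real \<Rightarrow> real"
  assumes "\<And>t. t \<notin> {0..1} \<Longrightarrow> K t = 0" "K differentiable_on {0..1}"
  shows "K \<in> borel_measurable borel"
proof -
  have "(\<lambda>t. indicator {0..1} t *\<^sub>R K t) \<in> borel_measurable borel"
    using assms(2) by (intro borel_measurable_continuous_on_indicator differentiable_imp_continuous_on) auto
  also have "(\<lambda>t. indicator {0..1} t *\<^sub>R K t) = K"
    using assms(1) by (auto simp: fun_eq_iff indicator_def)
  finally show ?thesis .
qed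

lemma
  assumes "is_seminorm p"
  shows seminorm_0: "p 0 = 0" and seminorm_minus_commute: "p (x - y) = p (y - x)"
    and seminorm_nonneg: "p x \<ge> 0"
proof -
  have tri: "p (a + b) \<le> p a + p b" and hom: "p (c *\<^sub>R a) = \<bar>c\<bar> * p a" for a b c
    using assms by (auto simp: is_seminorm_def)
  show p0: "p 0 = 0" using hom [of 0 0] by simp
  have neg: "p (- a) = p a" for a using hom [of "-1" a] by simp
  show "p (x - y) = p (y - x)" using neg [of "x - y"] by simp
  show "p x \<ge> 0" using tri [of x "- x"] by (simp add: p0 neg)
qed

lemma continuous_nearD:
  assumes "continuous_near p chi f" "is_seminorm p" "e > 0"
  shows "\<exists>d>0. \<forall>y. p (y - chi) < d \<longrightarrow> \<bar>f y - f chi\<bar> < e"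
  using assms seminorm_0 [OF assms(2)] unfolding continuous_near_def by (metis diff_self)

theorem theorem1:
  fixes M :: "'w measure"
    and p :: "'e::banach \<Rightarrow> real"
    and X :: "'w \<Rightarrow> 'e" and Y :: "'w \<Rightarrow> real"
    and Xs :: "nat \<Rightarrow> 'w \<Rightarrow> 'e" and Ys :: "nat \<Rightarrow> 'w \<Rightarrow> real"
    and r \<sigma>2 :: "'e \<Rightarrow> real"
    and \<phi> :: "real \<Rightarrow> real" and \<phi>'0 :: real
    and chi :: 'e and l :: real
    and K \<tau>0 :: "real \<Rightarrow> real" and h :: "nat \<Rightarrow> real"
    and \<alpha> :: real and \<beta> :: "real \<Rightarrow> real"
    and F :: "real \<Rightarrow> real"
  defines "F \<equiv> small_ball M p X chi"
  assumes prob: "prob_space M"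
    and seminorm: "is_seminorm p" "p \<in> borel_measurable borel"
    \<comment> \<open>the random pair and its i.i.d. copies\<close>
    and pair: "X \<in> borel_measurable M" "Y \<in> borel_measurable M" "integrable M Y"
    and indep: "prob_space.indep_vars M (\<lambda>_. borel \<Otimes>\<^sub>M borel) (\<lambda>i \<omega>. (Xs i \<omega>, Ys i \<omega>)) {1..}"
    and ident: "\<And>i. i \<ge> 1 \<Longrightarrow>
        distr M (borel \<Otimes>\<^sub>M borel) (\<lambda>\<omega>. (Xs i \<omega>, Ys i \<omega>)) =
        distr M (borel \<Otimes>\<^sub>M borel) (\<lambda>\<omega>. (X \<omega>, Y \<omega>))"
    \<comment> \<open>regression function and conditional variance\<close>
    and r: "r \<in> borel_measurable borel"
        "AE \<omega> in M. real_cond_exp M (sigma_gen M X) Y \<omega> = r (X \<omega>)"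
    and \<sigma>2: "\<sigma>2 \<in> borel_measurable borel" "\<And>x. \<sigma>2 x \<ge> 0"
        "AE \<omega> in M. nn_cond_exp M (sigma_gen M X) (\<lambda>\<omega>. ennreal ((Y \<omega> - r (X \<omega>))\<^sup>2)) \<omega>
           = ennreal (\<sigma>2 (X \<omega>))"
    \<comment> \<open>equivalent to finiteness of the variances in the conclusion\<close>
    and second_moment: "\<And>i. i \<ge> 1 \<Longrightarrow>
        integrable M (\<lambda>\<omega>. (Y \<omega>)\<^sup>2 * indicator {\<omega>. p (chi - X \<omega>) \<le> h i} \<omega>)"
    and l: "l \<in> {0..1}" and h_pos: "\<And>n. n \<ge> 1 \<Longrightarrow> h n > 0"
    \<comment> \<open>(1)\<close>
    and cont: "continuous_near p chi r" "continuous_near p chi \<sigma>2"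
    and F0: "F 0 = 0"
    and \<phi>: "\<phi> \<in> borel_measurable borel"
        "AE \<omega> in M. real_cond_exp M (sigma_gen M (\<lambda>\<omega>. p (X \<omega> - chi)))
            (\<lambda>\<omega>. r (X \<omega>) - r chi) \<omega> = \<phi> (p (X \<omega> - chi))"
        "(\<phi> has_real_derivative \<phi>'0) (at 0 within {0..})"
    \<comment> \<open>(2)\<close>
    and K: "\<And>t. K t \<ge> 0" "bounded (range K)" "closure {t. K t \<noteq> 0} = {0..1}"
        "(INF t\<in>{0..1}. K t) > 0"
        "K differentiable_on {0..1}" "set_integrable lborel {0..1} (deriv01 K)"
    \<comment> \<open>(3)\<close>
    and \<tau>0: "\<And>s. s \<in> {0..1} \<Longrightarrow> ((\<lambda>t. F (t * s) / F t) \<longlongrightarrow> \<tau>0 s) (at_right 0)"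
    \<comment> \<open>(4)\<close>
    and h_lim: "h \<longlonglongrightarrow> 0" "filterlim (\<lambda>n. real n * F (h n)) at_top sequentially"
    and A_lim: "A_avg F h l \<longlonglongrightarrow> \<alpha>"
    and B_lim: "\<And>q. q \<le> 2 \<Longrightarrow> B_avg F h q \<longlonglongrightarrow> \<beta> q"
  shows
    "(\<exists>\<rho>. \<rho> \<in> O(\<lambda>n. 1 / (real n * F (h n))) \<and>
        leading_term
          (\<lambda>n. prob_space.expectation M (recursive_estimator p F K h l Xs Ys chi n) - r chi - \<rho> n)
          (\<phi>'0 * (\<alpha> / \<beta> (1 - l)) * (M0 K \<tau>0 / M1 K \<tau>0)) h)
     \<and> leading_term
          (\<lambda>n. prob_space.variance M (recursive_estimator p F K h l Xs Ys chi n))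
          (\<beta> (1 - 2 * l) / (\<beta> (1 - l))\<^sup>2 * (M2 K \<tau>0 / (M1 K \<tau>0)\<^sup>2) * \<sigma>2 chi)
          (\<lambda>n. 1 / (real n * F (h n)))"
proof -
  interpret M: prob_space M by (rule prob)
  note F_small_ball = F_def
  note [measurable] = seminorm(2) pair(1,2) r(1) \<sigma>2(1) \<phi>(1)
  have p_nonneg: "p x \<ge> 0" and p_commute: "p (x - y) = p (y - x)" for x y
    by (rule seminorm_nonneg [OF seminorm(1)], rule seminorm_minus_commute [OF seminorm(1)])
  have [measurable]: "(\<lambda>x. p (chi - x)) \<in> borel_measurable borel"
    by (rule measurable_compose [OF _ seminorm(2)])
       (intro borel_measurable_continuous_onI continuous_intros)
  define Q where "Q = distr M (borel \<Otimes>\<^sub>M borel) (\<lambda>\<omega>. (X \<omega>, Y \<omega>))"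
  define \<rho> where "\<rho> q = p (chi - fst q)" for q :: "'e \<times> real"
  define Z where "Z q = snd q - r chi" for q :: "'e \<times> real"
  have XY [measurable]: "(\<lambda>\<omega>. (X \<omega>, Y \<omega>)) \<in> measurable M (borel \<Otimes>\<^sub>M borel)"
    by measurable
  have sets_Q [measurable_cong]: "sets Q = sets (borel \<Otimes>\<^sub>M borel)"
    by (simp add: Q_def)
  have \<rho>_meas [measurable]: "\<rho> \<in> borel_measurable (borel \<Otimes>\<^sub>M borel)"
    unfolding \<rho>_def [abs_def] by measurable
  have Z_meas [measurable]: "Z \<in> borel_measurable (borel \<Otimes>\<^sub>M borel)"
    unfolding Z_def [abs_def] by measurable
  have E_Q: "(\<integral>q. f q \<partial>Q) = M.expectation (\<lambda>\<omega>. f (X \<omega>, Y \<omega>))"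
    and int_Q: "integrable Q f \<longleftrightarrow> integrable M (\<lambda>\<omega>. f (X \<omega>, Y \<omega>))"
    if "f \<in> borel_measurable (borel \<Otimes>\<^sub>M borel)" for f :: "'e \<times> real \<Rightarrow> real"
    unfolding Q_def by (rule integral_distr [OF XY that], rule integrable_distr_eq [OF XY that])
  interpret small_ball_distribution Q \<rho> F
  proof (intro small_ball_distribution.intro small_ball_distribution_axioms.intro)
    show "prob_space Q" unfolding Q_def by (rule M.prob_space_distr) measurable
    show "F t = measure Q {y \<in> space Q. \<rho> y \<le> t}" for t
    proof -
      have "{y \<in> space Q. \<rho> y \<le> t} \<in> sets (borel \<Otimes>\<^sub>M borel)"
        unfolding sets_Q [symmetric] by measurable
      then show ?thesis
        unfolding Q_def F_def small_ball_def
        by (subst measure_distr) (auto simp: \<rho>_def space_pair_measure intro!: arg_cong [where f = "measure M"])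
    qed
  qed (use F0 in measurable)
  have F_pos: "F t > 0" if "t > 0" for t
  proof -
    have "\<forall>\<^sub>F n in sequentially. real n * F (h n) > 0" "\<forall>\<^sub>F n in sequentially. h n < t"
      using h_lim(2) order_tendstoD(2) [OF h_lim(1) that] by (auto simp: filterlim_at_top_dense)
    then have "\<forall>\<^sub>F n in sequentially. F t > 0"
    proof eventually_elim
      case (elim n)
      then show ?case
        using F_mono [of "h n" t] F_nonneg [of "h n"] by (auto simp: zero_less_mult_iff)
    qed
    then show ?thesis by simp
  qed
  have h_right: "filterlim h (at_right 0) sequentially"
    using h_lim(1) eventually_sequentiallyI [of 1 "\<lambda>n. h n > 0", OF h_pos]
    by (simp add: filterlim_at eventually_conj_iff eventually_mono [of "\<lambda>n. h n > 0" _ "\<lambda>n. h n \<noteq> 0"])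
  note K_0 = kernel_support [OF K(3)]
  have K_meas: "K \<in> borel_measurable borel"
    by (rule kernel_measurable [OF _ K(5)]) (rule K_0)
  obtain K_hi where K_hi: "\<And>t. K t \<le> K_hi"
    using K(2) unfolding bounded_iff by (metis abs_le_D1 rangeI real_norm_def)
  have K_lo: "(INF t\<in>{0..1}. K t) \<le> K t" if "t \<in> {0..1}" for t
    by (rule cINF_lower [OF _ that]) (use K(1) in \<open>auto intro!: bdd_belowI2\<close>)
  have K2: "(\<lambda>s. (K s)\<^sup>2) differentiable_on {0..1}" "set_integrable lborel {0..1} (deriv01 (\<lambda>s. (K s)\<^sup>2))"
    using deriv01_mult [OF K(5,6) K(5,6)] by (simp_all add: power2_eq_square)
  have ind: "indicator {0..1} u * K u = K u" "indicator {0..1} u * (K u)\<^sup>2 = (K u)\<^sup>2"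
    "indicator {0..1} u * (u * K u) = u * K u" for u :: real
    using K_0 [of u] by (auto simp: indicator_def)
  have \<mu>0: "(\<lambda>i. expectation (\<lambda>y. \<rho> y / h i * K (\<rho> y / h i)) / F (h i)) \<longlonglongrightarrow> M0 K \<tau>0"
    using expectation_kernel_tendsto [OF deriv01_mult [OF deriv01_ident K(5,6)] h_right F_pos \<tau>0]
    unfolding ind by (simp add: M0_def)
  have \<mu>1: "(\<lambda>i. expectation (\<lambda>y. K (\<rho> y / h i)) / F (h i)) \<longlonglongrightarrow> M1 K \<tau>0"
    using expectation_kernel_tendsto [OF K(5,6) h_right F_pos \<tau>0] unfolding ind by (simp add: M1_def)
  have \<mu>2: "(\<lambda>i. expectation (\<lambda>y. (K (\<rho> y / h i))\<^sup>2) / F (h i)) \<longlonglongrightarrow> M2 K \<tau>0"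
    using expectation_kernel_tendsto [OF K2 h_right F_pos \<tau>0] unfolding ind by (simp add: M2_def)
  have rX_int: "integrable M (\<lambda>\<omega>. r (X \<omega>))"
    by (rule M.integrable_regression [OF pair(1,3) r])
  have p_meas: "(\<lambda>\<omega>. p (X \<omega> - chi)) \<in> borel_measurable M"
    unfolding p_commute [of _ chi] by measurable
  have \<psi>_int: "integrable M (\<lambda>\<omega>. r (X \<omega>) - r chi)"
    using rX_int by simp
  have mean_bias: "M.expectation (\<lambda>\<omega>. g (p (chi - X \<omega>)) * (r (X \<omega>) - r chi))
      = M.expectation (\<lambda>\<omega>. g (p (chi - X \<omega>)) * \<phi> (p (chi - X \<omega>)))"
    "integrable M (\<lambda>\<omega>. g (p (chi - X \<omega>)) * (r (X \<omega>) - r chi))"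
    "integrable M (\<lambda>\<omega>. g (p (chi - X \<omega>)) * \<phi> (p (chi - X \<omega>)))"
    if g: "g \<in> borel_measurable borel" "\<And>u. \<bar>g u\<bar> \<le> C" for g :: "real \<Rightarrow> real" and C
    using M.expectation_mult_regression [OF p_meas \<psi>_int \<phi>(1,2) g] unfolding p_commute [of _ chi] by auto
  have \<phi>_0: "\<phi> 0 = 0"
  proof (rule ccontr)
    assume "\<phi> 0 \<noteq> 0"
    define \<eta> where "\<eta> = \<bar>\<phi> 0\<bar> / 3"
    have \<eta>: "\<eta> > 0" using \<open>\<phi> 0 \<noteq> 0\<close> by (simp add: \<eta>_def)
    obtain d1 where d1: "d1 > 0" "\<And>y. p (y - chi) < d1 \<Longrightarrow> \<bar>r y - r chi\<bar> < \<eta>"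
      using continuous_nearD [OF cont(1) seminorm(1) \<eta>] by blast
    have "continuous (at 0 within {0..}) \<phi>"
      using \<phi>(3) by (rule DERIV_continuous)
    then obtain d2 where d2: "d2 > 0" "\<And>u. u \<in> {0..} \<Longrightarrow> dist u 0 < d2 \<Longrightarrow> dist (\<phi> u) (\<phi> 0) < \<eta>"
      using \<eta> unfolding continuous_within_eps_delta by blast
    define t where "t = min d1 d2 / 2"
    have t: "t > 0" "t < d1" "t < d2" using d1(1) d2(1) by (auto simp: t_def)
    define g where "g = (indicator {0..t} :: real \<Rightarrow> real)"
    have g: "g \<in> borel_measurable borel" "\<And>u. \<bar>g u\<bar> \<le> 1"
      by (auto simp: g_def indicator_def)
    note [measurable] = g(1)
    have g_int: "integrable M (\<lambda>\<omega>. g (p (chi - X \<omega>)))"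
      by (rule M.integrable_const_bound [where B = 1]) (use g(2) in auto)
    have Eg: "M.expectation (\<lambda>\<omega>. g (p (chi - X \<omega>))) = F t"
    proof -
      have "M.expectation (\<lambda>\<omega>. g (p (chi - X \<omega>))) = M.expectation (indicator {\<omega> \<in> space M. p (chi - X \<omega>) \<le> t})"
        by (intro Bochner_Integration.integral_cong refl) (auto simp: g_def indicator_def p_nonneg)
      then show ?thesis by (simp add: F_small_ball small_ball_def)
    qed
    have "\<bar>\<phi> 0\<bar> * F t = \<bar>M.expectation (\<lambda>\<omega>. g (p (chi - X \<omega>)) * \<phi> 0)\<bar>"
      using F_nonneg by (simp add: Eg abs_mult mult.commute)
    also have "M.expectation (\<lambda>\<omega>. g (p (chi - X \<omega>)) * \<phi> 0)
        = M.expectation (\<lambda>\<omega>. g (p (chi - X \<omega>)) * (r (X \<omega>) - r chi) - g (p (chi - X \<omega>)) * (\<phi> (p (chi - X \<omega>)) - \<phi> 0))"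
      using mean_bias [OF g] g_int by (simp add: right_diff_distrib)
    also have "\<bar>\<dots>\<bar> \<le> M.expectation (\<lambda>\<omega>. 2 * \<eta> * g (p (chi - X \<omega>)))"
    proof (rule order.trans [OF integral_abs_bound integral_mono])
      fix \<omega> assume "\<omega> \<in> space M"
      show "\<bar>g (p (chi - X \<omega>)) * (r (X \<omega>) - r chi) - g (p (chi - X \<omega>)) * (\<phi> (p (chi - X \<omega>)) - \<phi> 0)\<bar>
          \<le> 2 * \<eta> * g (p (chi - X \<omega>))"
      proof (cases "p (chi - X \<omega>) \<le> t")
        case True
        have "\<bar>r (X \<omega>) - r chi\<bar> < \<eta>" using True t d1(2) [of "X \<omega>"] by (simp add: p_commute [of _ chi])
        moreover have "\<bar>\<phi> (p (chi - X \<omega>)) - \<phi> 0\<bar> < \<eta>"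
          using True t d2(2) [of "p (chi - X \<omega>)"] p_nonneg [of "chi - X \<omega>"] by (simp add: dist_real_def)
        ultimately show ?thesis using True p_nonneg [of "chi - X \<omega>"] by (simp add: g_def)
      qed (simp add: g_def)
    qed (use mean_bias [OF g] g_int in \<open>simp_all add: right_diff_distrib\<close>)
    also have "\<dots> = 2 * \<eta> * F t" by (simp add: Eg)
    finally have "\<bar>\<phi> 0\<bar> \<le> 2 * \<eta>" using F_pos [OF t(1)] by simp
    then show False using \<eta> by (simp add: \<eta>_def)
  qed
  have e_meas [measurable]: "(\<lambda>\<omega>. Y \<omega> - r (X \<omega>)) \<in> borel_measurable M" by measurable
  interpret KR: kernel_regression Q \<rho> F K h l "INF t\<in>{0..1}. K t" K_hi "M1 K \<tau>0" "M2 K \<tau>0" \<beta>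
    Z \<phi> \<phi>'0 "\<sigma>2 chi" \<alpha> "M0 K \<tau>0"
  proof (intro kernel_regression.intro kernel_weights.intro kernel_weights_axioms.intro
      kernel_regression_axioms.intro)
    show "small_ball_distribution Q \<rho> F" by unfold_locales
    show "Z \<in> borel_measurable Q" by measurable
    show "integrable Q Z"
      using pair(3) by (subst int_Q) (simp_all add: Z_def)
    show "integrable Q (\<lambda>y. indicator {0..h i} (\<rho> y) * (Z y)\<^sup>2)" if i: "i \<ge> 1" for i
    proof (subst int_Q)
      show "integrable M (\<lambda>\<omega>. indicator {0..h i} (\<rho> (X \<omega>, Y \<omega>)) * (Z (X \<omega>, Y \<omega>))\<^sup>2)"
      proof (rule Bochner_Integration.integrable_bound)
        show "integrable M (\<lambda>\<omega>. 2 * ((Y \<omega>)\<^sup>2 * indicator {\<omega>. p (chi - X \<omega>) \<le> h i} \<omega>) + 2 * (r chi)\<^sup>2)"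
          using second_moment [OF i] by simp
        show "AE \<omega> in M. norm (indicator {0..h i} (\<rho> (X \<omega>, Y \<omega>)) * (Z (X \<omega>, Y \<omega>))\<^sup>2)
            \<le> norm (2 * ((Y \<omega>)\<^sup>2 * indicator {\<omega>. p (chi - X \<omega>) \<le> h i} \<omega>) + 2 * (r chi)\<^sup>2)"
        proof (rule AE_I2)
          fix \<omega>
          have "(Y \<omega> - r chi)\<^sup>2 \<le> 2 * (Y \<omega>)\<^sup>2 + 2 * (r chi)\<^sup>2"
            using zero_le_power2 [of "Y \<omega> + r chi"] by (simp add: power2_sum power2_diff)
          then show "norm (indicator {0..h i} (\<rho> (X \<omega>, Y \<omega>)) * (Z (X \<omega>, Y \<omega>))\<^sup>2)
            \<le> norm (2 * ((Y \<omega>)\<^sup>2 * indicator {\<omega>. p (chi - X \<omega>) \<le> h i} \<omega>) + 2 * (r chi)\<^sup>2)"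
            by (auto simp: \<rho>_def Z_def indicator_def)
        qed
      qed measurable
    qed measurable
    show "\<phi> \<in> borel_measurable borel" by (rule \<phi>(1))
    show "integrable Q (\<lambda>y. \<phi> (\<rho> y))"
      using mean_bias(3) [of "\<lambda>_. 1" 1] by (subst int_Q) (simp_all add: \<rho>_def)
    show "expectation (\<lambda>y. g (\<rho> y) * Z y) = expectation (\<lambda>y. g (\<rho> y) * \<phi> (\<rho> y))"
      if g [measurable]: "g \<in> borel_measurable borel" and "bounded (range g)" for g
    proof -
      obtain C where C: "\<And>u. \<bar>g u\<bar> \<le> C"
        using \<open>bounded (range g)\<close> unfolding bounded_iff by auto
      have "(\<lambda>x. g (p (chi - x))) \<in> borel_measurable borel" by measurable
      note reg = M.expectation_mult_regression [OF pair(1,3) r this C]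
      have g_int: "integrable M (\<lambda>\<omega>. g (p (chi - X \<omega>)))"
        by (rule M.integrable_const_bound [where B = C]) (use C in auto)
      have "expectation (\<lambda>y. g (\<rho> y) * Z y) = M.expectation (\<lambda>\<omega>. g (p (chi - X \<omega>)) * (Y \<omega> - r chi))"
        by (subst E_Q) (simp_all add: \<rho>_def Z_def)
      also have "\<dots> = M.expectation (\<lambda>\<omega>. g (p (chi - X \<omega>)) * (r (X \<omega>) - r chi))"
        using reg g_int by (simp add: right_diff_distrib)
      also have "\<dots> = M.expectation (\<lambda>\<omega>. g (p (chi - X \<omega>)) * \<phi> (p (chi - X \<omega>)))"
        by (rule mean_bias(1) [OF g C])
      also have "\<dots> = expectation (\<lambda>y. g (\<rho> y) * \<phi> (\<rho> y))"
        by (subst E_Q) (simp_all add: \<rho>_def)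
      finally show ?thesis .
    qed
    show "\<exists>t>0. \<forall>g\<in>borel_measurable borel. (\<forall>u. 0 \<le> g u \<and> g u \<le> 1) \<longrightarrow> (\<forall>u. u \<notin> {0..t} \<longrightarrow> g u = 0) \<longrightarrow>
        \<bar>expectation (\<lambda>y. g (\<rho> y) * ((Z y)\<^sup>2 - (\<phi> (\<rho> y))\<^sup>2)) - \<sigma>2 chi * expectation (\<lambda>y. g (\<rho> y))\<bar>
          \<le> \<epsilon> * expectation (\<lambda>y. g (\<rho> y))" if \<epsilon>: "\<epsilon> > 0" for \<epsilon>
    proof -
      define \<eta> where "\<eta> = sqrt (\<epsilon> / 3)"
      have \<eta>: "\<eta> > 0" "\<eta>\<^sup>2 = \<epsilon> / 3" using \<epsilon> by (simp_all add: \<eta>_def)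
      obtain d1 where d1: "d1 > 0" "\<And>y. p (y - chi) < d1 \<Longrightarrow> \<bar>r y - r chi\<bar> < \<eta>"
        using continuous_nearD [OF cont(1) seminorm(1) \<eta>(1)] by blast
      obtain d2 where d2: "d2 > 0" "\<And>y. p (y - chi) < d2 \<Longrightarrow> \<bar>\<sigma>2 y - \<sigma>2 chi\<bar> < \<epsilon> / 3"
        using continuous_nearD [OF cont(2) seminorm(1), of "\<epsilon> / 3"] \<epsilon> by auto
      have "continuous (at 0 within {0..}) \<phi>"
        using \<phi>(3) by (rule DERIV_continuous)
      then obtain d3 where d3: "d3 > 0" "\<And>u. u \<in> {0..} \<Longrightarrow> dist u 0 < d3 \<Longrightarrow> dist (\<phi> u) (\<phi> 0) < \<eta>"
        using \<eta>(1) unfolding continuous_within_eps_delta by blast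
      define t where "t = min d1 (min d2 d3) / 2"
      have t: "t > 0" "t < d1" "t < d2" "t < d3" using d1(1) d2(1) d3(1) by (auto simp: t_def)
      show ?thesis
      proof (intro exI [of _ t] conjI t(1) ballI impI)
        fix g :: "real \<Rightarrow> real"
        assume g_meas [measurable]: "g \<in> borel_measurable borel"
          and g01: "\<forall>u. 0 \<le> g u \<and> g u \<le> 1" and g_supp: "\<forall>u. u \<notin> {0..t} \<longrightarrow> g u = 0"
        define G where "G x = g (p (chi - x))" for x
        have G_meas [measurable]: "G \<in> borel_measurable borel" unfolding G_def [abs_def] by measurable
        have G01: "0 \<le> G x" "G x \<le> 1" for x using g01 by (auto simp: G_def)
        have G_near: "p (x - chi) \<le> t" if "G x \<noteq> 0" for x
          using g_supp that by (auto simp: G_def p_commute [of _ chi])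
        have G_r: "(r x - r chi)\<^sup>2 \<le> \<epsilon> / 3" "\<bar>r x - r chi\<bar> \<le> \<eta>" if "G x \<noteq> 0" for x
        proof -
          show "\<bar>r x - r chi\<bar> \<le> \<eta>" using G_near [OF that] d1(2) [of x] t by simp
          then have "\<bar>r x - r chi\<bar>\<^sup>2 \<le> \<eta>\<^sup>2" by (intro power_mono) auto
          then show "(r x - r chi)\<^sup>2 \<le> \<epsilon> / 3" by (simp add: \<eta>(2))
        qed
        have G_\<sigma>: "\<bar>\<sigma>2 x - \<sigma>2 chi\<bar> \<le> \<epsilon> / 3" if "G x \<noteq> 0" for x
          using G_near [OF that] d2(2) [of x] t by simp
        have G_\<phi>: "(\<phi> (p (chi - x)))\<^sup>2 \<le> \<epsilon> / 3" if "G x \<noteq> 0" for x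
        proof -
          have "\<bar>\<phi> (p (chi - x))\<bar> \<le> \<eta>"
            using G_near [OF that] d3(2) [of "p (chi - x)"] t p_nonneg [of "chi - x"]
            by (simp add: dist_real_def \<phi>_0 p_commute [of _ chi])
          then have "\<bar>\<phi> (p (chi - x))\<bar>\<^sup>2 \<le> \<eta>\<^sup>2" by (intro power_mono) auto
          then show ?thesis by (simp add: \<eta>(2))
        qed
        have bounded_int: "integrable M (\<lambda>\<omega>. G (X \<omega>) * c (X \<omega>))"
          if [measurable]: "c \<in> borel_measurable borel" and c: "\<And>x. G x \<noteq> 0 \<Longrightarrow> \<bar>c x\<bar> \<le> B" for c B
        proof (rule M.integrable_const_bound [where B = "\<bar>B\<bar>"])
          show "AE \<omega> in M. norm (G (X \<omega>) * c (X \<omega>)) \<le> \<bar>B\<bar>"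
          proof (rule AE_I2)
            fix \<omega>
            show "norm (G (X \<omega>) * c (X \<omega>)) \<le> \<bar>B\<bar>"
            proof (cases "G (X \<omega>) = 0")
              case False
              have "\<bar>G (X \<omega>)\<bar> * \<bar>c (X \<omega>)\<bar> \<le> 1 * \<bar>B\<bar>"
                using G01 c [OF False] by (intro mult_mono) auto
              then show ?thesis by (simp add: abs_mult)
            qed simp
          qed
        qed measurable
        have \<sigma>_int: "integrable M (\<lambda>\<omega>. G (X \<omega>) * \<sigma>2 (X \<omega>))"
        proof (rule bounded_int [of \<sigma>2 "\<sigma>2 chi + \<epsilon> / 3"])
          show "\<bar>\<sigma>2 x\<bar> \<le> \<sigma>2 chi + \<epsilon> / 3" if "G x \<noteq> 0" for x
            using G_\<sigma> [OF that] \<sigma>2(2) [of x] by linarith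
        qed measurable
        have \<psi>_int: "integrable M (\<lambda>\<omega>. G (X \<omega>) * (r (X \<omega>) - r chi)\<^sup>2)"
          by (rule bounded_int [of "\<lambda>x. (r x - r chi)\<^sup>2" "\<epsilon> / 3"]) (use G_r in auto)
        have \<phi>_int: "integrable M (\<lambda>\<omega>. G (X \<omega>) * (\<phi> (p (chi - X \<omega>)))\<^sup>2)"
          by (rule bounded_int [of "\<lambda>x. (\<phi> (p (chi - x)))\<^sup>2" "\<epsilon> / 3"]) (use G_\<phi> in auto)
        have G_int: "integrable M (\<lambda>\<omega>. G (X \<omega>))"
          using bounded_int [of "\<lambda>_. 1" 1] by simp
        note var = M.expectation_mult_conditional_variance [OF pair(1) e_meas \<sigma>2 G_meas G01(1) \<sigma>_int]
        have "(\<lambda>x. G x * (r x - r chi)) \<in> borel_measurable borel" by measurable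
        moreover have "\<bar>G (X \<omega>) * (r (X \<omega>) - r chi)\<bar> \<le> \<eta>" for \<omega>
        proof (cases "G (X \<omega>) = 0")
          case False
          have "\<bar>G (X \<omega>)\<bar> * \<bar>r (X \<omega>) - r chi\<bar> \<le> 1 * \<eta>"
            using G01 G_r(2) [OF False] by (intro mult_mono) auto
          then show ?thesis by (simp add: abs_mult)
        qed (use \<eta> in simp)
        ultimately have cross: "integrable M (\<lambda>\<omega>. G (X \<omega>) * (r (X \<omega>) - r chi) * Y \<omega>)"
          "integrable M (\<lambda>\<omega>. G (X \<omega>) * (r (X \<omega>) - r chi) * r (X \<omega>))"
          "M.expectation (\<lambda>\<omega>. G (X \<omega>) * (r (X \<omega>) - r chi) * Y \<omega>)
            = M.expectation (\<lambda>\<omega>. G (X \<omega>) * (r (X \<omega>) - r chi) * r (X \<omega>))"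
          using M.expectation_mult_regression [OF pair(1,3) r, of "\<lambda>x. G x * (r x - r chi)" \<eta>] by auto
        define V where "V \<omega> = G (X \<omega>) * (\<sigma>2 (X \<omega>) - \<sigma>2 chi) + G (X \<omega>) * (r (X \<omega>) - r chi)\<^sup>2
            - G (X \<omega>) * (\<phi> (p (chi - X \<omega>)))\<^sup>2" for \<omega>
        have V_int: "integrable M V"
          unfolding V_def [abs_def] using \<sigma>_int \<psi>_int \<phi>_int G_int by (simp add: right_diff_distrib)
        have "expectation (\<lambda>y. g (\<rho> y) * ((Z y)\<^sup>2 - (\<phi> (\<rho> y))\<^sup>2))
            = M.expectation (\<lambda>\<omega>. G (X \<omega>) * (Y \<omega> - r (X \<omega>))\<^sup>2
                + 2 * (G (X \<omega>) * (r (X \<omega>) - r chi) * Y \<omega> - G (X \<omega>) * (r (X \<omega>) - r chi) * r (X \<omega>))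
                + G (X \<omega>) * (r (X \<omega>) - r chi)\<^sup>2 - G (X \<omega>) * (\<phi> (p (chi - X \<omega>)))\<^sup>2)"
        proof (subst E_Q)
          show "M.expectation (\<lambda>\<omega>. g (\<rho> (X \<omega>, Y \<omega>)) * ((Z (X \<omega>, Y \<omega>))\<^sup>2 - (\<phi> (\<rho> (X \<omega>, Y \<omega>)))\<^sup>2))
            = M.expectation (\<lambda>\<omega>. G (X \<omega>) * (Y \<omega> - r (X \<omega>))\<^sup>2
                + 2 * (G (X \<omega>) * (r (X \<omega>) - r chi) * Y \<omega> - G (X \<omega>) * (r (X \<omega>) - r chi) * r (X \<omega>))
                + G (X \<omega>) * (r (X \<omega>) - r chi)\<^sup>2 - G (X \<omega>) * (\<phi> (p (chi - X \<omega>)))\<^sup>2)"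
            by (intro Bochner_Integration.integral_cong refl)
               (simp add: \<rho>_def Z_def G_def power2_eq_square algebra_simps)
        qed measurable
        also have "\<dots> = M.expectation (\<lambda>\<omega>. G (X \<omega>) * \<sigma>2 (X \<omega>))
            + M.expectation (\<lambda>\<omega>. G (X \<omega>) * (r (X \<omega>) - r chi)\<^sup>2) - M.expectation (\<lambda>\<omega>. G (X \<omega>) * (\<phi> (p (chi - X \<omega>)))\<^sup>2)"
          using var cross \<psi>_int \<phi>_int by simp
        also have "\<dots> = M.expectation V + \<sigma>2 chi * M.expectation (\<lambda>\<omega>. G (X \<omega>))"
          unfolding V_def [abs_def] using \<sigma>_int \<psi>_int \<phi>_int G_int by (simp add: right_diff_distrib)
        finally have lhs: "expectation (\<lambda>y. g (\<rho> y) * ((Z y)\<^sup>2 - (\<phi> (\<rho> y))\<^sup>2))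
            = M.expectation V + \<sigma>2 chi * M.expectation (\<lambda>\<omega>. G (X \<omega>))" .
        have rhs: "expectation (\<lambda>y. g (\<rho> y)) = M.expectation (\<lambda>\<omega>. G (X \<omega>))"
          by (subst E_Q) (simp_all add: \<rho>_def G_def)
        have "\<bar>M.expectation V\<bar> \<le> M.expectation (\<lambda>\<omega>. \<epsilon> * G (X \<omega>))"
        proof (rule order.trans [OF integral_abs_bound integral_mono])
          fix \<omega>
          show "\<bar>V \<omega>\<bar> \<le> \<epsilon> * G (X \<omega>)"
          proof (cases "G (X \<omega>) = 0")
            case False
            have "\<bar>\<sigma>2 (X \<omega>) - \<sigma>2 chi + (r (X \<omega>) - r chi)\<^sup>2 - (\<phi> (p (chi - X \<omega>)))\<^sup>2\<bar> \<le> \<epsilon>"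
              using G_\<sigma> [OF False] G_r(1) [OF False] G_\<phi> [OF False]
                zero_le_power2 [of "r (X \<omega>) - r chi"] zero_le_power2 [of "\<phi> (p (chi - X \<omega>))"] by linarith
            from mult_left_mono [OF this G01(1) [of "X \<omega>"]]
            have "\<bar>G (X \<omega>) * (\<sigma>2 (X \<omega>) - \<sigma>2 chi + (r (X \<omega>) - r chi)\<^sup>2 - (\<phi> (p (chi - X \<omega>)))\<^sup>2)\<bar> \<le> G (X \<omega>) * \<epsilon>"
              using G01(1) [of "X \<omega>"] by (simp add: abs_mult)
            then show ?thesis by (simp add: V_def algebra_simps)
          qed (simp add: V_def)
        qed (use V_int G_int in auto)
        then show "\<bar>expectation (\<lambda>y. g (\<rho> y) * ((Z y)\<^sup>2 - (\<phi> (\<rho> y))\<^sup>2)) - \<sigma>2 chi * expectation (\<lambda>y. g (\<rho> y))\<bar>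
          \<le> \<epsilon> * expectation (\<lambda>y. g (\<rho> y))"
          by (simp add: lhs rhs)
      qed
    qed
  qed (fact F_pos h_pos h_lim K_meas K_hi K(4) K_lo K_0 l B_lim \<mu>1 \<mu>2 \<phi>_0 \<phi>(3) \<mu>0 A_lim)+
  let ?est = "recursive_estimator p F K h l Xs Ys chi"
  let ?T = "\<lambda>n \<omega>. \<lambda>i\<in>{1..n}. (Xs i \<omega>, Ys i \<omega>)"
  have rv: "(\<lambda>\<omega>. (Xs i \<omega>, Ys i \<omega>)) \<in> measurable M (borel \<Otimes>\<^sub>M borel)" if "i \<in> {1..n}" for i n
    using indep that unfolding M.indep_vars_def by auto
  have T_meas: "?T n \<in> measurable M (\<Pi>\<^sub>M i\<in>{1..n}. borel \<Otimes>\<^sub>M borel)" for n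
    by (rule measurable_restrict) (rule rv)
  have distr_T: "distr M (\<Pi>\<^sub>M i\<in>{1..n}. borel \<Otimes>\<^sub>M borel) (?T n) = KR.P n" if "n \<ge> 1" for n
  proof -
    have "M.indep_vars (\<lambda>_. borel \<Otimes>\<^sub>M borel) (\<lambda>i \<omega>. (Xs i \<omega>, Ys i \<omega>)) {1..n}"
      by (rule M.indep_vars_subset [OF indep]) auto
    then have "distr M (\<Pi>\<^sub>M i\<in>{1..n}. borel \<Otimes>\<^sub>M borel) (?T n)
        = (\<Pi>\<^sub>M i\<in>{1..n}. distr M (borel \<Otimes>\<^sub>M borel) (\<lambda>\<omega>. (Xs i \<omega>, Ys i \<omega>)))"
      using that by (subst (asm) M.indep_vars_iff_distr_eq_PiM') (auto simp: rv)
    also have "\<dots> = KR.P n"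
      unfolding KR.P_def by (intro PiM_cong refl) (simp add: Q_def ident)
    finally show ?thesis .
  qed
  have est: "?est n \<omega> = KR.estimator (r chi) n (?T n \<omega>)" if n: "n \<ge> 1" for n \<omega>
  proof -
    define c where "c = F (h n) powr l / KR.N n"
    have c: "c \<noteq> 0" using KR.Fh_pos [OF n] KR.N_pos [OF n] by (simp add: c_def)
    have coef: "KR.coef n i = c * (1 / F (h i) powr l)" if "i \<in> {1..n}" for i
      using that KR.Fh_pos [of i] KR.Fh_pos [OF n]
      by (simp add: KR.coef_def c_def powr_divide powr_minus field_simps)
    have "KR.D n (?T n \<omega>) = c * (\<Sum>i=1..n. 1 / F (h i) powr l * K (p (chi - Xs i \<omega>) / h i))"
      unfolding KR.D_def sum_distrib_left by (intro sum.cong refl) (simp add: coef KR.kern_def \<rho>_def)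
    moreover have "KR.estimator (r chi) n (?T n \<omega>)
        = c * (\<Sum>i=1..n. Ys i \<omega> / F (h i) powr l * K (p (chi - Xs i \<omega>) / h i)) / KR.D n (?T n \<omega>)"
      unfolding KR.estimator_def sum_distrib_left sum_divide_distrib
      by (intro sum.cong refl) (simp add: KR.w_def coef KR.kern_def \<rho>_def Z_def)
    ultimately show ?thesis
      using c by (simp add: recursive_estimator_def)
  qed
  have est_meas: "KR.estimator (r chi) n \<in> borel_measurable (KR.P n)" for n
    unfolding KR.estimator_def [abs_def] by measurable
  have transfer: "M.expectation (\<lambda>\<omega>. g (?est n \<omega>)) = KR.EP n (\<lambda>x. g (KR.estimator (r chi) n x))"
    if n: "n \<ge> 1" and g: "g \<in> borel_measurable borel" for n and g :: "real \<Rightarrow> real"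
  proof -
    have "(\<lambda>x. g (KR.estimator (r chi) n x)) \<in> borel_measurable (\<Pi>\<^sub>M i\<in>{1..n}. borel \<Otimes>\<^sub>M borel)"
      using measurable_compose [OF est_meas g, of n] by (simp add: distr_T [OF n, symmetric])
    from integral_distr [OF T_meas this] show ?thesis
      unfolding distr_T [OF n] est [OF n] by (rule sym)
  qed
  have mean: "M.expectation (?est n) = KR.EP n (KR.estimator (r chi) n)" if "n \<ge> 1" for n
    using transfer [OF that, of "\<lambda>x. x"] by simp
  have variance: "M.variance (?est n) = KR.P.variance n (KR.estimator (r chi) n)" if "n \<ge> 1" for n
    unfolding mean [OF that] by (rule transfer [OF that]) measurable
  define rest where "rest n = M.expectation (?est n) - r chi - KR.b n" for n
  have "rest \<in> O(\<lambda>n. 1 / (real n * F (h n)))"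
  proof -
    have "\<forall>\<^sub>F n in sequentially. KR.EP n (KR.estimator (r chi) n) - r chi - KR.b n = rest n"
      by (auto simp: rest_def mean intro!: eventually_sequentiallyI [of 1])
    from landau_o.big.in_cong [OF this] KR.estimator_bias [of "r chi"] show ?thesis by simp
  qed
  moreover have "leading_term (\<lambda>n. M.expectation (?est n) - r chi - rest n)
      (\<phi>'0 * (\<alpha> / \<beta> (1 - l)) * (M0 K \<tau>0 / M1 K \<tau>0)) h"
    using KR.b_lim h_pos
    by (intro leading_termI) (auto simp: rest_def intro!: eventually_sequentiallyI [of 1] less_imp_neq [symmetric])
  moreover have "leading_term (\<lambda>n. M.variance (?est n))
      (\<beta> (1 - 2 * l) / (\<beta> (1 - l))\<^sup>2 * (M2 K \<tau>0 / (M1 K \<tau>0)\<^sup>2) * \<sigma>2 chi) (\<lambda>n. 1 / (real n * F (h n)))"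
  proof (rule leading_termI)
    have "\<forall>\<^sub>F n in sequentially. KR.N n * KR.P.variance n (KR.estimator (r chi) n) =
        M.variance (?est n) / (1 / (real n * F (h n)))"
      by (auto simp: variance KR.N_def mult.commute intro!: eventually_sequentiallyI [of 1])
    with KR.estimator_variance [of "r chi"]
    show "(\<lambda>n. M.variance (?est n) / (1 / (real n * F (h n)))) \<longlonglongrightarrow>
        \<beta> (1 - 2 * l) / (\<beta> (1 - l))\<^sup>2 * (M2 K \<tau>0 / (M1 K \<tau>0)\<^sup>2) * \<sigma>2 chi"
      by (rule Lim_transform_eventually)
    show "\<forall>\<^sub>F n in sequentially. 1 / (real n * F (h n)) \<noteq> 0"
    proof (rule eventually_sequentiallyI [of 1])
      show "1 / (real n * F (h n)) \<noteq> 0" if "n \<ge> 1" for n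
        using KR.Fh_pos [OF that] that by simp
    qed
  qed
  ultimately show ?thesis by blast
qed

end
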